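(* Let $A$ be an infinite type I Baer $*$-factor that satisfies the EP (Existence of Projections) axiom. Then there is an infinite-dimensional separable real, complex, or quaternionic Hilbert space $H$ such that $A$ is $*$-isomorphic to the algebra of all bounded linear operators on $H$ (with the Hilbert-space adjoint as involution).
   Context: A **Baer $*$-ring** is a ring $A$ with identity carrying an involution $x\mapsto x^*$ (an additive map with $(xy)^*=y^*x^*$ and $x^{**}=x$) such that the right annihilator $\{x\in A: sx=0\ \forall s\in S\}$ of every nonempty subset $S\subseteq A$ has the form $eA$ for some projection $e\in A$. A **projection** is an element $e\in A$ with $e^2=e^*=e$. A **Baer $*$-factor** is a Baer $*$-ring whose only central projections are $0$ and $1$. Projections are partially ordered by $e\le f \iff ef=e$; projections $e,f$ are orthogonal when $ef=0$. A nonzero projection $e$ is **minimal** if every projection $f\le e$ is $0$ or $e$. A Baer $*$-factor is **type I** if it has a minimal projection. It is called **infinite** if it contains an infinite family of nonzero mutually orthogonal projections and every family of nonzero mutually orthogonal projections is at most countable. **EP axiom:** for every nonzero $x\in A$ there is $y=y^*\in A$ such that $y$ commutes with every element of $A$ that commutes with $xx^*$, and $xx^*y^2$ is a nonzero projection. Real, complex, quaternionic Hilbert spaces are Hilbert spaces over $\mathbb{R}$ (identity involution), $\mathbb{C}$ (complex conjugation), and the real quaternions $\mathbb{H}$ (quaternionic conjugation); they are regarded as left vector spaces, the inner product being linear in the first variable. *)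

theory Defs
  imports
    "HOL-Analysis.Abstract_Metric_Spaces"
    "HOL-Algebra.Module"
    "HOL-Algebra.Algebraic_Closure_Type"
begin

section \<open>Baer *-rings\<close>

text \<open>
  The ring is the type \<open>'a\<close>, with the involution as an explicit parameter. The class
  \<^class>\<open>ring_1\<close> includes \<open>0 \<noteq> 1\<close>; the zero ring has no nonzero projection, so it is
  neither infinite nor of type I in the sense below.
\<close>

locale star_ring =
  fixes star :: "'a::ring_1 \<Rightarrow> 'a"
  assumes star_add: "star (x + y) = star x + star y"
    and star_mult: "star (x * y) = star y * star x"
    and star_star: "star (star x) = x"

definition projection :: "('a::ring_1 \<Rightarrow> 'a) \<Rightarrow> 'a \<Rightarrow> bool"
  where "projection star e \<longleftrightarrow> e * e = e \<and> star e = e"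

definition right_annihilator :: "'a::ring_1 set \<Rightarrow> 'a set"
  where "right_annihilator S = {x. \<forall>s\<in>S. s * x = 0}"

locale baer_star_ring = star_ring +
  assumes right_annihilator_projection:
    "S \<noteq> {} \<Longrightarrow> \<exists>e. projection star e \<and> right_annihilator S = {e * x | x. True}"

locale baer_star_factor = baer_star_ring +
  assumes central_projection: "projection star e \<Longrightarrow> (\<And>x. e * x = x * e) \<Longrightarrow> e = 0 \<or> e = 1"

definition proj_le :: "'a::ring_1 \<Rightarrow> 'a \<Rightarrow> bool"
  where "proj_le e f \<longleftrightarrow> e * f = e"

definition minimal_projection :: "('a::ring_1 \<Rightarrow> 'a) \<Rightarrow> 'a \<Rightarrow> bool"
  where "minimal_projection star e \<longleftrightarrow>
    projection star e \<and> e \<noteq> 0 \<and> (\<forall>f. projection star f \<longrightarrow> proj_le f e \<longrightarrow> f = 0 \<or> f = e)"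

definition type_I :: "('a::ring_1 \<Rightarrow> 'a) \<Rightarrow> bool"
  where "type_I star \<longleftrightarrow> (\<exists>e. minimal_projection star e)"

text \<open>
  Families of nonzero mutually orthogonal projections are represented by their ranges: since
  \<open>e * e = e \<noteq> 0\<close>, the members of such a family are pairwise distinct.
\<close>

definition orthogonal_family :: "('a::ring_1 \<Rightarrow> 'a) \<Rightarrow> 'a set \<Rightarrow> bool"
  where "orthogonal_family star P \<longleftrightarrow>
    (\<forall>e\<in>P. projection star e \<and> e \<noteq> 0) \<and> (\<forall>e\<in>P. \<forall>f\<in>P. e \<noteq> f \<longrightarrow> e * f = 0)"

definition infinite_factor :: "('a::ring_1 \<Rightarrow> 'a) \<Rightarrow> bool"
  where "infinite_factor star \<longleftrightarrow>
    (\<exists>P. orthogonal_family star P \<and> infinite P) \<and>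
    (\<forall>P. orthogonal_family star P \<longrightarrow> countable P)"

definition EP_axiom :: "('a::ring_1 \<Rightarrow> 'a) \<Rightarrow> bool"
  where "EP_axiom star \<longleftrightarrow>
    (\<forall>x. x \<noteq> 0 \<longrightarrow>
      (\<exists>y. star y = y \<and>
           (\<forall>z. z * (x * star x) = (x * star x) * z \<longrightarrow> y * z = z * y) \<and>
           projection star (x * star x * y\<^sup>2) \<and> x * star x * y\<^sup>2 \<noteq> 0))"


section \<open>Real quaternions\<close>

codatatype quat = Quat (qRe: real) (qI: real) (qJ: real) (qK: real)

lemma quat_eq_iff: "x = y \<longleftrightarrow> qRe x = qRe y \<and> qI x = qI y \<and> qJ x = qJ y \<and> qK x = qK y"
  by (auto intro: quat.expand)

instantiation quat :: ab_group_add
begin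

primcorec zero_quat where
  "qRe 0 = 0" | "qI 0 = 0" | "qJ 0 = 0" | "qK 0 = 0"

primcorec plus_quat where
  "qRe (x + y) = qRe x + qRe y"
| "qI (x + y) = qI x + qI y"
| "qJ (x + y) = qJ x + qJ y"
| "qK (x + y) = qK x + qK y"

primcorec uminus_quat where
  "qRe (- x) = - qRe x" | "qI (- x) = - qI x" | "qJ (- x) = - qJ x" | "qK (- x) = - qK x"

primcorec minus_quat where
  "qRe (x - y) = qRe x - qRe y"
| "qI (x - y) = qI x - qI y"
| "qJ (x - y) = qJ x - qJ y"
| "qK (x - y) = qK x - qK y"

instance
  by standard (simp_all add: quat_eq_iff)

end

instantiation quat :: ring_1
begin

primcorec one_quat where
  "qRe 1 = 1" | "qI 1 = 0" | "qJ 1 = 0" | "qK 1 = 0"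

primcorec times_quat where
  "qRe (x * y) = qRe x * qRe y - qI x * qI y - qJ x * qJ y - qK x * qK y"
| "qI (x * y) = qRe x * qI y + qI x * qRe y + qJ x * qK y - qK x * qJ y"
| "qJ (x * y) = qRe x * qJ y - qI x * qK y + qJ x * qRe y + qK x * qI y"
| "qK (x * y) = qRe x * qK y + qI x * qJ y - qJ x * qI y + qK x * qRe y"

instance
  by standard (simp_all add: quat_eq_iff algebra_simps)

end

instantiation quat :: real_algebra_1
begin

primcorec scaleR_quat where
  "qRe (scaleR r x) = r * qRe x"
| "qI (scaleR r x) = r * qI x"
| "qJ (scaleR r x) = r * qJ x"
| "qK (scaleR r x) = r * qK x"

instance
  by standard (simp_all add: quat_eq_iff algebra_simps)

end

primcorec qcnj :: "quat \<Rightarrow> quat" where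
  "qRe (qcnj x) = qRe x" | "qI (qcnj x) = - qI x" | "qJ (qcnj x) = - qJ x" | "qK (qcnj x) = - qK x"

definition qnorm2 :: "quat \<Rightarrow> real"
  where "qnorm2 x = (qRe x)\<^sup>2 + (qI x)\<^sup>2 + (qJ x)\<^sup>2 + (qK x)\<^sup>2"

lemma qnorm2_eq_0_iff: "qnorm2 x = 0 \<longleftrightarrow> x = 0"
  by (simp add: qnorm2_def quat_eq_iff add_nonneg_eq_0_iff)

lemma qcnj_mult_self: "qcnj x * x = qnorm2 x *\<^sub>R 1" "x * qcnj x = qnorm2 x *\<^sub>R 1"
  by (simp_all add: qnorm2_def quat_eq_iff power2_eq_square)

instantiation quat :: real_div_algebra
begin

definition inverse_quat :: "quat \<Rightarrow> quat"
  where "inverse x = qcnj x /\<^sub>R qnorm2 x"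

definition divide_quat :: "quat \<Rightarrow> quat \<Rightarrow> quat"
  where "x div y = x * inverse y" for x y :: quat

instance
proof
  fix x y :: quat
  show "x \<noteq> 0 \<Longrightarrow> inverse x * x = 1" "x \<noteq> 0 \<Longrightarrow> x * inverse x = 1"
    by (simp_all add: inverse_quat_def qcnj_mult_self qnorm2_eq_0_iff)
  show "x div y = x * inverse y" by (fact divide_quat_def)
  show "inverse (0::quat) = 0" by (simp add: inverse_quat_def quat_eq_iff)
qed

end

instantiation quat :: real_normed_div_algebra
begin

definition norm_quat :: "quat \<Rightarrow> real"
  where "norm x = sqrt ((qRe x)\<^sup>2 + (qI x)\<^sup>2 + (qJ x)\<^sup>2 + (qK x)\<^sup>2)"

definition sgn_quat :: "quat \<Rightarrow> quat"
  where "sgn x = x /\<^sub>R norm x" for x :: quat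

definition dist_quat :: "quat \<Rightarrow> quat \<Rightarrow> real"
  where "dist x y = norm (x - y)" for x y :: quat

definition uniformity_quat [code del]:
  "(uniformity :: (quat \<times> quat) filter) = (INF e\<in>{0 <..}. principal {(x, y). dist x y < e})"

definition open_quat [code del]:
  "open (U :: quat set) \<longleftrightarrow> (\<forall>x\<in>U. eventually (\<lambda>(x', y). x' = x \<longrightarrow> y \<in> U) uniformity)"

instance
proof
  fix r :: real and x y :: quat and S :: "quat set"
  have norm_pair: "norm z = norm ((qRe z, qI z), (qJ z, qK z))" for z
    by (simp add: norm_quat_def norm_Pair)
  show "norm x = 0 \<longleftrightarrow> x = 0"
    by (simp add: norm_pair quat_eq_iff zero_prod_def)
  show "norm (x + y) \<le> norm x + norm y"
    using norm_triangle_ineq[of "((qRe x, qI x), (qJ x, qK x))" "((qRe y, qI y), (qJ y, qK y))"]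
    by (simp add: norm_pair)
  show "norm (scaleR r x) = \<bar>r\<bar> * norm x"
    using norm_scaleR[of r "((qRe x, qI x), (qJ x, qK x))"] by (simp add: norm_pair)
  show "norm (x * y) = norm x * norm y"
    by (simp add: norm_quat_def real_sqrt_mult [symmetric] power2_eq_square algebra_simps)
qed (rule sgn_quat_def dist_quat_def open_quat uniformity_quat)+

end


section \<open>Hilbert spaces over the reals, the complex numbers and the quaternions\<close>

class conj_scalar = real_normed_div_algebra +
  fixes sconj :: "'a \<Rightarrow> 'a"
  assumes sconj_add: "sconj (x + y) = sconj x + sconj y"
    and sconj_mult: "sconj (x * y) = sconj y * sconj x"
    and sconj_sconj: "sconj (sconj x) = x"
    and mult_sconj: "x * sconj x = (norm x)\<^sup>2 *\<^sub>R 1"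

instantiation real :: conj_scalar
begin
definition sconj_real :: "real \<Rightarrow> real" where "sconj x = x" for x :: real
instance by standard (simp_all add: sconj_real_def power2_eq_square)
end

instantiation complex :: conj_scalar
begin
definition sconj_complex :: "complex \<Rightarrow> complex" where "sconj = cnj"
instance
  by standard (simp_all add: sconj_complex_def complex_norm_square[symmetric] scaleR_conv_of_real
      del: of_real_power)
end

instantiation quat :: conj_scalar
begin
definition sconj_quat :: "quat \<Rightarrow> quat" where "sconj = qcnj"
instance
  by standard
    (simp_all add: sconj_quat_def quat_eq_iff norm_quat_def power2_eq_square algebra_simps)
end

text \<open>
  Vector spaces are records with an explicit carrier, so that the existence of a space can be
  asserted. HOL cannot quantify existentially over types; when a Hilbert space is asserted to
  exist for a ring \<open>'a\<close>, its vectors are drawn from the type \<open>'a\<close> itself. This is no restriction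
  up to isomorphism: for a nonzero vector \<open>v\<close> the operators \<open>x \<mapsto> \<langle>x, v\<rangle> w\<close> embed the space of
  all \<open>w\<close> into the ring of bounded operators. The ring multiplication and unit of the record
  are ignored, as for modules in \<open>HOL-Algebra\<close>.
\<close>

record ('k, 'v) inner_space = "('k, 'v) module" +
  ip :: "'v \<Rightarrow> 'v \<Rightarrow> 'k"

definition hnorm :: "('k::conj_scalar, 'v, 'm) inner_space_scheme \<Rightarrow> 'v \<Rightarrow> real"
  where "hnorm H x = sqrt (norm (ip H x x))"

text \<open>
  The locale \<^locale>\<open>Metric_space\<close> asks for symmetry on the whole type, hence the value \<open>0\<close>
  outside the carrier.
\<close>

definition hdist :: "('k::conj_scalar, 'v, 'm) inner_space_scheme \<Rightarrow> 'v \<Rightarrow> 'v \<Rightarrow> real"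
  where "hdist H x y =
    (if x \<in> carrier H \<and> y \<in> carrier H then hnorm H (x \<ominus>\<^bsub>H\<^esub> y) else 0)"

locale left_inner_product_space = abelian_group H
  for H :: "('k::conj_scalar, 'v, 'm) inner_space_scheme" (structure) +
  assumes smult_closed: "x \<in> carrier H \<Longrightarrow> a \<odot> x \<in> carrier H"
    and smult_l_distr: "x \<in> carrier H \<Longrightarrow> (a + b) \<odot> x = a \<odot> x \<oplus> b \<odot> x"
    and smult_r_distr: "x \<in> carrier H \<Longrightarrow> y \<in> carrier H \<Longrightarrow> a \<odot> (x \<oplus> y) = a \<odot> x \<oplus> a \<odot> y"
    and smult_assoc: "x \<in> carrier H \<Longrightarrow> (a * b) \<odot> x = a \<odot> (b \<odot> x)"
    and smult_one: "x \<in> carrier H \<Longrightarrow> 1 \<odot> x = x"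
    and ip_add_left: "x \<in> carrier H \<Longrightarrow> y \<in> carrier H \<Longrightarrow> z \<in> carrier H \<Longrightarrow>
          ip H (x \<oplus> y) z = ip H x z + ip H y z"
    and ip_smult_left: "x \<in> carrier H \<Longrightarrow> y \<in> carrier H \<Longrightarrow> ip H (a \<odot> x) y = a * ip H x y"
    and ip_sym: "x \<in> carrier H \<Longrightarrow> y \<in> carrier H \<Longrightarrow> ip H y x = sconj (ip H x y)"
    and ip_pos: "x \<in> carrier H \<Longrightarrow> x \<noteq> \<zero> \<Longrightarrow> \<exists>r>0. ip H x x = of_real r"
begin

lemma ip_add_right:
  assumes "x \<in> carrier H" "y \<in> carrier H" "z \<in> carrier H"
  shows "ip H z (x \<oplus> y) = ip H z x + ip H z y"
proof -
  have "ip H z (x \<oplus> y) = sconj (ip H x z + ip H y z)"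
    using assms by (simp add: ip_sym[of "x \<oplus> y" z] ip_add_left)
  then show ?thesis
    using assms by (simp add: sconj_add ip_sym[of x z] ip_sym[of y z])
qed

lemma ip_smult_right:
  assumes "x \<in> carrier H" "y \<in> carrier H"
  shows "ip H x (a \<odot> y) = ip H x y * sconj a"
proof -
  have "ip H x (a \<odot> y) = sconj (a * ip H y x)"
    using assms by (simp add: ip_sym[of "a \<odot> y" x] ip_smult_left smult_closed)
  then show ?thesis
    using assms by (simp add: sconj_mult ip_sym[of y x])
qed

lemma ip_zero_left: "x \<in> carrier H \<Longrightarrow> ip H \<zero> x = 0"
  using ip_add_left[of \<zero> \<zero> x] by simp

lemma ip_self: "x \<in> carrier H \<Longrightarrow> ip H x x = of_real ((hnorm H x)\<^sup>2)"
  using ip_pos[of x] ip_zero_left[of x] by (cases "x = \<zero>") (auto simp: hnorm_def)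

lemma hnorm_eq_0_iff: "x \<in> carrier H \<Longrightarrow> hnorm H x = 0 \<longleftrightarrow> x = \<zero>"
  using ip_pos[of x] ip_zero_left[of x] by (cases "x = \<zero>") (auto simp: hnorm_def)

lemma hnorm_nonneg: "0 \<le> hnorm H x"
  by (simp add: hnorm_def)

lemma smult_minus_one:
  assumes "x \<in> carrier H" shows "(-1) \<odot> x = \<ominus> x"
proof -
  have z: "0 \<odot> x = \<zero>"
  proof -
    have cl: "0 \<odot> x \<in> carrier H" using assms by (rule smult_closed)
    have "0 \<odot> x \<oplus> 0 \<odot> x = 0 \<odot> x \<oplus> \<zero>"
      unfolding smult_l_distr[OF assms, symmetric] using cl by simp
    then show ?thesis using cl by (metis add.l_cancel zero_closed)
  qed
  have "(-1) \<odot> x \<oplus> x = \<zero>"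
    using smult_l_distr[OF assms, of "-1" 1] z by (simp add: smult_one assms)
  then show ?thesis
    by (simp add: assms minus_equality smult_closed)
qed

lemma hnorm_minus:
  assumes x: "x \<in> carrier H" shows "hnorm H (\<ominus> x) = hnorm H x"
proof -
  have "norm (sconj (-1 :: 'k)) = 1"
    using mult_sconj[of "-1 :: 'k"] by (metis norm_minus_cancel norm_mult norm_one mult_1
        norm_scaleR one_power2 abs_one)
  moreover have "ip H (\<ominus> x) (\<ominus> x) = -1 * (ip H x x * sconj (-1))"
    using x smult_closed[OF x, of "-1"]
    by (simp only: smult_minus_one[OF x, symmetric] ip_smult_left ip_smult_right mult.assoc)
  ultimately show ?thesis
    by (simp add: hnorm_def norm_mult)
qed

lemma hnorm_add_sq:
  assumes "x \<in> carrier H" "y \<in> carrier H"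
  shows "of_real ((hnorm H (x \<oplus> y))\<^sup>2) =
    of_real ((hnorm H x)\<^sup>2) + ip H x y + ip H y x + of_real ((hnorm H y)\<^sup>2)"
proof -
  have "of_real ((hnorm H (x \<oplus> y))\<^sup>2) = ip H (x \<oplus> y) (x \<oplus> y)"
    using assms by (intro ip_self[symmetric]) simp
  also have "\<dots> = (ip H x x + ip H x y) + (ip H y x + ip H y y)"
    using assms by (simp add: ip_add_left ip_add_right)
  also have "\<dots> = ip H x x + ip H x y + ip H y x + ip H y y"
    by (simp only: ab_semigroup_add_class.add_ac)
  finally show ?thesis
    unfolding ip_self[OF assms(1)] ip_self[OF assms(2)] .
qed

lemma Cauchy_Schwarz:
  assumes x: "x \<in> carrier H" and y: "y \<in> carrier H"
  shows "norm (ip H x y) \<le> hnorm H x * hnorm H y"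
proof (cases "y = \<zero>")
  case True
  then show ?thesis
    using ip_smult_right[of x \<zero> 0] ip_add_right[of \<zero> \<zero> x] x by (simp add: hnorm_nonneg)
next
  case False
  define s where "s = (hnorm H y)\<^sup>2"
  have s: "s > 0" using False y hnorm_eq_0_iff hnorm_nonneg[of y] by (simp add: s_def)
  define a where "a = ip H x y"
  define c where "c = - (a /\<^sub>R s)"
  have cy: "c \<odot> y \<in> carrier H" using y smult_closed by simp
  have ss: "a * sconj a = of_real ((norm a)\<^sup>2)" for a :: 'k
    by (simp add: mult_sconj scaleR_conv_of_real)
  have sc: "sconj (r *\<^sub>R b) = r *\<^sub>R sconj b" if "b \<noteq> 0" for r and b :: 'k
  proof -
    have "(r *\<^sub>R b) * sconj (r *\<^sub>R b) = (r *\<^sub>R b) * (r *\<^sub>R sconj b)"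
      by (simp add: mult_sconj power_mult_distrib power2_eq_square)
    then have "r = 0 \<or> sconj (r *\<^sub>R b) = r *\<^sub>R sconj b"
      using that by (metis mult_left_cancel scaleR_eq_0_iff)
    then show ?thesis
      using sconj_add[of "0::'k" 0] by auto
  qed
  have c: "c = (- inverse s) *\<^sub>R a" by (simp add: c_def)
  have scc: "sconj c = (- inverse s) *\<^sub>R sconj a"
  proof (cases "a = 0")
    case True
    have "sconj (0::'k) = 0" by (metis add_cancel_right_left sconj_add)
    then show ?thesis unfolding c True by simp
  next
    case False
    then show ?thesis unfolding c by (rule sc)
  qed
  have yx: "ip H y x = sconj a" unfolding a_def by (rule ip_sym[OF x y])
  have nc: "ip H (c \<odot> y) (c \<odot> y) = of_real ((norm a)\<^sup>2 / s)"
  proof -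
    have "ip H (c \<odot> y) (c \<odot> y) = c * (of_real s * sconj c)"
      unfolding ip_smult_left[OF y cy] ip_smult_right[OF y y] ip_self[OF y] s_def ..
    also have "\<dots> = (s * inverse s * inverse s) *\<^sub>R (a * sconj a)"
      unfolding scc unfolding c
      by (simp only: of_real_def mult_scaleR_left mult_scaleR_right scaleR_scaleR mult_1)
         (simp add: mult_ac)
    also have "\<dots> = of_real ((norm a)\<^sup>2 / s)"
      using s unfolding ss by (simp add: scaleR_conv_of_real divide_inverse del: of_real_power
          flip: of_real_mult of_real_inverse)
    finally show ?thesis .
  qed
  have x1: "ip H x (c \<odot> y) = of_real (- (norm a)\<^sup>2 / s)"
    unfolding ip_smult_right[OF x y] a_def[symmetric] scc mult_scaleR_right ss
    by (simp add: scaleR_conv_of_real divide_inverse mult_ac)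
  have x2: "ip H (c \<odot> y) x = of_real (- (norm a)\<^sup>2 / s)"
    unfolding ip_smult_left[OF y x] yx c mult_scaleR_left ss
    by (simp add: scaleR_conv_of_real divide_inverse mult_ac)
  have "of_real ((hnorm H (x \<oplus> c \<odot> y))\<^sup>2) =
      (of_real ((hnorm H x)\<^sup>2 + - (norm a)\<^sup>2 / s + - (norm a)\<^sup>2 / s + (norm a)\<^sup>2 / s) :: 'k)"
    using hnorm_add_sq[OF x cy] x1 x2 nc cy by (simp only: ip_self[symmetric] of_real_add)
  then have "(hnorm H (x \<oplus> c \<odot> y))\<^sup>2 = (hnorm H x)\<^sup>2 - (norm a)\<^sup>2 / s"
    unfolding of_real_eq_iff by simp
  then have "(norm a)\<^sup>2 / s \<le> (hnorm H x)\<^sup>2"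
    by (metis diff_ge_0_iff_ge zero_le_power2)
  then have "(norm a)\<^sup>2 \<le> (hnorm H x * hnorm H y)\<^sup>2"
    using s by (simp add: s_def power_mult_distrib divide_le_eq)
  then show ?thesis
    unfolding a_def by (rule power2_le_imp_le) (simp add: hnorm_nonneg)
qed

lemma hnorm_triangle:
  assumes x: "x \<in> carrier H" and y: "y \<in> carrier H"
  shows "hnorm H (x \<oplus> y) \<le> hnorm H x + hnorm H y"
proof -
  have "(hnorm H (x \<oplus> y))\<^sup>2 = norm (of_real ((hnorm H (x \<oplus> y))\<^sup>2) :: 'k)"
    by (simp del: of_real_power)
  also have "\<dots> \<le> (hnorm H x)\<^sup>2 + norm (ip H x y) + norm (ip H y x) + (hnorm H y)\<^sup>2"
    unfolding hnorm_add_sq[OF x y]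
    by (intro order.trans[OF norm_triangle_ineq] add_mono) (simp_all del: of_real_power)
  also have "\<dots> \<le> (hnorm H x + hnorm H y)\<^sup>2"
    using Cauchy_Schwarz[OF x y] Cauchy_Schwarz[OF y x] by (simp add: power2_sum mult_ac)
  finally show ?thesis
    by (rule power2_le_imp_le) (simp add: hnorm_nonneg)
qed

sublocale Metric_space "carrier H" "hdist H"
proof
  fix x y z
  show "0 \<le> hdist H x y" by (simp add: hdist_def hnorm_nonneg)
  show "hdist H x y = hdist H y x"
    using hnorm_minus[of "x \<ominus> y"]
    by (auto simp: hdist_def minus_eq minus_add a_comm)
  show "hdist H x y = 0 \<longleftrightarrow> x = y" if "x \<in> carrier H" "y \<in> carrier H"
  proof -
    have "x = y" if "x \<ominus> y = \<zero>"
      using \<open>x \<in> carrier H\<close> \<open>y \<in> carrier H\<close> that minus_equality[of x "\<ominus> y"]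
      by (simp add: minus_eq)
    then show ?thesis
      using that by (auto simp: hdist_def hnorm_eq_0_iff minus_eq r_neg)
  qed
  show "hdist H x z \<le> hdist H x y + hdist H y z"
    if "x \<in> carrier H" "y \<in> carrier H" "z \<in> carrier H"
  proof -
    have "x \<ominus> z = (x \<ominus> y) \<oplus> (y \<ominus> z)"
      using that by (simp add: minus_eq a_assoc r_neg1)
    then show ?thesis
      using that hnorm_triangle[of "x \<ominus> y" "y \<ominus> z"] by (simp add: hdist_def)
  qed
qed

end

locale left_hilbert_space = left_inner_product_space +
  assumes complete: "Metric_space.mcomplete (carrier H) (hdist H)"

definition separable :: "('k::conj_scalar, 'v, 'm) inner_space_scheme \<Rightarrow> bool"
  where "separable H \<longleftrightarrow> separable_space (Metric_space.mtopology (carrier H) (hdist H))"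

definition linear_subspace :: "('k, 'v, 'm) module_scheme \<Rightarrow> 'v set \<Rightarrow> bool"
  where "linear_subspace H W \<longleftrightarrow> W \<subseteq> carrier H \<and> \<zero>\<^bsub>H\<^esub> \<in> W \<and>
    (\<forall>x\<in>W. \<forall>y\<in>W. x \<oplus>\<^bsub>H\<^esub> y \<in> W) \<and> (\<forall>a. \<forall>x\<in>W. a \<odot>\<^bsub>H\<^esub> x \<in> W)"

definition infinite_dimensional :: "('k, 'v, 'm) module_scheme \<Rightarrow> bool"
  where "infinite_dimensional H \<longleftrightarrow>
    \<not> (\<exists>B. finite B \<and> B \<subseteq> carrier H \<and> linear_subspace H hull B = carrier H)"


section \<open>The *-ring of bounded operators\<close>

text \<open>Operators are made extensional, so that equality of operators is equality on the carrier.\<close>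

definition bounded_operators :: "('k::conj_scalar, 'v, 'm) inner_space_scheme \<Rightarrow> ('v \<Rightarrow> 'v) set"
  where "bounded_operators H = {T \<in> carrier H \<rightarrow>\<^sub>E carrier H.
    (\<forall>x\<in>carrier H. \<forall>y\<in>carrier H. T (x \<oplus>\<^bsub>H\<^esub> y) = T x \<oplus>\<^bsub>H\<^esub> T y) \<and>
    (\<forall>a. \<forall>x\<in>carrier H. T (a \<odot>\<^bsub>H\<^esub> x) = a \<odot>\<^bsub>H\<^esub> T x) \<and>
    (\<exists>K. \<forall>x\<in>carrier H. hnorm H (T x) \<le> K * hnorm H x)}"

definition operator_ring :: "('k::conj_scalar, 'v, 'm) inner_space_scheme \<Rightarrow> ('v \<Rightarrow> 'v) ring"
  where "operator_ring H =
    \<lparr>carrier = bounded_operators H,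
     monoid.mult = compose (carrier H),
     one = (\<lambda>x\<in>carrier H. x),
     zero = (\<lambda>x\<in>carrier H. \<zero>\<^bsub>H\<^esub>),
     add = (\<lambda>S T. \<lambda>x\<in>carrier H. S x \<oplus>\<^bsub>H\<^esub> T x)\<rparr>"

definition hadjoint :: "('k::conj_scalar, 'v, 'm) inner_space_scheme \<Rightarrow> ('v \<Rightarrow> 'v) \<Rightarrow> 'v \<Rightarrow> 'v"
  where "hadjoint H T = (THE S. S \<in> bounded_operators H \<and>
    (\<forall>x\<in>carrier H. \<forall>y\<in>carrier H. ip H (T x) y = ip H x (S y)))"

definition star_isomorphic_operators ::
    "('a::ring_1 \<Rightarrow> 'a) \<Rightarrow> ('k::conj_scalar, 'v, 'm) inner_space_scheme \<Rightarrow> bool"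
  where "star_isomorphic_operators star H \<longleftrightarrow>
    (\<exists>\<phi> \<in> ring_iso ring_of_type_algebra (operator_ring H).
      \<forall>a. \<phi> (star a) = hadjoint H (\<phi> a))"

end

(*
  Let e be a minimal projection. By EP every nonzero element of D = eAe is invertible, and
  H = eA is a left vector space over D with the anisotropic form <x, y> = x * star y, on which A
  acts by right multiplication. EP moreover gives <x, x> = z^2 with z symmetric and in the
  bicommutant of <x, x>, so every nonzero vector can be normalized. The Baer condition provides
  orthogonal projections onto closed subspaces, and hence symmetries in A that exchange two
  mutually orthogonal orthonormal sequences.

  As in Soler's theorem, such symmetries decide which infinite sums of orthonormal vectors
  exist. For symmetric a with a^2 /= 1 one of the sums of a^i f_i and a^-i f_i exists, and its norm
  is a geometric series, which makes the symmetric scalars totally ordered; the sum of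
  f_n / sqrt ((n + 1) (n + 2)) exists, which makes them Archimedean. So they embed into the real
  numbers, are fixed by conjugation with unitary scalars and therefore central, and projections
  of the sum of 2^(-i/2) f_i realize every real number. Now D is the real, complex or
  quaternionic field by the argument of Frobenius.

  Dominated sums exist, so H is complete; right multiplications are bounded by the uniform
  boundedness principle; and a bounded operator between two of three blocks of an orthonormal
  basis is, up to a scalar, a corner of a symmetry of the above kind.
*)

theory Submission
  imports Defs
begin

text \<open>\<open>A\<close> carries no topology, so a sum of the \<open>c i * f i\<close> can only
  mean a vector in the biorthogonal of the \<open>f i\<close> with coordinates \<open>c i\<close>.
  Such a vector is unique; its existence is the question behind most of the proof. Symmetries that
  exchange sequences exist only between mutually orthogonal ones, hence the spare sequence
  \<open>k\<close> in many lemmas and the splitting of index sets modulo 3.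

  That one of the two geometric sums exists comes from a dichotomy: if no vector has the coordinates
  \<open>c i\<close>, then the vectors that would be orthogonal to it span everything,
  \<open>f 0\<close> included, and this produces a unit vector with other, explicit coordinates. If
  the dichotomy ended this way for the powers of \<open>a\<close> and of its inverse, there would be
  unit vectors \<open>x\<close> and \<open>y\<close> with \<open>x = a * y\<close>, against
  \<open>a * a \<noteq> e\<close>.

  Symmetric scalars are not known to commute before they are embedded into the real numbers. Until
  then the bicommutant clause of EP takes the place of commutativity.\<close>

context star_ring
begin

lemma star_0 [simp]: "star 0 = 0"
  using star_add[of 0 0] by simp

lemma star_minus: "star (- x) = - star x"
  using star_add[of x "- x"] by (simp add: eq_neg_iff_add_eq_0 add.commute)

lemma star_diff: "star (x - y) = star x - star y"
  using star_add[of x "- y"] by (simp add: star_minus)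

lemma star_1 [simp]: "star 1 = 1"
  by (metis mult_1 mult_1_right star_mult star_star)

lemma star_sum: "star (sum f A) = (\<Sum>i\<in>A. star (f i))"
  by (induction A rule: infinite_finite_induct) (simp_all add: star_add)

lemma star_eq_0_iff [simp]: "star x = 0 \<longleftrightarrow> x = 0"
  by (metis star_0 star_star)

lemma projection_compl: "projection star p \<Longrightarrow> projection star (1 - p)"
  by (simp add: projection_def star_diff algebra_simps)

lemma projection_0 [simp]: "projection star 0"
  by (simp add: projection_def)

end

section \<open>Projections obtained from annihilators\<close>

context baer_star_ring
begin

text \<open>The annihilator of \<open>x\<close> is generated by a projection \<open>g\<close>, and
  \<open>star x\<close> lies in it; hence \<open>x = x * g = 0\<close>.\<close>

lemma proper: "x * star x = 0 \<Longrightarrow> x = 0"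
proof -
  assume a: "x * star x = 0"
  obtain g where g: "projection star g" "right_annihilator {x} = {g * y | y. True}"
    using right_annihilator_projection[of "{x}"] by auto
  have "star x \<in> right_annihilator {x}"
    using a by (simp add: right_annihilator_def)
  then obtain y where y: "star x = g * y" using g by auto
  have gg: "g * g = g" "star g = g" using g by (auto simp: projection_def)
  have "star x = g * star x" using y gg by (metis mult.assoc)
  then have "x = x * g" using gg by (metis star_mult star_star)
  moreover have "x * g = 0"
  proof -
    have "g \<in> right_annihilator {x}" using g gg by (metis (mono_tags, lifting) mem_Collect_eq)
    then show ?thesis by (simp add: right_annihilator_def)
  qed
  ultimately show "x = 0" by simp
qed

text \<open>\<open>p\<close> is the complement of the projection that generates the right
  annihilator of \<open>M\<close>, so it projects onto the biorthogonal of \<open>M\<close>. The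
  empty set is separate because the Baer condition speaks of nonempty sets.\<close>

lemma closed_span_projection:
  obtains p where "projection star p" "\<And>x. x \<in> M \<Longrightarrow> x * p = x"
    "\<And>y. (\<And>x. x \<in> M \<Longrightarrow> x * star y = 0) \<Longrightarrow> y * p = 0"
proof (cases "M = {}")
  case True
  then show ?thesis using that[of 0] by simp
next
  case False
  then obtain g where g: "projection star g" "right_annihilator M = {g * y | y. True}"
    using right_annihilator_projection by blast
  have gg: "g * g = g" "star g = g" using g by (auto simp: projection_def)
  have g0: "x * g = 0" if "x \<in> M" for x
  proof -
    have "g \<in> right_annihilator M" using g gg by (metis (mono_tags, lifting) mem_Collect_eq)
    then show ?thesis using that by (simp add: right_annihilator_def)
  qed
  have "y * (1 - g) = 0" if y: "\<And>x. x \<in> M \<Longrightarrow> x * star y = 0" for y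
  proof -
    have "star y \<in> right_annihilator M" using y by (simp add: right_annihilator_def)
    then obtain z where "star y = g * z" using g by auto
    then have "star y = g * star y" using gg by (metis mult.assoc)
    then have "y = y * g" using gg by (metis star_mult star_star)
    then show ?thesis by (simp add: algebra_simps)
  qed
  then show ?thesis
    using that[of "1 - g"] projection_compl[OF g(1)] g0 by (simp add: algebra_simps)
qed

end

text \<open>The right annihilator of \<open>e A\<close> absorbs multiplication from the left, so its
  generating projection \<open>g\<close> satisfies \<open>y * g = g * y * g\<close>. Applied to
  \<open>star y\<close> as well, this makes \<open>g\<close> central, hence 0 or 1, and 1 does not
  annihilate \<open>e\<close>.\<close>

lemma (in baer_star_factor) factor_annihilator:
  fixes e x :: 'a
  assumes e: "e \<noteq> 0" and x: "\<And>a. e * a * x = 0"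
  shows "x = 0"
proof -
  let ?M = "{e * a | a. True}"
  obtain g where g: "projection star g" "right_annihilator ?M = {g * y | y. True}"
    using right_annihilator_projection[of ?M] by blast
  have gg: "g * g = g" "star g = g" using g by (auto simp: projection_def)
  have iff: "(\<forall>a. e * a * y = 0) \<longleftrightarrow> y = g * y" for y
  proof -
    have "(\<forall>a. e * a * y = 0) \<longleftrightarrow> y \<in> right_annihilator ?M"
      by (auto simp: right_annihilator_def)
    also have "\<dots> \<longleftrightarrow> (\<exists>z. y = g * z)" using g by auto
    also have "\<dots> \<longleftrightarrow> y = g * y" using gg by (metis mult.assoc)
    finally show ?thesis .
  qed
  have c: "y * g = g * y * g" for y
  proof -
    have "e * a * g = 0" for a using iff[of g] gg by simp
    then have "\<forall>a. e * a * (y * g) = 0" by (metis mult.assoc)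
    then show ?thesis using iff[of "y * g"] by (simp add: mult.assoc)
  qed
  have "g * y = y * g" for y
  proof -
    have "star (star y * g) = star (g * star y * g)" using c[of "star y"] by simp
    then have "g * y = g * y * g" using gg by (simp add: star_mult star_star mult.assoc)
    then show ?thesis using c[of y] by simp
  qed
  then have "g = 0 \<or> g = 1" using central_projection g(1) by blast
  moreover have "g \<noteq> 1"
  proof
    assume "g = 1"
    then have "e * 1 * 1 = 0" using iff[of 1] by (metis mult_1)
    then show False using e by simp
  qed
  ultimately show ?thesis using iff[of x] x by simp
qed

section \<open>The division ring of a minimal projection\<close>

locale ep_factor = baer_star_factor star
  for star :: "'a::ring_1 \<Rightarrow> 'a" +
  fixes e :: 'a
  assumes infinite: "infinite_factor star"
    and EP: "EP_axiom star"
    and minimal: "minimal_projection star e"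
begin

definition D :: "'a set" where "D = {x. e * x = x \<and> x * e = x}"
definition H :: "'a set" where "H = {x. e * x = x}"
definition S :: "'a set" where "S = {x \<in> D. star x = x}"
text \<open>The future cone of nonnegative elements of \<open>S\<close>; that it orders
  \<open>S\<close> totally is \<open>S_total\<close>.\<close>

definition P :: "'a set" where "P = {x * star x | x. x \<in> H}"

lemma ee [simp]: "e * e = e" and star_e [simp]: "star e = e" and e_nz [simp]: "e \<noteq> 0"
  using minimal by (auto simp: minimal_projection_def projection_def)

lemma D_H: "x \<in> D \<Longrightarrow> x \<in> H" by (simp add: D_def H_def)
lemma S_D: "x \<in> S \<Longrightarrow> x \<in> D" and S_star: "x \<in> S \<Longrightarrow> star x = x" by (simp_all add: S_def)
lemma SI: "x \<in> D \<Longrightarrow> star x = x \<Longrightarrow> x \<in> S" by (simp add: S_def)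

lemma H_e: "x \<in> H \<Longrightarrow> e * x = x" by (simp add: H_def)
lemma H_e_star: "x \<in> H \<Longrightarrow> star x * e = star x" by (metis H_e star_e star_mult)
lemma D_e: "x \<in> D \<Longrightarrow> e * x = x" and D_e': "x \<in> D \<Longrightarrow> x * e = x" by (simp_all add: D_def)

lemma H_0 [simp]: "0 \<in> H" and D_0 [simp]: "0 \<in> D" and D_1 [simp]: "e \<in> D" and H_1 [simp]: "e \<in> H"
  and S_0 [simp]: "0 \<in> S" and S_1 [simp]: "e \<in> S"
  by (simp_all add: H_def D_def S_def)

lemma H_add [simp]: "x \<in> H \<Longrightarrow> y \<in> H \<Longrightarrow> x + y \<in> H"
  and H_diff [simp]: "x \<in> H \<Longrightarrow> y \<in> H \<Longrightarrow> x - y \<in> H"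
  and H_minus [simp]: "x \<in> H \<Longrightarrow> - x \<in> H"
  by (simp_all add: H_def algebra_simps)

lemma H_mult_right [simp]: "x \<in> H \<Longrightarrow> x * a \<in> H"
  by (simp add: H_def mult.assoc[symmetric])

lemma H_sum [simp]: "(\<And>i. i \<in> A \<Longrightarrow> f i \<in> H) \<Longrightarrow> sum f A \<in> H"
  by (induction A rule: infinite_finite_induct) simp_all

lemma D_add [simp]: "x \<in> D \<Longrightarrow> y \<in> D \<Longrightarrow> x + y \<in> D"
  and D_diff [simp]: "x \<in> D \<Longrightarrow> y \<in> D \<Longrightarrow> x - y \<in> D"
  and D_minus [simp]: "x \<in> D \<Longrightarrow> - x \<in> D"
  by (simp_all add: D_def algebra_simps)

lemma D_mult [simp]: "x \<in> D \<Longrightarrow> y \<in> D \<Longrightarrow> x * y \<in> D"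
  unfolding D_def by (simp add: mult.assoc) (simp add: mult.assoc[symmetric])

lemma D_mult_H [simp]: "x \<in> D \<Longrightarrow> y \<in> H \<Longrightarrow> x * y \<in> H"
  by (simp add: D_H)

lemma D_sum [simp]: "(\<And>i. i \<in> A \<Longrightarrow> f i \<in> D) \<Longrightarrow> sum f A \<in> D"
  by (induction A rule: infinite_finite_induct) simp_all

lemma D_star [simp]: "x \<in> D \<Longrightarrow> star x \<in> D"
  unfolding D_def by (simp, metis star_e star_mult)

lemma D_inner [simp]: "x \<in> H \<Longrightarrow> y \<in> H \<Longrightarrow> x * star y \<in> D"
  unfolding D_def by (simp add: H_e_star mult.assoc) (simp add: mult.assoc[symmetric] H_e)

lemma S_add [simp]: "x \<in> S \<Longrightarrow> y \<in> S \<Longrightarrow> x + y \<in> S"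
  and S_diff [simp]: "x \<in> S \<Longrightarrow> y \<in> S \<Longrightarrow> x - y \<in> S"
  and S_minus [simp]: "x \<in> S \<Longrightarrow> - x \<in> S"
  by (simp_all add: S_def star_add star_diff star_minus)

lemma S_mult: "x \<in> S \<Longrightarrow> y \<in> S \<Longrightarrow> x * y = y * x \<Longrightarrow> x * y \<in> S"
  by (simp add: S_def star_mult)

lemma S_norm [simp]: "x \<in> H \<Longrightarrow> x * star x \<in> S"
  by (simp add: S_def star_mult star_star)

lemma of_nat_D [simp]: "x \<in> D \<Longrightarrow> of_nat n * x \<in> D"
  by (induction n) (simp_all add: algebra_simps)

lemma of_nat_S [simp]: "x \<in> S \<Longrightarrow> of_nat n * x \<in> S"
  by (induction n) (simp_all add: algebra_simps)

lemma of_int_S [simp]: "x \<in> S \<Longrightarrow> of_int n * x \<in> S"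
  by (cases n rule: int_cases2) (simp_all)

lemma P_S: "x \<in> P \<Longrightarrow> x \<in> S"
  by (auto simp: P_def)

lemma P_norm [simp]: "x \<in> H \<Longrightarrow> x * star x \<in> P"
  by (auto simp: P_def)

lemma P_sq: "x \<in> S \<Longrightarrow> x * x \<in> P"
  using P_norm[of x] D_H[OF S_D] S_star by metis

lemma P_0 [simp]: "0 \<in> P" and P_1 [simp]: "e \<in> P"
  using P_norm[of 0] P_norm[of e] by simp_all

text \<open>With \<open>n = x * star x\<close>, the projection \<open>n * y\<^sup>2\<close> is
  nonzero and lies below the minimal \<open>e\<close>, so it equals \<open>e\<close>. Then
  \<open>n * y\<close> is a square root of \<open>n\<close>, and it commutes with whatever commutes
  with \<open>n\<close> because \<open>y\<close> does.\<close>

lemma EP_sqrt: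
  assumes "x \<in> H"
  obtains z where "z \<in> S" "z * z = x * star x"
    "\<And>c. c * (x * star x) = (x * star x) * c \<Longrightarrow> z * c = c * z"
proof (cases "x = 0")
  case True
  then show ?thesis using that[of 0] by simp
next
  case False
  define n where "n = x * star x"
  obtain y where y: "star y = y" "\<And>z. z * n = n * z \<Longrightarrow> y * z = z * y"
      "projection star (n * y\<^sup>2)" "n * y\<^sup>2 \<noteq> 0"
    using EP False unfolding EP_axiom_def n_def by (metis)
  have nS: "n \<in> S" using assms by (simp add: n_def)
  have en: "e * n = n" "n * e = n" "star n = n" using nS by (auto simp: S_def D_def)
  have ye: "y * e = e * y" using y(2)[of e] en by simp
  have yn: "y * n = n * y" using y(2)[of n] by simp
  have "(n * y\<^sup>2) * e = n * y\<^sup>2"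
    using en ye by (simp add: power2_eq_square mult.assoc) (metis mult.assoc)
  then have "n * y\<^sup>2 = e"
    using minimal y(3,4) unfolding minimal_projection_def proj_le_def by blast
  then have nyy: "n * y * y = e" by (simp add: power2_eq_square mult.assoc)
  let ?z = "n * y"
  have "?z \<in> S"
    using en y(1) yn ye by (auto simp: S_def D_def star_mult mult.assoc[symmetric]) (metis mult.assoc)
  moreover have "?z * ?z = n"
    using nyy en yn by (metis mult.assoc)
  moreover have "?z * c = c * ?z" if "c * n = n * c" for c
    using y(2)[of c] that by (metis mult.assoc)
  ultimately show ?thesis using that unfolding n_def by blast
qed

lemma P_sqrt:
  assumes "s \<in> P"
  obtains z where "z \<in> S" "z * z = s" "\<And>c. c * s = s * c \<Longrightarrow> z * c = c * z"
  using assms EP_sqrt unfolding P_def by blast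

lemma D_right_inverse:
  assumes "x \<in> D" "x \<noteq> 0"
  obtains y where "y \<in> D" "x * y = e"
proof -
  obtain y where y: "projection star (x * star x * y\<^sup>2)" "x * star x * y\<^sup>2 \<noteq> 0"
      "\<And>z. z * (x * star x) = x * star x * z \<Longrightarrow> y * z = z * y"
    using EP assms unfolding EP_axiom_def by metis
  have "x * star x \<in> D" using assms D_H by simp
  then have en: "e * (x * star x) = x * star x" "x * star x * e = x * star x"
    by (auto simp: D_def)
  have ye: "y * e = e * y" using y(3)[of e] en by simp
  have "(x * star x * y\<^sup>2) * e = x * star x * y\<^sup>2"
    using en ye by (simp add: power2_eq_square mult.assoc) (metis mult.assoc)
  then have 1: "x * star x * y\<^sup>2 = e"
    using minimal y(1,2) unfolding minimal_projection_def proj_le_def by blast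
  have "star x * y\<^sup>2 * e \<in> D"
    using assms(1) D_star[of x] unfolding D_def by (simp add: mult.assoc) (simp add: mult.assoc[symmetric])
  moreover have "x * (star x * y\<^sup>2 * e) = e" using 1 by (simp add: mult.assoc[symmetric])
  ultimately show ?thesis using that by blast
qed

definition dinv :: "'a \<Rightarrow> 'a" where "dinv x = (SOME y. y \<in> D \<and> x * y = e \<and> y * x = e)"

lemma dinv:
  assumes "x \<in> D" "x \<noteq> 0"
  shows "dinv x \<in> D" "x * dinv x = e" "dinv x * x = e"
proof -
  obtain y where y: "y \<in> D" "x * y = e" using D_right_inverse assms by blast
  have "y \<noteq> 0" using y by auto
  \<comment> \<open>The right inverse \<open>y\<close> has a right inverse in turn, which must be
    \<open>x\<close>.\<close>
  then obtain z where z: "z \<in> D" "y * z = e" using D_right_inverse y by blast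
  have "x = x * (y * z)" using z assms by (simp add: D_e')
  also have "\<dots> = (x * y) * z" by (simp add: mult.assoc)
  also have "\<dots> = z" using y z by (simp add: D_e)
  finally have "y * x = e" using z by simp
  then have "\<exists>y. y \<in> D \<and> x * y = e \<and> y * x = e" using y by blast
  then have "dinv x \<in> D \<and> x * dinv x = e \<and> dinv x * x = e"
    unfolding dinv_def by (rule someI_ex)
  then show "dinv x \<in> D" "x * dinv x = e" "dinv x * x = e" by auto
qed

lemma dinv_cancel:
  assumes "x \<in> D" "x \<noteq> 0" "y \<in> H"
  shows "x * (dinv x * y) = y" "dinv x * (x * y) = y"
  using dinv[OF assms(1,2)] assms(3) by (simp_all add: mult.assoc[symmetric] H_e)

lemma dinv_cancel_right:
  assumes "x \<in> D" "x \<noteq> 0" "y \<in> D"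
  shows "y * x * dinv x = y" "y * dinv x * x = y"
  using dinv[OF assms(1,2)] assms(3) by (simp_all add: mult.assoc D_e')

lemma D_H_nz: "x \<in> D \<Longrightarrow> y \<in> H \<Longrightarrow> x * y = 0 \<Longrightarrow> x = 0 \<or> y = 0"
  using dinv_cancel(2)[of x y] by fastforce

lemma D_nz: "x \<in> D \<Longrightarrow> y \<in> D \<Longrightarrow> x \<noteq> 0 \<Longrightarrow> y \<noteq> 0 \<Longrightarrow> x * y \<noteq> 0"
  using D_H_nz D_H by blast

lemma dinv_nz: "x \<in> D \<Longrightarrow> x \<noteq> 0 \<Longrightarrow> dinv x \<noteq> 0"
  using dinv(2)[of x] by auto

lemma dinv_unique:
  assumes "x \<in> D" "y \<in> D" "x * y = e" shows "y = dinv x"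
proof -
  have "x \<noteq> 0" using assms by auto
  then have "dinv x * (x * y) = y" using dinv_cancel(2)[of x y] assms D_H by blast
  then show ?thesis using assms dinv[of x] \<open>x \<noteq> 0\<close> by (simp add: D_e')
qed

lemma dinv_star: "x \<in> D \<Longrightarrow> x \<noteq> 0 \<Longrightarrow> dinv (star x) = star (dinv x)"
  using dinv[of x] by (intro dinv_unique[symmetric]) (auto simp: star_mult[symmetric])

lemma dinv_S: "x \<in> S \<Longrightarrow> x \<noteq> 0 \<Longrightarrow> dinv x \<in> S"
  using dinv_star[of x] dinv[of x] by (simp add: S_def)

lemma dinv_commute:
  assumes "x \<in> D" "x \<noteq> 0" "c \<in> D" "x * c = c * x"
  shows "dinv x * c = c * dinv x"
proof -
  have "dinv x * c = dinv x * (c * x) * dinv x"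
    using assms dinv[of x] by (simp add: mult.assoc D_e')
  also have "\<dots> = dinv x * x * c * dinv x" using assms(4) by (simp add: mult.assoc)
  also have "\<dots> = c * dinv x" using assms dinv[of x] by (simp add: D_e)
  finally show ?thesis .
qed

lemma P_root:
  assumes "s \<in> P" "s \<noteq> 0"
  obtains z w where "z \<in> S" "w \<in> S" "z * z = s" "z * w = e" "w * z = e" "w * s * w = e"
    "\<And>c. c \<in> D \<Longrightarrow> c * s = s * c \<Longrightarrow> z * c = c * z \<and> w * c = c * w"
proof -
  obtain z where z: "z \<in> S" "z * z = s" "\<And>c. c * s = s * c \<Longrightarrow> z * c = c * z"
    using P_sqrt[OF assms(1)] by metis
  have z0: "z \<noteq> 0" using z(2) assms(2) by (metis mult_zero_left)
  note zD = S_D[OF z(1)] and i = dinv(2,3)[OF S_D[OF z(1)] z0]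
  have "dinv z * s * dinv z = (dinv z * z) * (z * dinv z)" unfolding z(2)[symmetric] by (simp add: mult.assoc)
  then have "dinv z * s * dinv z = e" using i by simp
  then show ?thesis
    using that[OF z(1) dinv_S[OF z(1) z0] z(2) i] dinv_commute[OF zD z0] z(3) by metis
qed

text \<open>Polar decomposition: \<open>z\<close> is the square root of the norm
  \<open>x * star x\<close> and \<open>w\<close> its inverse. The last clause keeps the bicommutant
  property of both, on which \<open>S_commute\<close> depends.\<close>

lemma normalize:
  assumes "x \<in> H" "x \<noteq> 0"
  obtains z w u where "z \<in> S" "w \<in> S" "u \<in> H" "u * star u = e" "x = z * u" "u = w * x"
    "\<And>c. c \<in> D \<Longrightarrow> c * (x * star x) = (x * star x) * c \<Longrightarrow> z * c = c * z \<and> w * c = c * w"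
proof -
  have "x * star x \<noteq> 0" using proper assms(2) by blast
  then obtain z w where zw: "z \<in> S" "w \<in> S" "z * w = e" "w * (x * star x) * w = e"
    "\<And>c. c \<in> D \<Longrightarrow> c * (x * star x) = (x * star x) * c \<Longrightarrow> z * c = c * z \<and> w * c = c * w"
    using P_root[OF P_norm[OF assms(1)]] by metis
  have 1: "(w * x) * star (w * x) = e" using zw(4) S_star[OF zw(2)] by (simp add: star_mult mult.assoc)
  have 2: "x = z * (w * x)" using zw(3) assms(1) by (simp add: mult.assoc[symmetric] H_e)
  show ?thesis by (rule that[OF zw(1,2) D_mult_H[OF S_D[OF zw(2)] assms(1)] 1 2 refl zw(5)])
qed

section \<open>Orthonormal families\<close>

definition orthonormal :: "('i \<Rightarrow> 'a) \<Rightarrow> bool" where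
  "orthonormal u \<longleftrightarrow> (\<forall>i. u i \<in> H) \<and> (\<forall>i j. u i * star (u j) = (if i = j then e else 0))"

lemma orthonormal_H [simp]: "orthonormal u \<Longrightarrow> u i \<in> H"
  by (simp add: orthonormal_def)

lemma orthonormalI:
  "(\<And>i. u i \<in> H) \<Longrightarrow> (\<And>i. u i * star (u i) = e) \<Longrightarrow>
    (\<And>i j. i \<noteq> j \<Longrightarrow> u i * star (u j) = 0) \<Longrightarrow> orthonormal u"
  unfolding orthonormal_def by metis

lemma orthonormal_norm: "orthonormal u \<Longrightarrow> u i * star (u i) = e"
  and orthonormal_orth: "orthonormal u \<Longrightarrow> i \<noteq> j \<Longrightarrow> u i * star (u j) = 0"
  unfolding orthonormal_def by metis+

lemma orthonormal_norm_left: "orthonormal u \<Longrightarrow> d * u i * star (u i) = d * e"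
  and orthonormal_orth_left: "orthonormal u \<Longrightarrow> i \<noteq> j \<Longrightarrow> d * u i * star (u j) = 0"
  by (simp_all add: orthonormal_norm orthonormal_orth mult.assoc)

lemmas orthonormal_simps =
  orthonormal_norm orthonormal_orth orthonormal_norm_left orthonormal_orth_left

lemma orthonormal_comp: "orthonormal u \<Longrightarrow> inj \<sigma> \<Longrightarrow> orthonormal (\<lambda>i. u (\<sigma> i))"
  by (intro orthonormalI) (simp_all add: orthonormal_simps inj_eq)

text \<open>There are infinitely many orthogonal projections \<open>f i\<close>. In a factor each
  \<open>e A f i\<close> is nonzero, so it contains a unit vector \<open>u i\<close>, and vectors
  with \<open>u i * f i = u i\<close> are mutually orthogonal.\<close>

lemma orthonormal_exists: obtains u :: "nat \<Rightarrow> 'a" where "orthonormal u"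
proof -
  obtain Q where Q: "orthogonal_family star Q" "infinite Q"
    using infinite by (auto simp: infinite_factor_def)
  obtain f :: "nat \<Rightarrow> 'a" where f: "inj f" "range f \<subseteq> Q"
    using infinite_countable_subset[OF Q(2)] by blast
  have fp: "projection star (f i)" "f i \<noteq> 0" "i \<noteq> j \<Longrightarrow> f i * f j = 0" for i j
    using Q(1) f unfolding orthogonal_family_def by (auto simp: inj_eq image_subset_iff)
  have "\<exists>u\<in>H. u * star u = e \<and> u * f i = u" for i
  proof -
    obtain a where a: "e * a * f i \<noteq> 0"
      using factor_annihilator[of e "f i"] fp(2) by auto
    have "e * a * f i \<in> H" by simp
    then obtain w u where u: "u \<in> H" "u * star u = e" "u = w * (e * a * f i)"
      using normalize[OF _ a] by metis
    have "f i * f i = f i" using fp(1)[of i] by (simp add: projection_def)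
    then have "u * f i = u" using u(3) by (simp add: mult.assoc)
    then show ?thesis using u by blast
  qed
  then obtain u where u: "\<And>i. u i \<in> H" "\<And>i. u i * star (u i) = e" "\<And>i. u i * f i = u i" by metis
  have "u i * star (u j) = 0" if "i \<noteq> j" for i j
  proof -
    have "u i * star (u j) = (u i * f i) * star (u j * f j)" using u by simp
    also have "\<dots> = u i * (f i * f j) * star (u j)"
      using fp(1)[of j] by (simp add: projection_def star_mult mult.assoc)
    also have "\<dots> = 0" using fp(3)[OF that] by simp
    finally show ?thesis .
  qed
  then have "orthonormal u" using u by (intro orthonormalI) auto
  then show ?thesis using that by blast
qed

section \<open>The cone of norms\<close>

lemma norm_0: "x \<in> H \<Longrightarrow> y \<in> H \<Longrightarrow> y * star x = 0 \<Longrightarrow> (x + y) * star (x + y) = x * star x + y * star y"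
  using star_mult[of y "star x"] by (simp add: star_add star_star algebra_simps)

text \<open>Two orthogonal unit vectors, scaled by square roots of \<open>s\<close> and
  \<open>t\<close>, add up to a vector of norm \<open>s + t\<close>.\<close>

lemma P_add [simp]: assumes "s \<in> P" "t \<in> P" shows "s + t \<in> P"
proof -
  obtain u :: "nat \<Rightarrow> 'a" where u: "orthonormal u" using orthonormal_exists .
  obtain z w where zw: "z \<in> S" "z * z = s" "w \<in> S" "w * w = t"
    using P_sqrt assms by metis
  let ?x = "z * u 0 + w * u 1"
  have zD: "z \<in> D" "w \<in> D" "star z = z" "star w = w" using zw S_def by auto
  have "?x * star ?x = z * e * z + w * e * w"
    using u zD by (simp add: star_add star_mult ring_distribs mult.assoc[symmetric] orthonormal_simps)
  also have "\<dots> = s + t" using zw zD by (simp add: D_e')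
  finally show ?thesis using P_norm[of ?x] u zD by simp
qed

text \<open>The vector built as in \<open>P_add\<close> from \<open>s\<close> and \<open>- s\<close>
  has norm 0, so it vanishes by \<open>proper\<close>, and its coordinate \<open>z\<close> with
  it.\<close>

lemma P_antisym: assumes "s \<in> P" "- s \<in> P" shows "s = 0"
proof -
  obtain u :: "nat \<Rightarrow> 'a" where u: "orthonormal u" using orthonormal_exists .
  obtain z w where zw: "z \<in> S" "z * z = s" "w \<in> S" "w * w = - s"
    using P_sqrt assms by metis
  let ?x = "z * u 0 + w * u 1"
  have zD: "z \<in> D" "w \<in> D" "star z = z" "star w = w" using zw S_def by auto
  have "?x * star ?x = z * e * z + w * e * w"
    using u zD by (simp add: star_add star_mult ring_distribs mult.assoc[symmetric] orthonormal_simps)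
  also have "\<dots> = 0" using zw zD by (simp add: D_e')
  finally have x0: "?x = 0" by (rule proper)
  have "z = ?x * star (u 0)"
    using u zD by (simp add: distrib_right orthonormal_simps D_e')
  then have "z = 0" using x0 by simp
  then show ?thesis using zw by simp
qed

lemma P_conj [simp]: assumes "d \<in> D" "s \<in> P" shows "d * s * star d \<in> P"
proof -
  obtain x where x: "x \<in> H" "s = x * star x" using assms(2) by (auto simp: P_def)
  have "d * s * star d = (d * x) * star (d * x)" using x by (simp add: star_mult mult.assoc)
  then show ?thesis using P_norm[of "d * x"] x assms(1) by simp
qed

lemma P_mult: assumes "s \<in> P" "t \<in> P" "s * t = t * s" shows "s * t \<in> P"
proof -
  obtain w where w: "w \<in> S" "w * w = t" "\<And>c. c * t = t * c \<Longrightarrow> w * c = c * w"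
    using P_sqrt assms(2) by metis
  have "s * t = w * s * star w"
    using w(3)[of s] assms(3) w(1,2) by (metis S_star mult.assoc)
  then show ?thesis using P_conj[OF S_D[OF w(1)] assms(1)] by simp
qed

lemma P_dinv: assumes "s \<in> P" "s \<noteq> 0" shows "dinv s \<in> P"
proof -
  have s: "s \<in> D" "dinv s \<in> S" using assms P_S S_D dinv_S by blast+
  then have "dinv s * s * star (dinv s) \<in> P" using assms S_D by simp
  then show ?thesis using dinv[OF s(1) assms(2)] S_star[OF s(2)] by (simp add: D_e)
qed

lemma P_sum [simp]: "(\<And>i. i \<in> A \<Longrightarrow> f i \<in> P) \<Longrightarrow> sum f A \<in> P"
  by (induction A rule: infinite_finite_induct) simp_all

lemma P_of_nat [simp]: "s \<in> P \<Longrightarrow> of_nat n * s \<in> P"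
  by (induction n) (simp_all add: algebra_simps)

text \<open>\<open>D\<close> has characteristic 0: otherwise \<open>- e\<close> would be a natural
  multiple of \<open>e\<close>, hence a norm like \<open>e\<close> itself, against
  \<open>P_antisym\<close>.\<close>

lemma of_nat_nz: assumes "n > 0" "x \<in> H" "of_nat n * x = 0" shows "x = 0"
proof -
  obtain m where m: "n = Suc m" using assms(1) by (cases n) auto
  have "of_nat n * e \<noteq> 0"
  proof
    assume "of_nat n * e = 0"
    then have "of_nat m * e = - e" using m by (simp add: algebra_simps eq_neg_iff_add_eq_0)
    then have "- e \<in> P" using P_of_nat[of e m] by simp
    then show False using P_antisym[of e] by simp
  qed
  moreover have "of_nat n * e * x = 0" using assms by (simp add: mult.assoc H_e)
  ultimately show ?thesis using D_H_nz[of "of_nat n * e" x] assms(2) by simp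
qed

lemma two_nz: "x \<in> H \<Longrightarrow> x + x = 0 \<Longrightarrow> x = 0"
  using of_nat_nz[of 2 x] by (simp add: algebra_simps mult_2)

text \<open>\<open>EP_sqrt\<close> gives a root \<open>z\<close> of \<open>s * s\<close> in the
  bicommutant of \<open>s * s\<close>. It commutes with \<open>s\<close>, so
  \<open>(z - s) * (z + s) = 0\<close> and \<open>s\<close> is \<open>z\<close> or
  \<open>- z\<close>.\<close>

lemma S_bicommutant_sq:
  assumes s: "s \<in> S" and c: "c * (s * s) = s * s * c" "c \<in> D"
  shows "s * c = c * s"
proof (cases "s = 0")
  case False
  have sD: "s \<in> D" "s \<in> H" "star s = s" using s by (auto simp: S_def D_H)
  obtain z where z: "z \<in> S" "z * z = s * star s"
      "\<And>c. c * (s * star s) = (s * star s) * c \<Longrightarrow> z * c = c * z"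
    using EP_sqrt sD by metis
  have "z * s = s * z" using z(3)[of s] sD by (simp add: mult.assoc)
  then have "(z - s) * (z + s) = 0" using z(2) sD by (simp add: algebra_simps)
  then have "z = s \<or> z = - s"
    using D_nz[of "z - s" "z + s"] S_D[OF z(1)] sD by (auto simp: eq_neg_iff_add_eq_0)
  moreover have "z * c = c * z" using z(3)[of c] c sD by simp
  ultimately show ?thesis by auto
qed simp

section \<open>Closed spans and existence of infinite sums\<close>

text \<open>The biorthogonal, in place of a topological closure; \<open>cspan_projection\<close>
  shows it to be the range of a projection in the ring.\<close>

definition cspan :: "'a set \<Rightarrow> 'a set" where
  "cspan M = {x \<in> H. \<forall>y. (\<forall>z\<in>M. z * star y = 0) \<longrightarrow> x * star y = 0}"

lemma cspan_H: "x \<in> cspan M \<Longrightarrow> x \<in> H"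
  by (simp add: cspan_def)

lemma cspan_orth: "x \<in> cspan M \<Longrightarrow> (\<And>z. z \<in> M \<Longrightarrow> z * star y = 0) \<Longrightarrow> x * star y = 0"
  by (simp add: cspan_def)

lemma cspanI: "x \<in> H \<Longrightarrow> (\<And>y. (\<And>z. z \<in> M \<Longrightarrow> z * star y = 0) \<Longrightarrow> x * star y = 0) \<Longrightarrow> x \<in> cspan M"
  by (auto simp: cspan_def)

lemma cspan_base: "x \<in> M \<Longrightarrow> x \<in> H \<Longrightarrow> x \<in> cspan M"
  by (simp add: cspan_def)

lemma cspan_trans: "x \<in> cspan M \<Longrightarrow> M \<subseteq> cspan M' \<Longrightarrow> x \<in> cspan M'"
  unfolding cspan_def by blast

lemma cspan_mono: "x \<in> cspan M \<Longrightarrow> M \<subseteq> M' \<Longrightarrow> x \<in> cspan M'"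
  unfolding cspan_def by blast

lemma cspan_0 [simp]: "0 \<in> cspan M"
  by (simp add: cspan_def)

lemma cspan_add [simp]: "x \<in> cspan M \<Longrightarrow> y \<in> cspan M \<Longrightarrow> x + y \<in> cspan M"
  and cspan_diff [simp]: "x \<in> cspan M \<Longrightarrow> y \<in> cspan M \<Longrightarrow> x - y \<in> cspan M"
  by (simp_all add: cspan_def algebra_simps)

lemma cspan_mult [simp]: "d \<in> D \<Longrightarrow> x \<in> cspan M \<Longrightarrow> d * x \<in> cspan M"
  by (simp add: cspan_def mult.assoc)

lemma cspan_sum [simp]: "(\<And>i. i \<in> A \<Longrightarrow> f i \<in> cspan M) \<Longrightarrow> sum f A \<in> cspan M"
  by (induction A rule: infinite_finite_induct) simp_all

lemma cspan_projection:
  obtains p where "projection star p" "\<And>x. x \<in> cspan M \<Longrightarrow> x * p = x"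
    "\<And>x. x \<in> H \<Longrightarrow> x * p \<in> cspan M"
    "\<And>y. (\<And>x. x \<in> M \<Longrightarrow> x * star y = 0) \<Longrightarrow> y * p = 0"
proof -
  obtain p where p: "projection star p" "\<And>x. x \<in> M \<Longrightarrow> x * p = x"
    "\<And>y. (\<And>x. x \<in> M \<Longrightarrow> x * star y = 0) \<Longrightarrow> y * p = 0"
    using closed_span_projection[of M] by metis
  have 1: "x * p = x" if x: "x \<in> cspan M" for x
  proof -
    have "z * star (1 - p) = 0" if "z \<in> M" for z
      using p(1,2) that by (simp add: star_diff projection_def algebra_simps)
    then have "x * star (1 - p) = 0" by (rule cspan_orth[OF x])
    then show ?thesis using p(1) by (simp add: star_diff projection_def algebra_simps)
  qed
  have 2: "x * p \<in> cspan M" if x: "x \<in> H" for x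
  proof (rule cspanI)
    show "x * p * star y = 0" if "\<And>z. z \<in> M \<Longrightarrow> z * star y = 0" for y
    proof -
      have "y * p = 0" using p(3) that by blast
      then have "star (y * p) = 0" by simp
      then show ?thesis using p(1) by (simp add: star_mult projection_def mult.assoc)
    qed
  qed (use x in simp)
  from that[OF p(1) 1 2 p(3)] show ?thesis by blast
qed

text \<open>For orthonormal \<open>f\<close> this expresses, without convergence, that
  \<open>x\<close> is the sum of all \<open>c i * f i\<close>.\<close>

definition expands :: "('i \<Rightarrow> 'a) \<Rightarrow> ('i \<Rightarrow> 'a) \<Rightarrow> 'a \<Rightarrow> bool" where
  "expands f c x \<longleftrightarrow> x \<in> cspan (range f) \<and> (\<forall>i. x * star (f i) = c i)"

lemma expandsD: "expands f c x \<Longrightarrow> x \<in> cspan (range f)" "expands f c x \<Longrightarrow> x * star (f i) = c i"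
    "expands f c x \<Longrightarrow> x \<in> H"
  by (auto simp: expands_def cspan_H)

lemma cspan_eqI:
  assumes "x \<in> cspan M" "y \<in> cspan M" "\<And>z. z \<in> M \<Longrightarrow> x * star z = y * star z"
  shows "x = y"
proof -
  have "z * star (x - y) = 0" if "z \<in> M" for z
  proof -
    have "star (x * star z) = star (y * star z)" using assms(3)[OF that] by simp
    then show ?thesis by (simp add: star_mult star_star star_diff algebra_simps)
  qed
  then have "(x - y) * star (x - y) = 0"
    by (rule cspan_orth[OF cspan_diff[OF assms(1,2)]])
  then show ?thesis using proper[of "x - y"] by simp
qed

lemma expands_unique: "expands f c x \<Longrightarrow> expands f c y \<Longrightarrow> x = y"
  by (rule cspan_eqI[of _ "range f"]) (auto simp: expands_def)

section \<open>Symmetries that move orthonormal families\<close>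

lemma star_orth: "x * star y = 0 \<Longrightarrow> y * star x = 0"
  by (metis star_0 star_mult star_star)

text \<open>If \<open>r\<close> projects onto the closed span of the \<open>u i + v i\<close>, it
  fixes these sums and, by orthogonality, kills the differences \<open>u i - v i\<close>; so the
  reflection \<open>r + r - 1\<close> exchanges \<open>u i\<close> and \<open>v i\<close>.\<close>

lemma swap:
  assumes u: "orthonormal u" and v: "orthonormal v" and uv: "\<And>i j. u i * star (v j) = 0"
  obtains s where "star s = s" "s * s = 1" "\<And>i. u i * s = v i" "\<And>i. v i * s = u i"
proof -
  obtain r where r: "projection star r" "\<And>x. x \<in> range (\<lambda>i. u i + v i) \<Longrightarrow> x * r = x"
    "\<And>y. (\<And>x. x \<in> range (\<lambda>i. u i + v i) \<Longrightarrow> x * star y = 0) \<Longrightarrow> y * r = 0"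
    by (rule closed_span_projection[of "range (\<lambda>i. u i + v i)"]) blast
  have vu: "v i * star (u j) = 0" for i j using star_orth[OF uv] .
  have rr: "r * r = r" "star r = r" using r(1) by (auto simp: projection_def)
  have 1: "u i * r + v i * r = u i + v i" for i
    using r(2)[of "u i + v i"] by (simp add: distrib_right)
  have "(u i - v i) * r = 0" for i
  proof (rule r(3))
    fix x assume "x \<in> range (\<lambda>i. u i + v i)"
    then obtain j where x: "x = u j + v j" by auto
    show "x * star (u i - v i) = 0"
      unfolding x using u v uv vu
      by (cases "i = j") (simp_all add: star_diff algebra_simps orthonormal_simps)
  qed
  then have 2: "u i * r = v i * r" for i by (simp add: algebra_simps)
  let ?s = "r + r - 1"
  have "star ?s = ?s" using rr by (simp add: star_add star_diff)
  moreover have "?s * ?s = 1" using rr by (simp add: algebra_simps)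
  moreover have "u i * ?s = v i" for i
    using 1[of i] 2[of i] by (simp add: algebra_simps)
  moreover have "v i * ?s = u i" for i
    using 1[of i] 2[of i] by (simp add: algebra_simps)
  ultimately show ?thesis using that by blast
qed

text \<open>Composed of two symmetries, from \<open>u\<close> to \<open>k\<close> and from
  \<open>k\<close> to \<open>v\<close>, so that orthogonality is asked of \<open>k\<close>
  only.\<close>

lemma transport:
  fixes u v k :: "'i \<Rightarrow> 'a"
  assumes "orthonormal u" "orthonormal v" "orthonormal k"
    and "\<And>i j. u i * star (k j) = 0" "\<And>i j. v i * star (k j) = 0"
  obtains a where "a * star a = 1" "\<And>i. u i * a = v i"
proof -
  obtain s where s: "star s = s" "s * s = 1" "\<And>i. u i * s = k i"
    using swap[of u k] assms by metis
  obtain t where t: "star t = t" "t * t = 1" "\<And>i. k i * t = v i"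
    using swap[of v k] assms by metis
  have "(s * t) * star (s * t) = s * (t * t) * s" by (simp add: star_mult s(1) t(1) mult.assoc)
  then have "(s * t) * star (s * t) = 1" using s t by simp
  then show ?thesis using that[of "s * t"] s t by (simp add: mult.assoc[symmetric])
qed

lemma transport_expands:
  assumes a: "a * star a = 1" "\<And>i. u i * a = v i" and x: "expands u c x"
  shows "expands v c (x * a)" "(x * a) * star (x * a) = x * star x"
proof -
  show "(x * a) * star (x * a) = x * star x"
    using a(1) by (simp add: star_mult mult.assoc) (simp add: mult.assoc[symmetric])
  have "x * a \<in> cspan (range v)"
  proof (rule cspanI)
    show "x * a * star y = 0" if y: "\<And>z. z \<in> range v \<Longrightarrow> z * star y = 0" for y
    proof -
      have "x * star (y * star a) = 0"
      proof (rule cspan_orth[OF expandsD(1)[OF x]])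
        fix z assume "z \<in> range u"
        then obtain i where "z = u i" by auto
        then have "z * a * star y = 0" using a(2)[of i] y[of "v i"] by simp
        then show "z * star (y * star a) = 0" by (simp add: star_mult star_star mult.assoc)
      qed
      then show ?thesis by (simp add: star_mult star_star mult.assoc)
    qed
  qed (use expandsD(3)[OF x] in simp)
  moreover have "x * a * star (v i) = c i" for i
  proof -
    have "x * a * star (v i) = x * (a * star a) * star (u i)"
      by (simp add: a(2)[symmetric] star_mult mult.assoc)
    then show ?thesis using a(1) expandsD(2)[OF x] by simp
  qed
  ultimately show "expands v c (x * a)" by (simp add: expands_def)
qed

section \<open>Finite sums and dominated sums\<close>

lemma expands_base_sum:
  assumes f: "orthonormal f" and c: "\<And>i. c i \<in> D" and "finite A"
  shows "expands f (\<lambda>i. if i \<in> A then c i else 0) (\<Sum>i\<in>A. c i * f i)"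
proof -
  have "(\<Sum>i\<in>A. c i * f i) \<in> cspan (range f)"
    using f c by (intro cspan_sum cspan_mult cspan_base) auto
  moreover have "(\<Sum>i\<in>A. c i * f i) * star (f j) = (if j \<in> A then c j else 0)" for j
  proof -
    have "(\<Sum>i\<in>A. c i * f i) * star (f j) = (\<Sum>i\<in>A. if i = j then c i else 0)"
      using f c by (simp add: sum_distrib_right) (intro sum.cong, auto simp: orthonormal_simps D_e')
    then show ?thesis using \<open>finite A\<close> by simp
  qed
  ultimately show ?thesis by (simp add: expands_def)
qed

lemma projection_norm:
  assumes "projection star p"
  shows "x * star x = (x * p) * star (x * p) + (x * (1 - p)) * star (x * (1 - p))"
proof -
  have p: "p * p = p" "star p = p" using assms by (auto simp: projection_def)
  have pp: "p * (p * z) = p * z" for z using p by (simp add: mult.assoc[symmetric])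
  show ?thesis by (simp add: star_mult star_diff p algebra_simps pp)
qed

lemma P_projection: "projection star p \<Longrightarrow> x \<in> H \<Longrightarrow> x * star x - (x * p) * star (x * p) \<in> P"
  using projection_norm[of p x] P_norm[of "x * (1 - p)"] by (metis H_mult_right add_diff_cancel_left')

text \<open>The quotient \<open>lam i\<close> of \<open>\<beta> i\<close> by
  \<open>\<alpha> i\<close> has norm at most 1, so \<open>lam i * f i\<close> is the
  \<open>f i\<close> component of a unit vector \<open>v i\<close> in the plane of
  \<open>f i\<close> and \<open>g i\<close>. The sum \<open>x\<close> is carried over from
  \<open>f\<close> to \<open>v\<close> and then projected back to the closed span of
  \<open>f\<close>.\<close>

lemma dominated_expands:
  fixes f g k :: "'i \<Rightarrow> 'a"
  assumes f: "orthonormal f" and g: "orthonormal g" and k: "orthonormal k"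
    and orth: "\<And>i j. f i * star (g j) = 0" "\<And>i j. f i * star (k j) = 0" "\<And>i j. g i * star (k j) = 0"
    and x: "expands f \<alpha> x"
    and \<alpha>: "\<And>i. \<alpha> i \<in> S" "\<And>i. \<alpha> i \<noteq> 0" "\<And>i d. d \<in> D \<Longrightarrow> \<alpha> i * d = d * \<alpha> i"
    and \<beta>: "\<And>i. \<beta> i \<in> D" and le: "\<And>i. \<alpha> i * \<alpha> i - \<beta> i * star (\<beta> i) \<in> P"
  obtains y where "expands f \<beta> y" "x * star x - y * star y \<in> P"
proof -
  define lam where "lam i = dinv (\<alpha> i) * \<beta> i" for i
  have \<alpha>D: "\<alpha> i \<in> D" "star (\<alpha> i) = \<alpha> i" for i using \<alpha> by (auto simp: S_def)
  have i\<alpha>: "dinv (\<alpha> i) \<in> D" "star (dinv (\<alpha> i)) = dinv (\<alpha> i)" for i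
    using dinv_S[OF \<alpha>(1,2)] by (auto simp: S_def)
  have lD: "lam i \<in> D" for i using i\<alpha> \<beta> by (simp add: lam_def)
  have alam: "\<alpha> i * lam i = \<beta> i" for i
    using dinv_cancel(1)[OF \<alpha>D(1) \<alpha>(2)] \<beta>[of i] D_H by (simp add: lam_def)
  have "e - lam i * star (lam i) \<in> P" for i
  proof -
    have "dinv (\<alpha> i) * (\<alpha> i * \<alpha> i - \<beta> i * star (\<beta> i)) * star (dinv (\<alpha> i)) \<in> P"
      using le i\<alpha> by (intro P_conj) auto
    also have "dinv (\<alpha> i) * (\<alpha> i * \<alpha> i - \<beta> i * star (\<beta> i)) * star (dinv (\<alpha> i)) = e - lam i * star (lam i)"
      using dinv[OF \<alpha>D(1) \<alpha>(2), of i]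
      by (simp add: lam_def star_mult i\<alpha> right_diff_distrib left_diff_distrib mult.assoc[symmetric] D_e \<alpha>D)
    finally show ?thesis .
  qed
  then have "\<exists>z\<in>S. z * z = e - lam i * star (lam i)" for i using P_sqrt by metis
  then obtain \<mu> where \<mu>: "\<And>i. \<mu> i \<in> S" "\<And>i. \<mu> i * \<mu> i = e - lam i * star (lam i)" by metis
  have \<mu>D: "\<mu> i \<in> D" "star (\<mu> i) = \<mu> i" for i using \<mu> by (auto simp: S_def)
  define v where "v i = lam i * f i + \<mu> i * g i" for i
  have gf: "g i * star (f j) = 0" for i j using star_orth[OF orth(1)] .
  have left: "d * f i * star (g j) = 0" "d * g i * star (f j) = 0"
      "d * f i * star (k j) = 0" "d * g i * star (k j) = 0" for d i j
    using orth gf by (simp_all add: mult.assoc)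
  have v: "orthonormal v"
  proof (rule orthonormalI)
    show "v i \<in> H" for i using lD \<mu>D f g by (simp add: v_def)
    show "v i * star (v i) = e" for i
      using \<mu>(2)[of i] lD \<mu>D f g unfolding v_def
      by (simp add: star_add star_mult ring_distribs mult.assoc[symmetric] orthonormal_simps left D_e')
    show "v i * star (v j) = 0" if "i \<noteq> j" for i j
      using that f g unfolding v_def
      by (simp add: star_add star_mult ring_distribs mult.assoc[symmetric] orthonormal_simps left)
  qed
  have vk: "v i * star (k j) = 0" for i j
    unfolding v_def by (simp add: distrib_right left)
  obtain a where a: "a * star a = 1" "\<And>i. f i * a = v i"
    using transport[OF f v k orth(2) vk] by metis
  have xa: "expands v \<alpha> (x * a)" "(x * a) * star (x * a) = x * star x"
    using transport_expands[OF a x] by auto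
  obtain p where p: "projection star p" "\<And>x. x \<in> cspan (range f) \<Longrightarrow> x * p = x"
      "\<And>x. x \<in> H \<Longrightarrow> x * p \<in> cspan (range f)"
    using cspan_projection[of "range f"] by metis
  let ?y = "x * a * p"
  have coeff: "?y * star (f i) = \<beta> i" for i
  proof -
    have "f i * p = f i" using p(2) cspan_base f by auto
    then have "star (f i) = p * star (f i)" using p(1) by (metis projection_def star_mult)
    then have "?y * star (f i) = x * a * star (f i)" by (simp add: mult.assoc)
    \<comment> \<open>\<open>f i\<close> and \<open>star (lam i) * v i\<close> have the same inner
      products with every \<open>v j\<close>, hence with \<open>x * a\<close>, which lies in the
      closed span of \<open>v\<close>.\<close>
    also have "x * a * star (f i - star (lam i) * v i) = 0"
    proof (rule cspan_orth[OF expandsD(1)[OF xa(1)]])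
      fix z assume "z \<in> range v"
      then obtain j where z: "z = v j" by auto
      have "v j * star (f i) = (if i = j then lam j else 0)"
        unfolding v_def using f lD
        by (simp add: distrib_right left orthonormal_simps D_e')
      moreover have "v j * star (star (lam i) * v i) = (if i = j then lam j else 0)"
        using v lD by (simp add: star_mult star_star mult.assoc[symmetric] orthonormal_simps D_e)
      ultimately show "z * star (f i - star (lam i) * v i) = 0"
        by (simp add: z star_diff algebra_simps)
    qed
    then have "x * a * star (f i) = x * a * star (v i) * lam i"
      by (simp add: star_diff star_mult star_star algebra_simps)
    also have "\<dots> = \<beta> i" using expandsD(2)[OF xa(1)] alam by simp
    finally show ?thesis .
  qed
  have "expands f \<beta> ?y"
    using p(3)[of "x * a"] expandsD(3)[OF xa(1)] coeff by (simp add: expands_def)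
  moreover have "x * star x - ?y * star ?y \<in> P"
    using P_projection[OF p(1), of "x * a"] expandsD(3)[OF xa(1)] xa(2) by simp
  ultimately show ?thesis using that by blast
qed

section \<open>The dichotomy for infinite sums\<close>

lemma P_add_eq_0: "s \<in> P \<Longrightarrow> t \<in> P \<Longrightarrow> s + t = 0 \<Longrightarrow> s = 0"
  using P_antisym[of s] by (metis add.inverse_unique)

text \<open>
  The vectors \<open>t n\<close> result from orthonormalizing \<open>c (n + 1) f n - c n f (n + 1)\<close>; they span a
  closed subspace whose orthogonal complement in the closed span of \<open>f\<close> consists of the
  multiples of \<open>\<Sum> c i f i\<close>. When there is no such vector, \<open>t\<close> is as good a basis as \<open>f\<close>, and
  the second alternative lists the coordinates of \<open>f 0\<close> with respect to it.
\<close>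

lemma expands_dichotomy:
  fixes f k :: "nat \<Rightarrow> 'a"
  assumes f: "orthonormal f" and k: "orthonormal k" and fk: "\<And>i j. f i * star (k j) = 0"
    and c: "\<And>i. c i \<in> S" "\<And>i. c i \<noteq> 0" "\<And>i j. c i * c j = c j * c i"
    and N: "\<And>n. N n = (\<Sum>i\<le>n. c i * c i)"
    and r: "\<And>n. r n \<in> S" "\<And>n. r n * (N n * N (Suc n)) * r n = e"
  shows "(\<exists>x. expands f c x) \<or> (\<exists>x. expands f (\<lambda>n. c 0 * c (Suc n) * r n) x \<and> x * star x = e)"
proof -
  have cD: "c i \<in> D" "star (c i) = c i" for i using c by (auto simp: S_def)
  have rD: "r i \<in> D" "star (r i) = r i" for i using r by (auto simp: S_def)
  have NP: "N n \<in> P" for n unfolding N by (intro P_sum P_sq c)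
  have ND: "N n \<in> D" "star (N n) = N n" for n using P_S[OF NP] by (auto simp: S_def)
  have N_nz: "N n \<noteq> 0" for n
  proof
    assume "N n = 0"
    moreover have "N n = c 0 * c 0 + (\<Sum>i\<in>{..n} - {0}. c i * c i)"
      unfolding N by (subst sum.remove[of _ 0]) auto
    moreover have "(\<Sum>i\<in>{..n} - {0}. c i * c i) \<in> P" using c by (intro P_sum P_sq)
    ultimately have "c 0 * c 0 = 0" using P_add_eq_0[OF P_sq[OF c(1)[of 0]]] by metis
    then show False using D_nz[OF cD(1) cD(1) c(2) c(2), of 0 0] by simp
  qed
  have cN: "c i * N n = N n * c i" for i n
    unfolding N by (simp add: sum_distrib_left sum_distrib_right) (intro sum.cong refl, metis c(3) mult.assoc)
  define y where "y n = (\<Sum>i\<le>n. c i * f i)" for n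
  have yH: "y n \<in> H" for n using cD f by (simp add: y_def)
  have yf: "y n * star (f i) = (if i \<le> n then c i else 0)" for n i
    using expandsD(2)[OF expands_base_sum[OF f, of c "{..n}"], of i] cD by (simp add: y_def)
  have fy: "f i * star (y n) = (if i \<le> n then c i else 0)" for n i
  proof -
    have "f i * star (y n) = star (y n * star (f i))" by (simp add: star_mult star_star)
    then show ?thesis using yf cD by simp
  qed
  have yy: "y n * star (y m) = N m" if "m \<le> n" for m n
  proof -
    have "y n * star (y m) = star (y m * star (y n))" by (simp add: star_mult star_star)
    also have "y m * star (y n) = (\<Sum>i\<le>m. c i * (f i * star (y n)))"
      by (simp add: y_def[of m] sum_distrib_right mult.assoc)
    also have "\<dots> = N m" unfolding N using that by (intro sum.cong) (auto simp: fy)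
    finally show ?thesis using ND by simp
  qed
  \<comment> \<open>In the plane of \<open>y n\<close> and \<open>f (Suc n)\<close>, this is a
    vector orthogonal to the next partial sum \<open>y (Suc n)\<close>, and thus to any vector with
    coordinates \<open>c i\<close>.\<close>
  define w where "w n = c (Suc n) * y n - N n * f (Suc n)" for n
  have wH: "w n \<in> H" for n using cD ND yH f by (simp add: w_def)
  have wf: "w n * star (f i) = (if i \<le> n then c (Suc n) * c i else if i = Suc n then - N n else 0)" for n i
    using f ND by (auto simp: w_def left_diff_distrib mult.assoc yf orthonormal_simps D_e')
  have wy: "w n * star (y m) = c (Suc n) * N m" if "m \<le> n" for m n
    using that by (simp add: w_def left_diff_distrib mult.assoc yy fy)
  have sw: "z * star (w m) = (z * star (y m)) * c (Suc m) - (z * star (f (Suc m))) * N m" for z m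
    by (simp add: w_def star_diff star_mult cD ND right_diff_distrib mult.assoc)
  have ww: "w n * star (w n) = N n * N (Suc n)" for n
  proof -
    have "w n * star (w n) = N n * (c (Suc n) * c (Suc n)) + N n * N n"
      unfolding sw wf wy[OF order_refl] cN by (simp add: mult.assoc)
    also have "\<dots> = N n * N (Suc n)" by (simp add: N distrib_left add.commute)
    finally show ?thesis .
  qed
  have ww0: "w n * star (w m) = 0" if "m < n" for m n
    unfolding sw wf using that wy[of m n] cN[of "Suc m" m] by (simp add: mult.assoc)
  define t where "t n = r n * w n" for n
  have t: "orthonormal t"
  proof (rule orthonormalI)
    show "t i \<in> H" for i using rD wH by (simp add: t_def)
    show "t i * star (t i) = e" for i
    proof -
      have "t i * star (t i) = r i * (w i * star (w i)) * r i" by (simp add: t_def star_mult rD mult.assoc)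
      then show ?thesis unfolding ww using r by simp
    qed
    show "t i * star (t j) = 0" if "i \<noteq> j" for i j
    proof -
      have "w i * star (w j) = 0"
        using ww0[of i j] ww0[of j i] that star_orth[of "w j" "w i"] by (cases "i < j") auto
      moreover have "t i * star (t j) = r i * (w i * star (w j)) * r j"
        by (simp add: t_def star_mult rD mult.assoc)
      ultimately show ?thesis by simp
    qed
  qed
  have r_nz: "r n \<noteq> 0" for n using r(2)[of n] by auto
  have t_span: "range t \<subseteq> cspan (range f)"
  proof clarify
    fix n
    have ff: "f i \<in> cspan (range f)" for i using f by (simp add: cspan_base)
    then have "y n \<in> cspan (range f)" unfolding y_def using cD by simp
    then show "t n \<in> cspan (range f)" unfolding t_def w_def using rD cD ND ff by simp
  qed
  have tk: "t i * star (k j) = 0" for i j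
    using t_span fk cspan_orth[of "t i" "range f" "k j"] by blast
  show ?thesis
  proof (cases "\<exists>z \<in> cspan (range f). z \<noteq> 0 \<and> (\<forall>n. t n * star z = 0)")
    case True
    then obtain z where z: "z \<in> cspan (range f)" "z \<noteq> 0" "\<And>n. t n * star z = 0" by blast
    have zH: "z \<in> H" using z cspan_H by blast
    have wz: "w n * star z = 0" for n
    proof -
      have "r n * (w n * star z) = 0" using z(3)[of n] by (simp add: t_def mult.assoc)
      then show ?thesis using D_H_nz[OF rD(1), of "w n * star z" n] wH r_nz by auto
    qed
    define b where "b i = f i * star z" for i
    have bD: "b i \<in> D" for i unfolding b_def using f zH by simp
    define g where "g = dinv (c 0) * b 0"
    have gD: "g \<in> D" unfolding g_def using dinv(1)[OF cD(1) c(2)] bD by simp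
    \<comment> \<open>Orthogonality of \<open>z\<close> to \<open>w n\<close> determines
      \<open>b (Suc n)\<close> from the earlier coordinates, and multiples of \<open>c i\<close>
      satisfy the same recursion.\<close>
    have bg: "b i = c i * g" for i
    proof (induction i rule: less_induct)
      case (less i)
      show ?case
      proof (cases i)
        case 0
        then show ?thesis using dinv_cancel(1)[OF cD(1) c(2), of "b 0" 0] D_H[OF bD] by (simp add: g_def)
      next
        case (Suc n)
        have "y n * star z = (\<Sum>i\<le>n. c i * b i)"
          by (simp add: y_def sum_distrib_right b_def mult.assoc)
        also have "\<dots> = N n * g"
          unfolding N sum_distrib_right using less Suc by (intro sum.cong) (auto simp: mult.assoc)
        finally have 1: "y n * star z = N n * g" .
        have "0 = w n * star z" using wz by simp
        also have "\<dots> = c (Suc n) * (y n * star z) - N n * b (Suc n)"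
          by (simp add: w_def b_def left_diff_distrib mult.assoc)
        also have "\<dots> = N n * (c (Suc n) * g) - N n * b (Suc n)"
          unfolding 1 by (simp add: mult.assoc[symmetric] cN)
        finally have "N n * (c (Suc n) * g - b (Suc n)) = 0" by (simp add: right_diff_distrib)
        then have "c (Suc n) * g - b (Suc n) = 0"
          using D_nz[OF ND(1) _ N_nz, of "c (Suc n) * g - b (Suc n)" n] cD bD gD by auto
        then show ?thesis using Suc by simp
      qed
    qed
    have "g \<noteq> 0"
    proof
      assume "g = 0"
      then have "x * star z = 0" if "x \<in> range f" for x using that bg by (auto simp: b_def)
      then have "z * star z = 0" using cspan_orth[OF z(1)] by blast
      then show False using proper z(2) by blast
    qed
    then have sg: "star g \<in> D" "star g \<noteq> 0" using gD by auto
    have "expands f c (dinv (star g) * z)"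
      unfolding expands_def
    proof (intro conjI allI)
      show "dinv (star g) * z \<in> cspan (range f)" using dinv(1)[OF sg] z by simp
      fix i
      have "z * star (f i) = star (b i)" by (simp add: b_def star_mult star_star)
      then have "z * star (f i) = star g * c i" by (simp add: bg star_mult cD)
      then show "dinv (star g) * z * star (f i) = c i"
        using dinv_cancel(2)[OF sg D_H[OF cD(1)]] by (simp add: mult.assoc)
    qed
    then show ?thesis by blast
  next
    case False
    obtain p where p: "projection star p" "\<And>x. x \<in> cspan (range t) \<Longrightarrow> x * p = x"
        "\<And>x. x \<in> H \<Longrightarrow> x * p \<in> cspan (range t)"
      using cspan_projection[of "range t"] by metis
    have fp: "f 0 * p \<in> cspan (range t)" using p f by simp
    \<comment> \<open>The part of \<open>f 0\<close> orthogonal to all \<open>t n\<close> lies in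
      the closed span of \<open>f\<close>, so in this case it vanishes.\<close>
    have "f 0 - f 0 * p = 0"
    proof (rule ccontr)
      assume nz: "f 0 - f 0 * p \<noteq> 0"
      have "f 0 - f 0 * p \<in> cspan (range f)"
        using cspan_trans[OF fp t_span] cspan_base[of "f 0" "range f"] f by simp
      moreover have "t n * star (f 0 - f 0 * p) = 0" for n
      proof -
        have tp: "t n * p = t n" using p(2) cspan_base t by auto
        have "t n * star (f 0 - f 0 * p) = t n * star (f 0) - t n * p * star (f 0)"
          using p(1) by (simp add: star_diff star_mult projection_def right_diff_distrib mult.assoc)
        then show ?thesis using tp by simp
      qed
      ultimately show False using False nz by blast
    qed
    then have "f 0 \<in> cspan (range t)" using fp by simp
    moreover have "f 0 * star (t n) = c 0 * c (Suc n) * r n" for n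
    proof -
      have "f 0 * star (t n) = (f 0 * star (w n)) * r n" by (simp add: t_def star_mult rD mult.assoc)
      also have "f 0 * star (w n) = c 0 * c (Suc n)"
        unfolding sw using f fy[of 0 n] orthonormal_orth[OF f, of 0 "Suc n"] by simp
      finally show ?thesis .
    qed
    ultimately have "expands t (\<lambda>n. c 0 * c (Suc n) * r n) (f 0)" by (simp add: expands_def)
    \<comment> \<open>Carrying \<open>t\<close> to \<open>f\<close> turns the unit vector
      \<open>f 0\<close> into one that has the same coordinates with respect to
      \<open>f\<close>.\<close>
    moreover obtain a where a: "a * star a = 1" "\<And>i. t i * a = f i"
      using transport[OF t f k tk fk] by metis
    ultimately have "expands f (\<lambda>n. c 0 * c (Suc n) * r n) (f 0 * a)"
      "(f 0 * a) * star (f 0 * a) = f 0 * star (f 0)"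
      using transport_expands[where u=t and v=f, OF a] by blast+
    then show ?thesis using orthonormal_norm[OF f] by metis
  qed
qed

section \<open>Geometric series\<close>

text \<open>The shift of \<open>f\<close> by one is a transport. It gives a copy
  \<open>x * b\<close> of \<open>x\<close> with the same norm, orthogonal to \<open>f 0\<close>, and
  comparing coordinates yields \<open>x = d * f 0 + a * (x * b)\<close>.\<close>

lemma expands_shift:
  fixes f k :: "nat \<Rightarrow> 'a"
  assumes f: "orthonormal f" and k: "orthonormal k" and fk: "\<And>i j. f i * star (k j) = 0"
    and x: "expands f c x" and d: "d \<in> D" "a \<in> D"
    and c: "c 0 = d" "\<And>i. c (Suc i) = a * c i"
  shows "x * star x = d * star d + a * (x * star x) * star a"
proof -
  have f': "orthonormal (\<lambda>i. f (Suc i))" using orthonormal_comp[OF f, of Suc] by simp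
  obtain b where b: "b * star b = 1" "\<And>i. f i * b = f (Suc i)"
    by (rule transport[OF f f' k]) (use fk in auto)
  have xb: "expands (\<lambda>i. f (Suc i)) c (x * b)" "(x * b) * star (x * b) = x * star x"
    using transport_expands[OF b x] by auto
  have "f (Suc i) * star (f 0) = 0" for i by (rule orthonormal_orth[OF f]) simp
  then have xb0: "x * b * star (f 0) = 0"
    by (intro cspan_orth[OF expandsD(1)[OF xb(1)]]) blast
  have "expands f c (d * f 0 + a * (x * b))"
    unfolding expands_def
  proof (intro conjI allI)
    have "x * b \<in> cspan (range f)" by (rule cspan_mono[OF expandsD(1)[OF xb(1)]]) blast
    then show "d * f 0 + a * (x * b) \<in> cspan (range f)"
      using d f cspan_base[of "f 0" "range f"] by simp
    fix i
    show "(d * f 0 + a * (x * b)) * star (f i) = c i"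
    proof (cases i)
      case 0
      then show ?thesis using f d c xb0 by (simp add: distrib_right mult.assoc orthonormal_simps D_e')
    next
      case (Suc j)
      have "x * b * star (f (Suc j)) = c j" using expandsD(2)[OF xb(1), of j] .
      then show ?thesis using Suc f c by (simp add: distrib_right mult.assoc orthonormal_simps)
    qed
  qed
  then have "x = d * f 0 + a * (x * b)" using expands_unique x by blast
  then have "x * star x = (d * f 0 + a * (x * b)) * star (d * f 0 + a * (x * b))" by simp
  also have "\<dots> = (d * f 0) * star (d * f 0) + (a * (x * b)) * star (a * (x * b))"
  proof (rule norm_0)
    show "a * (x * b) * star (d * f 0) = 0"
      using xb0 by (simp add: star_mult mult.assoc[symmetric]) (simp add: mult.assoc)
  qed (use d f expandsD(3)[OF x] in auto)
  also have "(d * f 0) * star (d * f 0) = d * star d"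
    using f d by (simp add: star_mult mult.assoc[symmetric] orthonormal_simps D_e')
  also have "(a * (x * b)) * star (a * (x * b)) = a * ((x * b) * star (x * b)) * star a"
    by (simp add: star_mult mult.assoc)
  finally show ?thesis using xb(2) by simp
qed

lemma power_D [simp]: "a \<in> D \<Longrightarrow> a ^ n * e \<in> D"
  by (induction n) (simp_all add: mult.assoc)

lemma power_commute: "a \<in> D \<Longrightarrow> c \<in> D \<Longrightarrow> a * c = c * a \<Longrightarrow> a ^ n * e * c = c * (a ^ n * e)"
  by (induction n) (simp_all add: mult.assoc D_e D_e', metis mult.assoc)

lemma power_S [simp]: "a \<in> S \<Longrightarrow> a ^ n * e \<in> S"
proof (induction n)
  case (Suc n)
  have "a * (a ^ n * e) \<in> S"
    using Suc power_commute[of a a n] S_D[of a] S_mult[of a "a ^ n * e"] by simp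
  then show ?case by (simp add: mult.assoc)
qed simp

lemma power_add_e: "a \<in> D \<Longrightarrow> (a ^ m * e) * (a ^ n * e) = a ^ (m + n) * e"
  using D_e[OF power_D[of a n]] by (simp add: mult.assoc power_add)

lemma power_nz: "a \<in> D \<Longrightarrow> a \<noteq> 0 \<Longrightarrow> a ^ n * e \<noteq> 0"
  by (induction n) (simp_all add: mult.assoc D_nz)

text \<open>The shift gives \<open>N = e + a * N * a\<close> for the norm \<open>N\<close>. The work
  lies in showing that \<open>a\<close> and \<open>N\<close> commute; then
  \<open>N * (e - a * a) = e\<close>, and \<open>e - a * a\<close> is in \<open>P\<close> as the
  inverse of a norm.\<close>

lemma geometric:
  fixes f k :: "nat \<Rightarrow> 'a"
  assumes f: "orthonormal f" and k: "orthonormal k" and fk: "\<And>i j. f i * star (k j) = 0"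
    and a: "a \<in> S" "a * a \<noteq> e" and x: "expands f (\<lambda>i. a ^ i * e) x"
  shows "x * star x * (e - a * a) = e" "e - a * a \<in> P"
proof -
  define N where "N = x * star x"
  have aD: "a \<in> D" "star a = a" using a by (auto simp: S_def)
  have ND: "N \<in> D" "star N = N" "N \<in> P" using S_norm[OF expandsD(3)[OF x]] expandsD(3)[OF x] by (auto simp: N_def S_def)
  have "N = e * star e + a * N * star a"
    unfolding N_def by (rule expands_shift[OF f k fk x D_1 aD(1)]) (simp_all add: mult.assoc)
  then have N: "N = e + a * N * a" using aD by simp
  define d where "d = a * N - N * a"
  have dD: "d \<in> D" using aD ND by (simp add: d_def)
  have "d = a * (e + a * N * a) - (e + a * N * a) * a" using N d_def by metis
  also have "\<dots> = a * d * a"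
    using aD by (simp add: d_def algebra_simps D_e D_e')
  finally have ada: "d = a * d * a" .
  have comm: "a * N = N * a"
  proof (rule ccontr)
    assume "a * N \<noteq> N * a"
    then have d0: "d \<noteq> 0" by (simp add: d_def)
    then have a0: "a \<noteq> 0" using ada by auto
    define b where "b = dinv a"
    have b: "b \<in> D" "a * b = e" "b * a = e" "b \<in> S" using dinv[OF aD(1) a0] dinv_S[OF a(1) a0] by (auto simp: b_def)
    have da: "d * a = b * d"
    proof -
      have "b * d = b * (a * d * a)" using ada by simp
      also have "\<dots> = (b * a) * d * a" by (simp add: mult.assoc)
      finally show ?thesis using b dD by (simp add: D_e)
    qed
    have db: "d * b = a * d"
    proof -
      have "d * b = (a * d * a) * b" using ada by simp
      also have "\<dots> = a * (d * (a * b))" by (simp add: mult.assoc)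
      finally show ?thesis using b dD by (simp add: D_e')
    qed
    \<comment> \<open>By \<open>da\<close> and \<open>db\<close>, the commutator \<open>d\<close>
      anticommutes with the symmetric \<open>s\<close>, so it commutes with \<open>s * s\<close>. By
      \<open>S_bicommutant_sq\<close> it also commutes with \<open>s\<close>; both together force
      \<open>s * d = 0\<close>.\<close>
    define s where "s = a - b"
    have s: "s \<in> S" using a b by (simp add: s_def)
    have ds: "d * s = - (s * d)" using da db by (simp add: s_def algebra_simps)
    then have "d * (s * s) = s * s * d" by (metis minus_mult_minus minus_mult_right mult.assoc mult_minus_left)
    then have "s * d = d * s" using S_bicommutant_sq[OF s _ dD] by simp
    then have "s * d = - (s * d)" using ds by metis
    then have "s * d + s * d = 0" by (metis add.right_inverse)
    then have "s * d = 0" by (rule two_nz[OF D_mult_H[OF S_D[OF s] D_H[OF dD]]])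
    then have "s = 0" using D_nz[OF S_D[OF s] dD] d0 by blast
    then have "a = b" by (simp add: s_def)
    then show False using b a by simp
  qed
  have "N * (e - a * a) = N - N * a * a" using ND by (simp add: right_diff_distrib D_e' mult.assoc)
  also have "\<dots> = N - a * N * a" using comm by simp
  also have "\<dots> = e" using N by (metis add_diff_cancel_right')
  finally have 1: "N * (e - a * a) = e" .
  then show "x * star x * (e - a * a) = e" by (simp add: N_def)
  have "e - a * a = dinv N" using dinv_unique[OF ND(1) _ 1] aD by simp
  moreover have "N \<noteq> 0" using 1 by auto
  ultimately show "e - a * a \<in> P" using P_dinv ND by metis
qed

text \<open>If neither sum exists, the dichotomy supplies unit vectors \<open>x\<close> and
  \<open>y\<close> with coordinates \<open>A (Suc n) * r n\<close> and
  \<open>B (Suc n) * r' n\<close>. These match so that \<open>x = a * y\<close>; but the norm of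
  \<open>a * y\<close> is \<open>a * a\<close>.\<close>

lemma geometric_alternative:
  fixes f k :: "nat \<Rightarrow> 'a"
  assumes f: "orthonormal f" and k: "orthonormal k" and fk: "\<And>i j. f i * star (k j) = 0"
    and a: "a \<in> S" "a \<noteq> 0" "a * a \<noteq> e"
  shows "(\<exists>x. expands f (\<lambda>i. a ^ i * e) x) \<or> (\<exists>x. expands f (\<lambda>i. dinv a ^ i * e) x)"
proof -
  have aD: "a \<in> D" using a S_D by blast
  define b where "b = dinv a"
  have b: "b \<in> D" "a * b = e" "b * a = e" "b \<in> S" "b \<noteq> 0"
    using dinv[OF aD a(2)] dinv_S[OF a(1,2)] dinv_nz[OF aD a(2)] by (auto simp: b_def)
  define A B where "A n = a ^ n * e" and "B n = b ^ n * e" for n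
  have AD: "A n \<in> D" "A n \<in> S" "B n \<in> D" "B n \<in> S" "A n \<noteq> 0" "B n \<noteq> 0" for n
    using aD a b power_nz[of a] power_nz[of b] by (auto simp: A_def B_def)
  have AA: "A m * A n = A (m + n)" "B m * B n = B (m + n)" for m n
    using power_add_e[OF aD] power_add_e[OF b(1)] by (auto simp: A_def B_def)
  have A0: "A 0 = e" "B 0 = e" by (auto simp: A_def B_def)
  have A1: "A 1 = a" "B 1 = b" using aD b D_e' by (auto simp: A_def B_def)
  have AB: "A n * B n = e" for n
  proof (induction n)
    case (Suc n)
    have "A (Suc n) * B (Suc n) = (A n * A 1) * (B 1 * B n)" using AA by simp
    also have "\<dots> = A n * (a * b) * B n" by (simp add: A1[simplified] mult.assoc)
    also have "\<dots> = e" using Suc b AD by (simp add: D_e')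
    finally show ?case .
  qed (simp add: A0)
  have comm: "A m * c = c * A m" "B m * c = c * B m" if "c \<in> D" "a * c = c * a" for m c
    using power_commute[OF aD that] power_commute[OF b(1) that(1)] dinv_commute[OF aD a(2) that]
    by (auto simp: A_def B_def b_def)
  have Ac: "a * A n = A n * a" "a * B n = B n * a" for n
    using comm(1)[OF aD, of n] comm(2)[OF aD, of n] by auto
  define N where "N n = (\<Sum>i\<le>n. A i * A i)" for n
  define L where "L n = (\<Sum>i\<le>n. B i * B i)" for n
  have NP: "N n \<in> P" for n unfolding N_def by (intro P_sum P_sq AD)
  have ND: "N n \<in> D" "N n \<in> S" for n using P_S[OF NP] S_D by auto
  have aN: "a * N n = N n * a" for n
    unfolding N_def by (simp add: sum_distrib_left sum_distrib_right) (intro sum.cong refl, metis Ac(1) mult.assoc)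
  have NN: "N m * N n = N n * N m" for m n
    unfolding N_def[of m] using comm(1)[OF ND(1) aN, of _ n]
    by (simp add: sum_distrib_left sum_distrib_right) (intro sum.cong refl, metis mult.assoc)
  have NNP: "N n * N (Suc n) \<in> P" for n using P_mult NP NN by blast
  have N_nz: "N n \<noteq> 0" for n
  proof
    assume "N n = 0"
    moreover have "N n = A 0 * A 0 + (\<Sum>i\<in>{..n} - {0}. A i * A i)"
      unfolding N_def by (subst sum.remove[of _ 0]) auto
    moreover have "(\<Sum>i\<in>{..n} - {0}. A i * A i) \<in> P" using AD by (intro P_sum P_sq)
    ultimately have "A 0 * A 0 = 0" using P_add_eq_0[OF P_sq[OF AD(2)[of 0]]] by metis
    then show False by (simp add: A0)
  qed
  have "\<exists>r\<in>S. r * (N n * N (Suc n)) * r = e \<and> r * a = a * r" for n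
  proof -
    have "a * (N n * N (Suc n)) = (N n * N (Suc n)) * a"
      using aN[of n] aN[of "Suc n"] by (metis mult.assoc)
    moreover have "N n * N (Suc n) \<noteq> 0" by (intro D_nz ND N_nz)
    ultimately show ?thesis using P_root[OF NNP] aD by metis
  qed
  then obtain r where r: "\<And>n. r n \<in> S" "\<And>n. r n * (N n * N (Suc n)) * r n = e" "\<And>n. a * r n = r n * a"
    by metis
  have rD: "r n \<in> D" for n using r S_D by blast
  have LN: "L n = B (2 * n) * N n" for n
  proof (induction n)
    case (Suc n)
    have "B (2 * Suc n) * N (Suc n) = B (2 * Suc n) * (A 0 * A 0 + (\<Sum>i\<le>n. A (Suc i) * A (Suc i)))"
      by (simp add: N_def sum.atMost_Suc_shift del: sum.atMost_Suc)
    also have "(\<Sum>i\<le>n. A (Suc i) * A (Suc i)) = A 2 * N n"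
      unfolding N_def sum_distrib_left by (simp add: AA mult_2[symmetric])
    also have "B (2 * Suc n) * (A 0 * A 0 + A 2 * N n) = B (2 * Suc n) + B (2 * n) * (B 2 * A 2) * N n"
      using AD by (simp add: A0 distrib_left D_e' mult.assoc[symmetric] AA add.commute)
    also have "B 2 * A 2 = e" using AB[of 2] comm(1)[of "B 2" 2] Ac AD by simp
    also have "B (2 * Suc n) + B (2 * n) * e * N n = L (Suc n)"
      using AD Suc by (simp add: L_def AA D_e' mult_2[symmetric] add.commute)
    finally show ?case by simp
  qed (simp add: L_def N_def A0)
  \<comment> \<open>By \<open>LN\<close>, the product \<open>L n * L (Suc n)\<close> is
    \<open>N n * N (Suc n)\<close> divided by the power \<open>4 * n + 2\<close> of
    \<open>a\<close>; its inverse square root arises from \<open>r n\<close> by half that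
    power.\<close>
  define r' where "r' n = A (2 * n + 1) * r n" for n
  have r'S: "r' n \<in> S" for n
    unfolding r'_def using AD r rD comm(1)[of "r n"] by (intro S_mult) auto
  have r'L: "r' n * (L n * L (Suc n)) * r' n = e" for n
  proof -
    let ?A = "A (2 * n + 1)"
    have 1: "L n * L (Suc n) = B (2 * n) * B (2 * Suc n) * (N n * N (Suc n))"
      unfolding LN using comm(2)[OF ND(1) aN, of "2 * Suc n" n] by (metis mult.assoc)
    have c: "z * ?A = ?A * z" if "z \<in> D" "a * z = z * a" for z using comm(1)[OF that] by simp
    have "r' n * (L n * L (Suc n)) * r' n = ?A * r n * (B (2 * n) * B (2 * Suc n)) * (N n * N (Suc n)) * (?A * r n)"
      unfolding r'_def 1 by (simp add: mult.assoc)
    also have "r n * (B (2 * n) * B (2 * Suc n)) = B (4 * n + 2) * r n"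
      unfolding AA using comm(2)[OF rD r(3), of "2 * n + 2 * Suc n" n] by (simp add: algebra_simps)
    then have "?A * r n * (B (2 * n) * B (2 * Suc n)) = ?A * B (4 * n + 2) * r n" by (simp add: mult.assoc)
    also have "?A * B (4 * n + 2) * r n * (N n * N (Suc n)) * (?A * r n) =
        ?A * B (4 * n + 2) * (r n * (N n * N (Suc n)) * ?A) * r n" by (simp add: mult.assoc)
    also have "r n * (N n * N (Suc n)) * ?A = ?A * (r n * (N n * N (Suc n)))"
      using aN[of n] aN[of "Suc n"] r(3)[of n] rD ND by (intro c) (simp, metis mult.assoc)
    also have "?A * B (4 * n + 2) * (?A * (r n * (N n * N (Suc n)))) * r n =
        ?A * (B (4 * n + 2) * ?A) * (r n * (N n * N (Suc n)) * r n)" by (simp add: mult.assoc)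
    also have "B (4 * n + 2) * ?A = ?A * B (4 * n + 2)" using c[of "B (4 * n + 2)"] Ac AD by simp
    also have "?A * (?A * B (4 * n + 2)) = A (4 * n + 2) * B (4 * n + 2)"
      by (simp add: mult.assoc[symmetric] AA)
    also have "A (4 * n + 2) * B (4 * n + 2) * (r n * (N n * N (Suc n)) * r n) = e"
      unfolding AB r(2) by simp
    finally show ?thesis .
  qed
  have cA: "A i * A j = A j * A i" "B i * B j = B j * B i" for i j by (auto simp: AA add.commute)
  have dA: "(\<exists>x. expands f A x) \<or> (\<exists>x. expands f (\<lambda>n. A 0 * A (Suc n) * r n) x \<and> x * star x = e)"
    by (rule expands_dichotomy[OF f k fk AD(2) AD(5) cA(1) N_def r(1,2)])
  have dB: "(\<exists>x. expands f B x) \<or> (\<exists>x. expands f (\<lambda>n. B 0 * B (Suc n) * r' n) x \<and> x * star x = e)"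
    by (rule expands_dichotomy[OF f k fk AD(4) AD(6) cA(2) L_def r'S r'L])
  show ?thesis
  proof (rule ccontr)
    assume "\<not> ?thesis"
    then have "\<nexists>x. expands f A x" "\<nexists>x. expands f B x"
      unfolding A_def[abs_def] B_def[abs_def] b_def by auto
    then obtain x y where x: "expands f (\<lambda>n. A 0 * A (Suc n) * r n) x" "x * star x = e"
        and y: "expands f (\<lambda>n. B 0 * B (Suc n) * r' n) y" "y * star y = e"
      using dA dB by blast
    have "expands f (\<lambda>n. A 0 * A (Suc n) * r n) (a * y)"
      unfolding expands_def
    proof (intro conjI allI)
      show "a * y \<in> cspan (range f)" using expandsD(1)[OF y(1)] aD by simp
      fix n
      have "B (Suc n) * A (2 * n + 1) = B (Suc n) * A (Suc n) * A n"
        by (simp add: mult.assoc AA mult_2)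
      also have "B (Suc n) * A (Suc n) = e" using AB[of "Suc n"] comm(1)[of "B (Suc n)" "Suc n"] Ac AD by simp
      finally have BA: "B (Suc n) * A (2 * n + 1) = A n" using AD by (simp add: D_e)
      have "a * y * star (f n) = a * (B 0 * B (Suc n) * r' n)"
        using expandsD(2)[OF y(1), of n] by (simp add: mult.assoc)
      also have "\<dots> = A 1 * (B (Suc n) * A (2 * n + 1) * r n)"
        unfolding A0 r'_def A1 using AD by (simp add: D_e mult.assoc)
      also have "\<dots> = A (Suc n) * r n" unfolding BA by (simp add: mult.assoc[symmetric] AA)
      finally show "a * y * star (f n) = A 0 * A (Suc n) * r n" unfolding A0 using AD by (simp add: D_e)
    qed
    then have "x = a * y" using x expands_unique by blast
    then have "e = a * (y * star y) * star a" using x(2) by (simp add: star_mult mult.assoc)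
    then have "a * a = e" using y(2) S_star[OF a(1)] aD by (simp add: D_e')
    then show False using a(3) by blast
  qed
qed

lemma geometric_inverse:
  fixes f k :: "nat \<Rightarrow> 'a"
  assumes f: "orthonormal f" and k: "orthonormal k" and fk: "\<And>i j. f i * star (k j) = 0"
    and a: "a \<in> S" "a \<noteq> 0" "a * a \<noteq> e" and x: "expands f (\<lambda>i. dinv a ^ i * e) x"
  shows "a * a - e \<in> P"
proof -
  have aD: "a \<in> D" using a S_D by blast
  define b where "b = dinv a"
  have b: "b \<in> D" "a * b = e" "b * a = e" "b \<in> S"
    using dinv[OF aD a(2)] dinv_S[OF a(1,2)] by (auto simp: b_def)
  have "b * b \<noteq> e"
  proof
    assume bb: "b * b = e"
    have "a * a = a * (b * b) * a" using bb aD by (simp add: D_e')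
    also have "\<dots> = (a * b) * (b * a)" by (simp add: mult.assoc)
    finally show False using b a(3) by simp
  qed
  then have "e - b * b \<in> P" using geometric(2)[OF f k fk b(4) _ x[folded b_def]] by blast
  then have "a * (e - b * b) * star a \<in> P" using aD by (intro P_conj)
  also have "a * (e - b * b) * star a = a * a - (a * b) * (b * a)"
    using S_star[OF a(1)] aD by (simp add: right_diff_distrib left_diff_distrib D_e' mult.assoc)
  finally show ?thesis using b by simp
qed

text \<open>The series in the inverse of \<open>a\<close> would put \<open>a * a - e\<close> into
  \<open>P\<close> as well, against \<open>P_antisym\<close>.\<close>

lemma geometric_expands:
  fixes f k :: "nat \<Rightarrow> 'a"
  assumes f: "orthonormal f" and k: "orthonormal k" and fk: "\<And>i j. f i * star (k j) = 0"
    and a: "a \<in> S" "a \<noteq> 0" "a * a \<noteq> e" "e - a * a \<in> P"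
  obtains x where "expands f (\<lambda>i. a ^ i * e) x"
proof -
  have "\<not> expands f (\<lambda>i. dinv a ^ i * e) x" for x
    using geometric_inverse[OF f k fk a(1-3)] P_antisym[OF a(4)] a(3) by force
  then show ?thesis using geometric_alternative[OF f k fk a(1-3)] that by blast
qed

section \<open>The total order of the symmetric scalars\<close>

lemma three_orthonormal:
  fixes h :: "nat \<Rightarrow> 'a"
  assumes h: "orthonormal h"
  shows "orthonormal (\<lambda>i. h (3 * i + a))"
    "a < 3 \<Longrightarrow> b < 3 \<Longrightarrow> a \<noteq> b \<Longrightarrow> h (3 * i + a) * star (h (3 * j + b)) = 0"
proof -
  show "orthonormal (\<lambda>i. h (3 * i + a))" by (intro orthonormal_comp[OF h] injI) simp
  show "h (3 * i + a) * star (h (3 * j + b)) = 0" if "a < 3" "b < 3" "a \<noteq> b"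
    by (intro orthonormal_orth[OF h]) (use that in presburger)
qed

lemma compare_square_1:
  assumes a: "a \<in> S" "a \<noteq> 0"
  shows "e - a * a \<in> P \<or> a * a - e \<in> P"
proof (cases "a * a = e")
  case False
  obtain h :: "nat \<Rightarrow> 'a" where h: "orthonormal h" using orthonormal_exists .
  have f: "orthonormal (\<lambda>i. h (3 * i + 0))" and k: "orthonormal (\<lambda>i. h (3 * i + 1))"
    using three_orthonormal[OF h] by blast+
  have fk: "h (3 * i + 0) * star (h (3 * j + 1)) = 0" for i j
    using three_orthonormal(2)[OF h, of 0 1] by simp
  show ?thesis
    using geometric_alternative[OF f k fk a False] geometric(2)[OF f k fk a(1) False]
      geometric_inverse[OF f k fk a False] by blast
qed simp

lemma of_nat_e: "of_nat n * e \<in> P" "of_nat n * e \<in> S" "of_nat n * e \<in> D"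
  using P_of_nat[OF P_1] P_S S_D by blast+

lemma of_nat_e_commute: "c \<in> D \<Longrightarrow> (of_nat n * e) * c = c * (of_nat n * e)"
  by (metis D_e D_e' mult.assoc mult_of_nat_commute)

lemma of_nat_e_mult: "c \<in> D \<Longrightarrow> (of_nat n * e) * c = of_nat n * c"
  by (simp add: mult.assoc D_e)

lemma P_divide_nat:
  assumes "n > 0" "s \<in> D" "of_nat n * s \<in> P" shows "s \<in> P"
proof -
  let ?n = "of_nat n * e"
  have n0: "?n \<noteq> 0" using of_nat_nz[OF assms(1), of e] by auto
  have "dinv ?n \<in> P" using P_dinv of_nat_e n0 by blast
  moreover have "dinv ?n * (of_nat n * s) = s"
    using dinv_cancel(2)[OF of_nat_e(3) n0 D_H[OF assms(2)]] assms by (simp add: of_nat_e_mult)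
  moreover have "(of_nat n * s) * dinv ?n = s"
  proof -
    have "(of_nat n * s) * dinv ?n = s * ?n * dinv ?n" using of_nat_e_commute[OF assms(2), of n] assms by (simp add: of_nat_e_mult)
    then show ?thesis using dinv_cancel_right(1)[OF of_nat_e(3) n0 assms(2)] by simp
  qed
  ultimately show ?thesis using P_mult[of "dinv ?n" "of_nat n * s"] assms(3) by simp
qed

text \<open>The transform \<open>a = (s + e) / (s - e)\<close> satisfies
  \<open>a^2 - e = 4 s / (s - e)^2\<close>, so comparing \<open>a^2\<close> with \<open>e\<close>
  decides the sign of \<open>s\<close>. Its pole \<open>e\<close> and its zero \<open>- e\<close>
  are treated apart.\<close>

lemma S_total: assumes s: "s \<in> S" shows "s \<in> P \<or> - s \<in> P"
proof (cases "s = e \<or> s = - e")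
  case True
  then show ?thesis by auto
next
  case False
  have sD: "s \<in> D" "star s = s" using s by (auto simp: S_def)
  define b where "b = s - e"
  have b: "b \<in> S" "b \<noteq> 0" "b \<in> D" using s False S_D by (auto simp: b_def)
  define a where "a = dinv b * (s + e)"
  have comm: "b * (s + e) = (s + e) * b" using sD by (simp add: b_def algebra_simps D_e D_e')
  have a: "a \<in> S" unfolding a_def
    using dinv_commute[OF b(3,2) _ comm] dinv_S[OF b(1,2)] s by (intro S_mult) (auto simp: sD)
  have a0: "a \<noteq> 0" unfolding a_def
    using D_nz[OF dinv(1)[OF b(3,2)] _ dinv_nz[OF b(3,2)], of "s + e"] sD False by (auto simp: add_eq_0_iff2)
  have ba: "b * a = s + e" using dinv_cancel(1)[OF b(3,2), of "s + e"] D_H sD by (simp add: a_def)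
  have ab: "a * b = s + e" using S_star[OF a] S_star[OF b(1)] ba sD star_mult[of b a] by (simp add: star_add)
  have 4: "b * (a * a - e) * star b = of_nat 4 * s"
  proof -
    have "b * (a * a - e) * star b = (b * a) * (a * b) - b * b"
      using S_star[OF b(1)] b by (simp add: algebra_simps D_e')
    also have "\<dots> = s + s + (s + s)" unfolding ba ab unfolding b_def using sD by (simp add: algebra_simps D_e D_e')
    also have "\<dots> = (1 + 1 + (1 + 1)) * s" by (simp only: distrib_right mult_1)
    also have "\<dots> = of_nat 4 * s" by simp
    finally show ?thesis .
  qed
  from compare_square_1[OF a a0] show ?thesis
  proof
    assume "e - a * a \<in> P"
    then have "b * (e - a * a) * star b \<in> P" using b by simp
    then have "of_nat 4 * (- s) \<in> P" using 4 by (simp add: algebra_simps)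
    then have "- s \<in> P" using P_divide_nat[of 4 "- s"] sD by simp
    then show ?thesis by blast
  next
    assume "a * a - e \<in> P"
    then have "b * (a * a - e) * star b \<in> P" using b by simp
    then have "of_nat 4 * s \<in> P" using 4 by simp
    then have "s \<in> P" using P_divide_nat[of 4 s] sD by simp
    then show ?thesis by blast
  qed
qed

section \<open>The symmetric scalars are the real numbers\<close>

lemma root_of_nat:
  assumes "n > 0"
  obtains r where "r \<in> S" "r \<noteq> 0" "r * (of_nat n * e) * r = e" "\<And>c. c \<in> D \<Longrightarrow> r * c = c * r"
proof -
  have "of_nat n * e \<noteq> 0" using of_nat_nz[OF assms, of e] by auto
  then obtain r where "r \<in> S" "r * (of_nat n * e) * r = e"
      "\<And>c. c \<in> D \<Longrightarrow> c * (of_nat n * e) = (of_nat n * e) * c \<Longrightarrow> r * c = c * r"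
    using P_root[OF of_nat_e(1)] by metis
  then show ?thesis using that of_nat_e_commute by (metis e_nz mult_zero_right)
qed

text \<open>
  If \<open>s = z\<^sup>2\<close> were a nonzero infinitesimal, the constant sequence \<open>z\<close> would be dominated by
  the summable sequence \<open>1 / sqrt ((n + 1) (n + 2))\<close>; but a vector with constant coordinates
  \<open>z\<close> has a norm \<open>N\<close> with \<open>N = z\<^sup>2 + N\<close>.
\<close>

lemma infinitesimal_eq_0:
  assumes s: "s \<in> P" and inf: "\<And>n. e - of_nat n * s \<in> P"
  shows "s = 0"
proof -
  obtain h :: "nat \<Rightarrow> 'a" where h: "orthonormal h" using orthonormal_exists .
  define f g k where "f = (\<lambda>i. h (3 * i + 0))" and "g = (\<lambda>i. h (3 * i + 1))" and "k = (\<lambda>i. h (3 * i + 2))"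
  have f: "orthonormal f" and g: "orthonormal g" and k: "orthonormal k"
    unfolding f_def g_def k_def using three_orthonormal[OF h] by blast+
  have orth: "f i * star (g j) = 0" "f i * star (k j) = 0" "g i * star (k j) = 0" for i j
    unfolding f_def g_def k_def by (rule three_orthonormal(2)[OF h]; simp)+
  obtain z where z: "z \<in> S" "z * z = s" using P_sqrt[OF s] by metis
  have zD: "z \<in> D" "star z = z" using z by (auto simp: S_def)
  \<comment> \<open>The dichotomy is used for the constant sequence \<open>e\<close>. Its first
    alternative is excluded by \<open>no_const\<close>, and with \<open>N n = n + 1\<close> the
    second one is the summable sequence described above.\<close>
  define N where "N n = (\<Sum>i\<le>n. e * e)" for n :: nat
  have N: "N n = of_nat (Suc n) * e" for n
    by (simp add: N_def)
  have NN: "N n * N (Suc n) = of_nat (Suc n * Suc (Suc n)) * e" for n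
    unfolding N of_nat_e_mult[OF of_nat_e(3)] of_nat_mult by (simp only: mult.assoc)
  have "\<exists>r. r \<in> S \<and> r \<noteq> 0 \<and> r * (N n * N (Suc n)) * r = e \<and> (\<forall>c\<in>D. r * c = c * r)" for n
    unfolding NN by (rule root_of_nat[of "Suc n * Suc (Suc n)"]) auto
  then obtain r where r: "\<And>n. r n \<in> S" "\<And>n. r n \<noteq> 0" "\<And>n. r n * (N n * N (Suc n)) * r n = e"
      "\<And>n c. c \<in> D \<Longrightarrow> r n * c = c * r n"
    by metis
  have rD: "r n \<in> D" for n using r S_D by blast
  have no_const: "d = 0" if x: "expands f (\<lambda>_. d) x" and d: "d \<in> D" for d x
  proof -
    have "x * star x = d * star d + e * (x * star x) * star e"
      by (rule expands_shift[OF f k orth(2) x d D_1]) (use d D_e in auto)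
    also have "e * (x * star x) * star e = x * star x"
      using D_inner[OF expandsD(3)[OF x] expandsD(3)[OF x]] by (simp add: D_e D_e')
    finally have "d * star d = 0" by simp
    then show ?thesis by (rule proper)
  qed
  have "(\<exists>x. expands f (\<lambda>_. e) x) \<or> (\<exists>x. expands f (\<lambda>n. e * e * r n) x \<and> x * star x = e)"
    by (rule expands_dichotomy[OF f k orth(2) _ _ _ N_def r(1,3)]) simp_all
  moreover have "\<not> expands f (\<lambda>_. e) x" for x
    using no_const[of e x] by auto
  ultimately obtain x where x: "expands f (\<lambda>n. e * e * r n) x" by blast
  have "e * e * r n = r n" for n using rD by (simp add: D_e)
  then have x: "expands f r x" using x by simp
  have "r n * r n - z * star z \<in> P" for n
  proof -
    let ?m = "Suc n * Suc (Suc n)"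
    have "r n * (of_nat ?m * s) * r n = r n * ((of_nat ?m * e) * s) * r n"
      using of_nat_e_mult[of s ?m] S_D[OF P_S[OF s]] by simp
    also have "\<dots> = r n * (of_nat ?m * e) * (s * r n)" by (simp only: mult.assoc)
    also have "s * r n = r n * s" using r(4)[of s n] S_D[OF P_S[OF s]] by simp
    also have "r n * (of_nat ?m * e) * (r n * s) = (r n * (of_nat ?m * e) * r n) * s"
      by (simp only: mult.assoc)
    also have "\<dots> = s" using r(3)[of n] S_D[OF P_S[OF s]] by (simp only: NN D_e)
    finally have "r n * (e - of_nat ?m * s) * star (r n) = r n * r n - s"
      using rD[of n] S_star[OF r(1)] by (simp only: right_diff_distrib left_diff_distrib D_e')
    moreover have "r n * (e - of_nat ?m * s) * star (r n) \<in> P"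
      using inf rD by (intro P_conj)
    ultimately show ?thesis using zD z by simp
  qed
  then obtain y where "expands f (\<lambda>_. z) y"
    using dominated_expands[OF f g k orth x r(1,2,4), of "\<lambda>_. z"] zD by metis
  then have "z = 0" using no_const zD by blast
  then show ?thesis using z by simp
qed

text \<open>If \<open>s\<close> exceeded every natural multiple of \<open>e\<close>, its inverse
  would be a nonzero infinitesimal: conjugating \<open>s - n\<close> with a square root of the
  inverse gives \<open>e - n\<close> times the inverse.\<close>

lemma S_bounded: assumes s: "s \<in> S" obtains n where "of_nat n * e - s \<in> P"
proof (rule ccontr)
  assume "\<not> thesis"
  then have "s - of_nat n * e \<in> P" for n
    using S_total[of "of_nat n * e - s"] of_nat_e(2) s that by auto
  note big = this
  then have sP: "s \<in> P" using big[of 0] by simp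
  have s0: "s \<noteq> 0"
    using big[of 1] P_antisym[of e] by auto
  have sD: "s \<in> D" using s S_D by blast
  let ?t = "dinv s"
  have tP: "?t \<in> P" using P_dinv sP s0 by blast
  obtain z where z: "z \<in> S" "z * z = ?t" "\<And>c. c * ?t = ?t * c \<Longrightarrow> z * c = c * z"
    using P_sqrt[OF tP] by metis
  have zs: "z * s = s * z" using z(3)[of s] dinv[OF sD s0] by simp
  have zD: "z \<in> D" "star z = z" using z(1) by (auto simp: S_def)
  have "e - of_nat n * ?t \<in> P" for n
  proof -
    have "z * (s - of_nat n * e) * star z \<in> P" using big zD by (intro P_conj)
    also have "z * (s - of_nat n * e) * star z = z * s * z - z * (of_nat n * e) * z"
      by (simp add: zD right_diff_distrib left_diff_distrib)
    also have "z * s * z = s * (z * z)" by (metis zs mult.assoc)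
    also have "z * (of_nat n * e) * z = of_nat n * (z * z)"
      by (metis of_nat_e_commute of_nat_e_mult mult.assoc zD(1))
    also have "s * (z * z) - of_nat n * (z * z) = e - of_nat n * ?t" unfolding z(2) dinv(2)[OF sD s0] ..
    finally show ?thesis .
  qed
  then have "?t = 0" by (rule infinitesimal_eq_0[OF tP])
  then show False using dinv_nz[OF sD s0] by simp
qed

section \<open>Comparison with rational numbers\<close>

lemma of_int_e_S [simp]: "of_int m * e \<in> S"
  by simp

lemma of_int_e_P: assumes "of_int m * e \<in> P" shows "m \<ge> 0"
proof (rule ccontr)
  assume "\<not> m \<ge> 0"
  define n where "n = nat (- m)"
  have m: "m = - int n" "n > 0" using \<open>\<not> m \<ge> 0\<close> by (simp_all add: n_def)
  then have "- (of_nat n * e) \<in> P" using assms by simp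
  then have "of_nat n * e = 0" using P_antisym of_nat_e(1) by blast
  then show False using of_nat_nz[OF m(2), of e] by simp
qed

lemma of_nat_mult_left:
  fixes x :: 'a
  shows "of_nat m * (of_nat n * x) = of_nat (m * n) * x" "of_nat m * (of_int k * x) = of_int (int m * k) * x"
  by (simp_all add: mult.assoc)

text \<open>The supremum of the lower Dedekind cut of \<open>s\<close>. The inequality between
  \<open>m / n\<close> and \<open>s\<close> is multiplied by \<open>n\<close>, which avoids division
  in \<open>D\<close>.\<close>

definition rho :: "'a \<Rightarrow> real" where
  "rho s = Sup {real_of_int m / real n | m n. n > 0 \<and> of_nat n * s - of_int m * e \<in> P}"

lemma rational_cut:
  assumes s: "s \<in> D" and n: "n > 0" "n' > 0"
    and lower: "of_nat n * s - of_int m * e \<in> P" and upper: "of_int m' * e - of_nat n' * s \<in> P"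
  shows "real_of_int m / real n \<le> real_of_int m' / real n'"
proof -
  have "of_nat n' * (of_nat n * s - of_int m * e) + of_nat n * (of_int m' * e - of_nat n' * s) \<in> P"
    using lower upper by simp
  also have "of_nat n' * (of_nat n * s - of_int m * e) + of_nat n * (of_int m' * e - of_nat n' * s) =
      of_int (int n * m' - int n' * m) * e"
    by (simp only: right_diff_distrib of_nat_mult_left of_int_diff left_diff_distrib mult.commute[of n' n]) simp
  finally have "int n' * m \<le> int n * m'" using of_int_e_P by fastforce
  then have "real n' * real_of_int m \<le> real n * real_of_int m'"
    by (metis of_int_le_iff of_int_mult of_int_of_nat_eq)
  then show ?thesis using n by (simp add: field_simps)
qed

lemma rho_lower_upper:
  assumes s: "s \<in> S" and n: "n > 0"
  shows "of_nat n * s - of_int m * e \<in> P \<Longrightarrow> real_of_int m / real n \<le> rho s"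
    and "of_int m * e - of_nat n * s \<in> P \<Longrightarrow> rho s \<le> real_of_int m / real n"
proof -
  let ?M = "{real_of_int m / real n | m n. n > 0 \<and> of_nat n * s - of_int m * e \<in> P}"
  have sD: "s \<in> D" using s S_D by blast
  obtain N where N: "of_nat N * e - s \<in> P" using S_bounded[OF s] .
  have "x \<le> real_of_int (int N) / real 1" if "x \<in> ?M" for x
    using that rational_cut[OF sD, of _ 1 _ "int N"] N by auto
  then have bdd: "bdd_above ?M" by (meson bdd_aboveI)
  obtain N' where N': "of_nat N' * e - (- s) \<in> P" using S_bounded[of "- s"] s by auto
  have "real_of_int (- int N') / real 1 \<in> ?M"
    using N' by (intro CollectI exI[of _ "- int N'"] exI[of _ 1]) (simp add: add.commute)
  then have ne: "?M \<noteq> {}" by blast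
  show "real_of_int m / real n \<le> rho s" if "of_nat n * s - of_int m * e \<in> P"
    unfolding rho_def using that n by (intro cSup_upper[OF _ bdd]) blast
  show "rho s \<le> real_of_int m / real n" if "of_int m * e - of_nat n * s \<in> P"
    unfolding rho_def using rational_cut[OF sD _ n _ that] by (intro cSup_least[OF ne]) auto
qed

lemma ratio_between:
  assumes "x < y"
  obtains m n where "n > 0" "x < real_of_int m / real n" "real_of_int m / real n < y"
proof -
  obtain q where q: "q \<in> \<rat>" "x < q" "q < y" using Rats_dense_in_real[OF assms] by blast
  then have "q \<in> {real_of_int i / real n | i n. n \<noteq> 0}" using Rats_eq_int_div_nat by metis
  then obtain m n where "q = real_of_int m / real n" "n \<noteq> 0" by blast
  then show ?thesis using q that[of n m] by simp
qed

lemma rho_cut: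
  assumes s: "s \<in> S" and n: "n > 0"
  shows "real_of_int m / real n < rho s \<Longrightarrow> of_nat n * s - of_int m * e \<in> P"
    and "rho s < real_of_int m / real n \<Longrightarrow> of_int m * e - of_nat n * s \<in> P"
proof -
  have "of_nat n * s - of_int m * e \<in> P \<or> of_int m * e - of_nat n * s \<in> P"
    using S_total[of "of_nat n * s - of_int m * e"] s by simp
  then show "real_of_int m / real n < rho s \<Longrightarrow> of_nat n * s - of_int m * e \<in> P"
    "rho s < real_of_int m / real n \<Longrightarrow> of_int m * e - of_nat n * s \<in> P"
    using rho_lower_upper[OF s n, of m] by auto
qed

text \<open>Lower fractions of \<open>s\<close> and of \<open>t\<close> add up to a lower fraction
  of \<open>s + t\<close>. Together with \<open>rho_minus\<close> this one inequality suffices for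
  additivity.\<close>

lemma rho_superadditive:
  assumes s: "s \<in> S" and t: "t \<in> S" shows "rho s + rho t \<le> rho (s + t)"
proof (rule ccontr)
  assume "\<not> ?thesis"
  then have "rho (s + t) - rho t < rho s" by simp
  then obtain m n where mn: "n > 0" "rho (s + t) - rho t < real_of_int m / real n" "real_of_int m / real n < rho s"
    using ratio_between by blast
  then have "rho (s + t) - real_of_int m / real n < rho t" by simp
  then obtain m' n' where mn': "n' > 0" "rho (s + t) - real_of_int m / real n < real_of_int m' / real n'"
      "real_of_int m' / real n' < rho t"
    using ratio_between by blast
  have "of_nat n' * (of_nat n * s - of_int m * e) + of_nat n * (of_nat n' * t - of_int m' * e) \<in> P"
    using rho_cut(1)[OF s mn(1,3)] rho_cut(1)[OF t mn'(1,3)] by simp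
  also have "of_nat n' * (of_nat n * s - of_int m * e) + of_nat n * (of_nat n' * t - of_int m' * e) =
     of_nat (n * n') * (s + t) - of_int (int n' * m + int n * m') * e"
    by (simp only: right_diff_distrib of_nat_mult_left of_int_add ring_distribs mult.commute[of n' n]) simp
  finally have "of_nat (n * n') * (s + t) - of_int (int n' * m + int n * m') * e \<in> P" .
  moreover have "n * n' > 0" using mn(1) mn'(1) by simp
  ultimately have "real_of_int (int n' * m + int n * m') / real (n * n') \<le> rho (s + t)"
    using rho_lower_upper(1)[OF S_add[OF s t], of "n * n'" "int n' * m + int n * m'"] by blast
  also have "real_of_int (int n' * m + int n * m') / real (n * n') = real_of_int m / real n + real_of_int m' / real n'"
    using mn(1) mn'(1) by (simp add: add_frac_eq mult.commute)
  finally show False using mn' by simp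
qed

lemma rho_0 [simp]: "rho 0 = 0" and rho_1 [simp]: "rho e = 1"
  using rho_lower_upper[of 0 1 0] rho_lower_upper[of e 1 1] by simp_all

text \<open>One inequality is superadditivity. For the other, totality of the order turns a fraction
  above \<open>rho s\<close> into an upper bound of \<open>s\<close>, hence its negative into a
  lower bound of \<open>- s\<close>.\<close>

lemma rho_minus: assumes s: "s \<in> S" shows "rho (- s) = - rho s"
proof (rule antisym)
  show "rho (- s) \<le> - rho s" using rho_superadditive[OF s, of "- s"] s by simp
  show "- rho s \<le> rho (- s)"
  proof (rule ccontr)
    assume "\<not> ?thesis"
    then have "rho s < - rho (- s)" by simp
    then obtain m n where mn: "n > 0" "rho s < real_of_int m / real n" "real_of_int m / real n < - rho (- s)"
      using ratio_between by blast
    then have "of_int m * e - of_nat n * s \<in> P" using rho_cut(2)[OF s mn(1)] by simp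
    then have "of_nat n * (- s) - of_int (- m) * e \<in> P" by simp
    then have "real_of_int (- m) / real n \<le> rho (- s)"
      by (rule rho_lower_upper(1)[OF S_minus[OF s] mn(1)])
    then show False using mn by simp
  qed
qed

lemma rho_add: assumes s: "s \<in> S" and t: "t \<in> S" shows "rho (s + t) = rho s + rho t"
  using rho_superadditive[OF s t] rho_superadditive[of "s + t" "- t"] s t rho_minus[OF t] by simp

lemma rho_diff: "s \<in> S \<Longrightarrow> t \<in> S \<Longrightarrow> rho (s - t) = rho s - rho t"
  using rho_add[of s "- t"] rho_minus[of t] by simp

lemma rho_sum: "(\<And>i. i \<in> A \<Longrightarrow> f i \<in> S) \<Longrightarrow> rho (sum f A) = (\<Sum>i\<in>A. rho (f i)) \<and> sum f A \<in> S"
  by (induction A rule: infinite_finite_induct) (simp_all add: rho_add)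

lemma rho_of_nat: "s \<in> S \<Longrightarrow> rho (of_nat n * s) = real n * rho s"
  by (induction n) (simp_all add: rho_add algebra_simps)

lemma rho_of_int: "s \<in> S \<Longrightarrow> rho (of_int n * s) = real_of_int n * rho s"
  by (cases n rule: int_cases2) (simp_all add: rho_of_nat rho_minus)

lemma rho_P: "s \<in> P \<Longrightarrow> rho s \<ge> 0"
  using rho_lower_upper(1)[OF P_S, of s 1 0] by simp

text \<open>This is the absence of infinitesimals: an element of \<open>P\<close> with value 0 has
  all its multiples below \<open>e\<close>.\<close>

lemma rho_eq_0: assumes s: "s \<in> S" and 0: "rho s = 0" shows "s = 0"
proof -
  have *: "t = 0" if t: "t \<in> P" "rho t = 0" for t
  proof (rule infinitesimal_eq_0[OF t(1)])
    fix n
    show "e - of_nat n * t \<in> P"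
      using rho_cut(2)[OF P_S[OF t(1)], of n 1] t(2) by (cases n) auto
  qed
  show ?thesis using S_total[OF s] *[of s] *[of "- s"] 0 rho_minus[OF s] by auto
qed

lemma rho_inj: "s \<in> S \<Longrightarrow> t \<in> S \<Longrightarrow> rho s = rho t \<Longrightarrow> s = t"
  using rho_eq_0[of "s - t"] rho_diff[of s t] by simp

lemma rho_nonneg_P: "s \<in> S \<Longrightarrow> rho s \<ge> 0 \<Longrightarrow> s \<in> P"
  using S_total[of s] rho_P[of "- s"] rho_minus[of s] rho_eq_0[of s] by fastforce

section \<open>Centrality of the symmetric scalars\<close>

lemma unitary_star: "u \<in> D \<Longrightarrow> u * star u = e \<Longrightarrow> star u * u = e"
  by (metis D_star dinv(3) dinv_unique e_nz mult_zero_left)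

text \<open>Conjugation with \<open>u\<close> preserves \<open>P\<close> and fixes the integer
  multiples of \<open>e\<close>, so it does not change the cut of \<open>s\<close>; and
  \<open>rho\<close> is injective.\<close>

lemma unitary_commute:
  assumes u: "u \<in> D" "u * star u = e" and s: "s \<in> S"
  shows "u * s = s * u"
proof -
  have u': "star u * u = e" using unitary_star u by blast
  have sD: "s \<in> D" "star s = s" using s by (auto simp: S_def)
  let ?t = "u * s * star u"
  have iff: "of_nat n * ?t - of_int m * e \<in> P \<longleftrightarrow> of_nat n * s - of_int m * e \<in> P" for n m
  proof -
    have c: "u * (of_int k * x) * star u = of_int k * (u * x * star u)" for k x
      by (metis mult.assoc mult_of_int_commute)
    have 1: "of_nat n * ?t - of_int m * e = u * (of_nat n * s - of_int m * e) * star u"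
      using c[of "int n" s] c[of m e] u by (simp add: right_diff_distrib left_diff_distrib D_e')
    moreover have "star u * (u * v * star u) * u = v" if "v \<in> D" for v
    proof -
      have "star u * (u * v * star u) * u = (star u * u) * v * (star u * u)" by (simp add: mult.assoc)
      then show ?thesis using u' that by (simp add: D_e D_e')
    qed
    then have "star u * (u * (of_nat n * s - of_int m * e) * star u) * u = of_nat n * s - of_int m * e"
      using sD S_D[OF of_int_e_S] by simp
    ultimately show ?thesis using P_conj[of u] P_conj[of "star u"] u by (metis D_star star_star)
  qed
  have "rho ?t = rho s" unfolding rho_def iff ..
  moreover have "?t \<in> S" using u sD by (intro SI) (simp_all add: star_mult star_star mult.assoc)
  ultimately have "?t = s" using rho_inj s by blast
  then have "u * s * (star u * u) = s * u" by (simp add: mult.assoc[symmetric])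
  then show ?thesis using u' u sD by (simp add: D_e')
qed

text \<open>
  A nonzero commutator of symmetric elements is skew, so its unitary part \<open>u\<close> satisfies
  \<open>star u = - u\<close> and commutes with all symmetric elements; then so does the Cayley transform
  \<open>(s + u) (s - u)\<^sup>-\<^sup>1\<close>, from which \<open>s\<close> can be recovered.
\<close>

lemma S_commute: assumes s: "s \<in> S" and t: "t \<in> S" shows "s * t = t * s"
proof (rule ccontr)
  assume ne: "s * t \<noteq> t * s"
  have sD: "s \<in> D" "star s = s" and tD: "t \<in> D" "star t = t" using s t by (auto simp: S_def)
  define d where "d = s * t - t * s"
  have d: "d \<in> D" "d \<noteq> 0" "star d = - d" using sD tD ne by (auto simp: d_def star_diff star_mult)
  obtain z u where z: "z \<in> S" and u': "u * star u = e" "u = z * d"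
    and "\<And>c. c \<in> D \<Longrightarrow> c * (d * star d) = (d * star d) * c \<Longrightarrow> z * c = c * z"
    using normalize[OF D_H[OF d(1)] d(2)] by metis
  then have zd: "z * d = d * z" using d(1,3) by (simp add: mult.assoc)
  have u: "u \<in> D" "u * star u = e" using u' S_D[OF z] d(1) by auto
  have su: "star u = - u" using zd d(3) S_star[OF z] by (simp add: u'(2) star_mult)
  have us: "u * x = x * u" if "x \<in> S" for x using unitary_commute[OF u(1,2) that] .
  define w w' where "w = s - u" and "w' = s + u"
  have wD: "w \<in> D" "w' \<in> D" using sD u by (auto simp: w_def w'_def)
  have sw: "star w = w'" "star w' = w" using sD su by (auto simp: w_def w'_def star_diff star_add)
  have ww: "w * w' = w' * w" using us[OF s] by (simp add: w_def w'_def algebra_simps)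
  have u_ne: "u \<noteq> - u"
  proof
    assume "u = - u"
    then have "u + u = 0" by (metis add.right_inverse)
    then have "u = 0" using two_nz D_H[OF u(1)] by blast
    then show False using u by simp
  qed
  have w0: "w \<noteq> 0" "w' \<noteq> 0"
  proof -
    have "s \<noteq> u" "s \<noteq> - u" using sD(2) su u_ne by (metis, metis minus_minus star_minus)
    then show "w \<noteq> 0" "w' \<noteq> 0" by (auto simp: w_def w'_def eq_neg_iff_add_eq_0)
  qed
  define c where "c = w' * dinv w"
  have cD: "c \<in> D" using wD dinv(1)[OF wD(1) w0(1)] by (simp add: c_def)
  have cw: "c * w = w'" using dinv_cancel_right(2)[OF wD(1) w0(1) wD(2)] by (simp add: c_def)
  have "c * star c = w' * dinv w * (dinv w' * w)"
    using dinv_star[OF wD(1) w0(1)] sw by (simp add: c_def star_mult)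
  also have "w' * dinv w = dinv w * w'" using dinv_commute[OF wD(1) w0(1) wD(2) ww] by simp
  also have "dinv w * w' * (dinv w' * w) = dinv w * (w' * (dinv w' * w))" by (simp add: mult.assoc)
  also have "\<dots> = e" using dinv_cancel(1)[OF wD(2) w0(2) D_H[OF wD(1)]] dinv[OF wD(1) w0(1)] by simp
  finally have "c * t = t * c" using unitary_commute[OF cD _ t] by blast
  \<comment> \<open>Since \<open>u\<close> commutes with \<open>t\<close>, both \<open>w\<close> and
    \<open>c * w = w'\<close> have the same commutator with \<open>t\<close>, namely
    \<open>- d\<close> up to the order of factors. As \<open>c\<close> commutes with
    \<open>t\<close>, this gives \<open>(c - e) * d = 0\<close>, so \<open>c = e\<close>.\<close>
  then have "c * (t * w - w * t) = t * (c * w) - (c * w) * t" by (simp add: right_diff_distrib mult.assoc[symmetric])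
  also have "\<dots> = t * w - w * t" unfolding cw using us[OF t] by (simp add: w_def w'_def algebra_simps)
  finally have "(c - e) * (t * w - w * t) = 0" using tD wD by (simp add: left_diff_distrib D_e)
  moreover have "t * w - w * t = - d" using us[OF t] by (simp add: w_def d_def algebra_simps)
  ultimately have "c = e" using D_nz[of "c - e" "- d"] cD d by auto
  then have "w' = w" using cw wD by (simp add: D_e)
  then have "u = - u" by (simp add: w_def w'_def)
  then show False using u_ne by simp
qed

text \<open>By polar decomposition \<open>d\<close> is the product of a symmetric and a unitary
  element, and \<open>s\<close> commutes with both.\<close>

lemma S_central: assumes s: "s \<in> S" and d: "d \<in> D" shows "s * d = d * s"
proof (cases "d = 0")
  case False
  obtain z w u where z: "z \<in> S" and w: "w \<in> S" "u = w * d" and u': "u * star u = e" "d = z * u"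
    using normalize[OF D_H[OF d] False] by metis
  have u: "u \<in> D" "u * star u = e" "d = z * u"
    using w(2) D_mult[OF S_D[OF w(1)] d] u' by simp_all
  have "s * (z * u) = z * (u * s)" using S_commute[OF s z] unitary_commute[OF u(1,2) s] by (metis mult.assoc)
  then show ?thesis using u by (simp add: mult.assoc)
qed simp

lemma S_mult' [simp]: "s \<in> S \<Longrightarrow> t \<in> S \<Longrightarrow> s * t \<in> S"
  using S_mult S_commute by blast

lemma rho_mult: assumes s: "s \<in> S" and t: "t \<in> S" shows "rho (s * t) = rho s * rho t"
proof -
  \<comment> \<open>An inequality for positive \<open>t\<close> is enough, since it also applies to
    \<open>- s\<close>.\<close>
  have ge: "rho s * rho t \<le> rho (s * t)" if s: "s \<in> S" and t: "t \<in> P" for s t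
  proof (rule ccontr)
    assume a: "\<not> ?thesis"
    have tS: "t \<in> S" using t P_S by blast
    have st: "s * t \<in> S" using s tS by simp
    have t0: "rho t > 0" using a rho_P[OF t] rho_eq_0[OF tS] by (cases "rho t = 0") auto
    then have "rho (s * t) / rho t < rho s" using a by (simp add: field_simps)
    then obtain m n where mn: "n > 0" "rho (s * t) / rho t < real_of_int m / real n" "real_of_int m / real n < rho s"
      using ratio_between by blast
    have "of_nat n * s - of_int m * e \<in> P" by (rule rho_cut(1)[OF s mn(1,3)])
    then have "(of_nat n * s - of_int m * e) * t \<in> P" using P_mult[OF _ t] S_commute P_S tS by blast
    then have "rho (of_nat n * (s * t) - of_int m * t) \<ge> 0"
      using rho_P S_D[OF tS] by (simp add: left_diff_distrib mult.assoc D_e)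
    then have "real n * rho (s * t) \<ge> real_of_int m * rho t"
      using st tS by (simp add: rho_diff rho_of_nat rho_of_int)
    then show False using mn t0 by (simp add: field_simps)
  qed
  have eq: "rho (s * t) = rho s * rho t" if s: "s \<in> S" and t: "t \<in> P" for s t
    using ge[OF s t] ge[of "- s" t] s t P_S[OF t] rho_minus by simp
  show ?thesis using S_total[OF t] eq[OF s, of t] eq[OF s, of "- t"] s t rho_minus by auto
qed

lemma rho_power: "s \<in> S \<Longrightarrow> rho (s ^ n * e) = rho s ^ n"
proof (induction n)
  case (Suc n)
  have "rho (s * (s ^ n * e)) = rho s * rho s ^ n" using Suc by (subst rho_mult) auto
  then show ?case by (simp add: mult.assoc)
qed simp

section \<open>Bessel's inequality and surjectivity onto the reals\<close>

lemma Bessel: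
  assumes f: "orthonormal f" and y: "y \<in> H" and A: "finite A"
  shows "y * star y - (\<Sum>i\<in>A. (y * star (f i)) * star (y * star (f i))) \<in> P"
proof -
  define c where "c i = y * star (f i)" for i
  have cD: "c i \<in> D" for i using y f by (simp add: c_def)
  define v where "v = (\<Sum>i\<in>A. c i * f i)"
  have vH: "v \<in> H" using cD f by (simp add: v_def)
  have vf: "v * star (f i) = c i" if "i \<in> A" for i
    using expandsD(2)[OF expands_base_sum[OF f, of c A], of i] cD A that by (simp add: v_def)
  have fx: "f i * star x = star (x * star (f i))" for i x by (simp add: star_mult star_star)
  have vy: "v * star y = (\<Sum>i\<in>A. c i * star (c i))"
    by (simp add: v_def sum_distrib_right mult.assoc fx[of _ y, folded c_def])
  have vv: "v * star v = (\<Sum>i\<in>A. c i * star (c i))"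
    by (subst v_def) (simp add: sum_distrib_right mult.assoc fx vf)
  have yv: "y * star v = (\<Sum>i\<in>A. c i * star (c i))"
  proof -
    have "y * star v = star (v * star y)" by (simp add: star_mult star_star)
    then show ?thesis unfolding vy by (simp add: star_sum star_mult star_star)
  qed
  have "(y - v) * star (y - v) = y * star y - (\<Sum>i\<in>A. c i * star (c i))"
    by (simp add: star_diff left_diff_distrib right_diff_distrib vy vv yv)
  moreover have "(y - v) * star (y - v) \<in> P" using y vH by simp
  ultimately show ?thesis by (simp add: c_def)
qed

lemma rho_Bessel:
  assumes f: "orthonormal f" and y: "y \<in> H" and A: "finite A"
  shows "(\<Sum>i\<in>A. rho ((y * star (f i)) * star (y * star (f i)))) \<le> rho (y * star y)"
proof -
  have S: "(y * star (f i)) * star (y * star (f i)) \<in> S" for i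
    using y f by (intro S_norm D_H) simp
  show ?thesis
    using rho_P[OF Bessel[OF assms]] rho_diff[OF S_norm[OF y]] rho_sum[of A, OF S] by simp
qed

lemma half_exists:
  obtains a where "a \<in> S" "a \<noteq> 0" "rho a * rho a = 1 / 2" "a * a \<noteq> e" "e - a * a \<in> P"
proof -
  let ?two = "of_nat 2 * e"
  have two: "?two \<in> S" "?two \<in> P" "?two \<in> D" using of_nat_e by blast+
  have r2: "rho ?two = 2" using rho_of_nat[OF S_1, of 2] by simp
  have 20: "?two \<noteq> 0" using r2 by auto
  have "rho (?two * dinv ?two) = 1" using dinv(2)[OF two(3) 20] by simp
  then have rh: "rho (dinv ?two) = 1 / 2" using rho_mult[OF two(1) dinv_S[OF two(1) 20]] r2 by simp
  obtain a where a: "a \<in> S" "a * a = dinv ?two" using P_sqrt[OF P_dinv[OF two(2) 20]] by metis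
  have ra: "rho (a * a) = 1 / 2" using a rh by simp
  then have "rho a * rho a = 1 / 2" using rho_mult[OF a(1) a(1)] by simp
  moreover have "a \<noteq> 0" using ra by auto
  moreover have "a * a \<noteq> e"
  proof
    assume "a * a = e"
    then show False using ra rho_1 by simp
  qed
  moreover have "e - a * a \<in> P" using ra a(1) rho_diff[of e "a * a"] by (intro rho_nonneg_P) auto
  ultimately show ?thesis using that a(1) by blast
qed

text \<open>
  The vector \<open>\<Sum> a\<^sup>k f k\<close> with \<open>a\<^sup>2 = 1/2\<close> has norm \<open>2\<close>; its projection to the closed span of
  those \<open>f k\<close> where the binary digit \<open>k\<close> of \<open>r\<close> is \<open>1\<close> has norm \<open>r\<close>.
\<close>

lemma rho_surj_aux:
  assumes r: "0 \<le> r" "r < 2" shows "\<exists>s\<in>S. rho s = r"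
proof -
  obtain h :: "nat \<Rightarrow> 'a" where h: "orthonormal h" using orthonormal_exists .
  define f k where "f = (\<lambda>i. h (3 * i + 0))" and "k = (\<lambda>i. h (3 * i + 1))"
  have f: "orthonormal f" and k: "orthonormal k"
    unfolding f_def k_def using three_orthonormal[OF h] by blast+
  have fk: "f i * star (k j) = 0" for i j
    unfolding f_def k_def by (rule three_orthonormal(2)[OF h]; simp)
  obtain a where a: "a \<in> S" "a \<noteq> 0" "rho a * rho a = 1 / 2" "a * a \<noteq> e" "e - a * a \<in> P"
    using half_exists .
  obtain x where x: "expands f (\<lambda>i. a ^ i * e) x" using geometric_expands[OF f k fk a(1,2,4,5)] .
  have xH: "x \<in> H" using expandsD(3)[OF x] .
  have "rho (x * star x) * rho (e - a * a) = 1"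
    using geometric(1)[OF f k fk a(1,4) x] rho_mult[OF S_norm[OF xH], of "e - a * a"] a(1) by simp
  moreover have "rho (e - a * a) = 1 / 2" using a rho_mult[OF a(1) a(1)] rho_diff[of e "a * a"] by simp
  ultimately have rx: "rho (x * star x) = 2" by simp
  \<comment> \<open>The positions of the binary digits 1 of \<open>r\<close>. Digit 0 has weight 1,
    which is why \<open>r\<close> ranges up to 2.\<close>
  define E where "E = {k. odd \<lfloor>2 ^ k * r\<rfloor>}"
  obtain p where p: "projection star p" "\<And>y. y \<in> cspan (f ` E) \<Longrightarrow> y * p = y"
      "\<And>y. (\<And>z. z \<in> f ` E \<Longrightarrow> z * star y = 0) \<Longrightarrow> y * p = 0"
    by (rule cspan_projection[of "f ` E"]) blast
  have fp: "f i * p = (if i \<in> E then f i else 0)" for i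
  proof (cases "i \<in> E")
    case True
    then show ?thesis using p(2)[OF cspan_base[of "f i" "f ` E"]] f by simp
  next
    case False
    have "f i * p = 0"
    proof (rule p(3))
      fix z assume "z \<in> f ` E"
      then obtain j where "z = f j" "j \<in> E" by blast
      then show "z * star (f i) = 0" using orthonormal_orth[OF f, of j i] False by blast
    qed
    then show ?thesis using False by simp
  qed
  have pf: "p * star (f i) = (if i \<in> E then star (f i) else 0)" for i
    using arg_cong[OF fp, of star i] p(1) by (simp add: star_mult projection_def split: if_splits)
  \<comment> \<open>Bessel's inequality bounds norms only from below. Applied to the complementary
    part \<open>y'\<close> too, with the total norm known to be 2, it also gives an upper bound for
    the norm of \<open>y\<close>.\<close>
  define y y' where "y = x * p" and "y' = x * (1 - p)"
  have yH: "y \<in> H" "y' \<in> H" using xH by (auto simp: y_def y'_def)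
  have sum2: "rho (y * star y) + rho (y' * star y') = 2"
    using rx projection_norm[OF p(1), of x] rho_add[OF S_norm[OF yH(1)] S_norm[OF yH(2)]]
    by (simp add: y_def y'_def)
  have xf: "x * star (f i) = a ^ i * e" for i using expandsD(2)[OF x] .
  have yf: "y * star (f i) = (if i \<in> E then a ^ i * e else 0)"
    "y' * star (f i) = (if i \<in> E then 0 else a ^ i * e)" for i
    by (simp_all add: y_def y'_def mult.assoc pf xf left_diff_distrib right_diff_distrib)
  have ra: "rho ((a ^ i * e) * star (a ^ i * e)) = 1 / 2 ^ i" for i
  proof -
    have "rho ((a ^ i * e) * star (a ^ i * e)) = rho a ^ i * rho a ^ i"
      using S_star[OF power_S[OF a(1)]] rho_mult[OF power_S[OF a(1)] power_S[OF a(1)]] rho_power[OF a(1)] by simp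
    also have "\<dots> = (rho a * rho a) ^ i" by (simp add: power_mult_distrib)
    finally show ?thesis using a(3) by (simp add: power_one_over)
  qed
  have dig: "(\<Sum>i\<le>n. if i \<in> E then 1 / 2 ^ i else 0) = real_of_int \<lfloor>2 ^ n * r\<rfloor> / 2 ^ n" for n
  proof (induction n)
    case 0
    have "\<lfloor>r\<rfloor> = 0 \<or> \<lfloor>r\<rfloor> = 1" using r by linarith
    then show ?case by (auto simp: E_def)
  next
    case (Suc n)
    define m where "m = \<lfloor>2 ^ n * r\<rfloor>"
    have "\<lfloor>2 ^ Suc n * r\<rfloor> = 2 * m \<or> \<lfloor>2 ^ Suc n * r\<rfloor> = 2 * m + 1"
      unfolding m_def by (simp add: mult.assoc) linarith
    then have "real_of_int \<lfloor>2 ^ Suc n * r\<rfloor> = 2 * real_of_int m + (if Suc n \<in> E then 1 else 0)"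
      by (auto simp: E_def)
    then show ?case using Suc unfolding m_def[symmetric] by (simp add: field_simps)
  qed
  have geo: "(\<Sum>i\<le>n. 1 / 2 ^ i) = 2 - 1 / (2::real) ^ n" for n
    by (induction n) (simp_all add: field_simps)
  have low: "real_of_int \<lfloor>2 ^ n * r\<rfloor> / 2 ^ n \<le> rho (y * star y)" for n
  proof -
    have "(\<Sum>i\<le>n. rho ((y * star (f i)) * star (y * star (f i)))) = real_of_int \<lfloor>2 ^ n * r\<rfloor> / 2 ^ n"
      unfolding dig[symmetric] using ra by (intro sum.cong) (auto simp: yf)
    then show ?thesis using rho_Bessel[OF f yH(1), of "{..n}"] by simp
  qed
  have up: "rho (y * star y) \<le> real_of_int \<lfloor>2 ^ n * r\<rfloor> / 2 ^ n + 1 / 2 ^ n" for n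
  proof -
    have "(\<Sum>i\<le>n. rho ((y' * star (f i)) * star (y' * star (f i)))) =
        (\<Sum>i\<le>n. 1 / 2 ^ i) - real_of_int \<lfloor>2 ^ n * r\<rfloor> / 2 ^ n"
      unfolding dig[symmetric] sum_subtractf[symmetric] using ra by (intro sum.cong) (auto simp: yf)
    then show ?thesis using rho_Bessel[OF f yH(2), of "{..n}"] sum2 geo[of n] by simp
  qed
  have "\<bar>rho (y * star y) - r\<bar> \<le> 1 / 2 ^ n" for n
  proof -
    have "real_of_int \<lfloor>2 ^ n * r\<rfloor> \<le> 2 ^ n * r" "2 ^ n * r \<le> real_of_int \<lfloor>2 ^ n * r\<rfloor> + 1" by linarith+
    then have "real_of_int \<lfloor>2 ^ n * r\<rfloor> / 2 ^ n \<le> r" "r \<le> real_of_int \<lfloor>2 ^ n * r\<rfloor> / 2 ^ n + 1 / 2 ^ n"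
      by (simp_all add: field_simps)
    then show ?thesis using low[of n] up[of n] by linarith
  qed
  then have "\<bar>rho (y * star y) - r\<bar> \<le> 0"
    by (intro LIMSEQ_le_const[OF LIMSEQ_inverse_realpow_zero[of 2, simplified]])
       (auto simp: inverse_eq_divide)
  then show ?thesis using S_norm[OF yH(1)] by auto
qed

lemma rho_bij: "bij_betw rho S UNIV"
proof -
  have "\<exists>s\<in>S. rho s = r" for r
  proof -
    have "0 \<le> r - real_of_int \<lfloor>r\<rfloor>" "r - real_of_int \<lfloor>r\<rfloor> < 2" by linarith+
    then obtain s where s: "s \<in> S" "rho s = r - real_of_int \<lfloor>r\<rfloor>" using rho_surj_aux by blast
    have "rho (s + of_int \<lfloor>r\<rfloor> * e) = r" using s rho_add[OF s(1) of_int_e_S] rho_of_int[OF S_1] by simp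
    then show ?thesis using s by (intro bexI[of _ "s + of_int \<lfloor>r\<rfloor> * e"]) simp_all
  qed
  then show ?thesis unfolding bij_betw_def inj_on_def using rho_inj by (auto simp: image_iff) metis
qed

definition iota :: "real \<Rightarrow> 'a" where "iota = inv_into S rho"

lemma iota_S [simp]: "iota r \<in> S" and rho_iota [simp]: "rho (iota r) = r"
  using bij_betw_inv_into_right[OF rho_bij, of r] inv_into_into[of r rho S] rho_bij
  by (auto simp: iota_def bij_betw_def)

lemma iota_D [simp]: "iota r \<in> D" and iota_star [simp]: "star (iota r) = iota r"
  using iota_S[of r] unfolding S_def by blast+

lemma iota_rho: "s \<in> S \<Longrightarrow> iota (rho s) = s"
  by (rule rho_inj) simp_all

lemma iota_add: "iota (x + y) = iota x + iota y"
  by (rule rho_inj) (simp_all add: rho_add)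

lemma iota_mult: "iota (x * y) = iota x * iota y"
  by (rule rho_inj) (simp_all add: rho_mult)

lemma iota_minus: "iota (- x) = - iota x"
  by (rule rho_inj) (simp_all add: rho_minus)

lemma iota_diff: "iota (x - y) = iota x - iota y"
  by (rule rho_inj) (simp_all add: rho_diff)

lemma iota_0 [simp]: "iota 0 = 0" and iota_1 [simp]: "iota 1 = e"
  by (rule rho_inj; simp)+

lemma iota_eq_iff: "iota x = iota y \<longleftrightarrow> x = y"
  by (metis rho_iota)

lemma iota_commute: "d \<in> D \<Longrightarrow> d * iota r = iota r * d"
  using S_central iota_S by metis

section \<open>The theorem of Frobenius\<close>

definition scalar_iso :: "('k::conj_scalar \<Rightarrow> 'a) \<Rightarrow> bool" where
  "scalar_iso \<theta> \<longleftrightarrow> (\<forall>x y. \<theta> (x + y) = \<theta> x + \<theta> y) \<and> (\<forall>x y. \<theta> (x * y) = \<theta> x * \<theta> y) \<and>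
    \<theta> 1 = e \<and> range \<theta> = D \<and> (\<forall>x. star (\<theta> x) = \<theta> (sconj x))"

text \<open>The imaginary parts of scalars.\<close>

definition V :: "'a set" where "V = {v \<in> D. star v = - v}"

lemma V_D: "v \<in> V \<Longrightarrow> v \<in> D" and V_star: "v \<in> V \<Longrightarrow> star v = - v"
  by (simp_all add: V_def)

lemma V_add [simp]: "v \<in> V \<Longrightarrow> w \<in> V \<Longrightarrow> v + w \<in> V"
  by (simp add: V_def star_add)

lemma V_iota_mult [simp]: "v \<in> V \<Longrightarrow> iota r * v \<in> V"
  using iota_commute[of v r] by (simp add: V_def star_mult)

lemma iota_left_commute: "d \<in> D \<Longrightarrow> d * (iota r * x) = iota r * (d * x)"
  using iota_commute[of d r] by (metis mult.assoc)

lemma iota_mult_left: "iota r * (iota s * x) = iota (r * s) * x"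
  by (simp add: iota_mult mult.assoc)

lemma D_cases_V:
  assumes d: "d \<in> D"
  obtains r v where "v \<in> V" "d = iota r + v"
proof -
  have 1: "d + star d \<in> S" using d by (simp add: S_def star_add star_star add.commute)
  have 2: "d - star d \<in> V" using d by (simp add: V_def star_diff star_star)
  have "iota (1/2) * ((d + star d) + (d - star d)) = (iota (1/2) + iota (1/2)) * d"
    by (simp add: algebra_simps)
  also have "\<dots> = d" unfolding iota_add[symmetric] using d by (simp add: D_e)
  finally have "d = iota (1/2) * iota (rho (d + star d)) + iota (1/2) * (d - star d)"
    by (simp only: distrib_left iota_rho[OF 1])
  then show ?thesis using that[of "iota (1/2) * (d - star d)" "1/2 * rho (d + star d)"] 2
    by (simp only: iota_mult V_iota_mult)
qed

text \<open>\<open>v * v = - (v * star v)\<close> is a negative real number, which rescaling turns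
  into \<open>- e\<close>.\<close>

lemma V_normalize:
  assumes v: "v \<in> V" "v \<noteq> 0"
  obtains j r where "j \<in> V" "j * j = - e" "v = iota r * j"
proof -
  have vD: "v \<in> D" "star v = - v" using v by (auto simp: V_def)
  define r where "r = sqrt (rho (v * star v))"
  have nS: "v * star v \<in> S" using S_norm[OF D_H[OF vD(1)]] .
  have "v * star v \<noteq> 0" using proper[of v] v(2) by metis
  then have rp: "rho (v * star v) > 0"
    using rho_P[OF P_norm[OF D_H[OF vD(1)]]] rho_eq_0[OF nS] by fastforce
  then have r: "r > 0" "r * r = rho (v * star v)" by (auto simp: r_def)
  have vv: "v * v = - iota (r * r)" using iota_rho[OF nS] vD r by simp
  define j where "j = iota (1 / r) * v"
  have "j * j = iota (1 / r) * (iota (1 / r) * (v * v))"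
    using iota_left_commute[OF vD(1)] by (simp add: j_def mult.assoc)
  also have "\<dots> = - iota (1 / r * (1 / r) * (r * r))" unfolding vv by (simp only: iota_mult mult.assoc mult_minus_right)
  also have "1 / r * (1 / r) * (r * r) = 1" using r(1) by simp
  finally have "j * j = - e" by simp
  moreover have "v = iota r * j"
  proof -
    have "iota r * j = iota (r * (1 / r)) * v" unfolding j_def iota_mult_left ..
    also have "r * (1 / r) = 1" using r(1) by simp
    finally show ?thesis using vD by (simp add: D_e)
  qed
  moreover have "j \<in> V" using v by (simp add: j_def)
  ultimately show ?thesis using that by blast
qed

text \<open>The symmetrized product of skew elements is symmetric, hence real. It is
  \<open>- 2\<close> times an inner product on \<open>V\<close> for which orthogonal means
  anticommuting, and \<open>orthogonalize_V\<close> is its Gram-Schmidt step.\<close>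

lemma anticommutator: assumes "v \<in> V" "w \<in> V" obtains c where "v * w + w * v = iota c"
proof -
  have "v * w + w * v \<in> S"
    using assms by (intro SI) (simp_all add: V_D V_star star_add star_mult add.commute)
  then show ?thesis using that iota_rho by metis
qed

lemma orthogonalize_V:
  assumes i: "i \<in> V" "i * i = - e" and w: "w \<in> V"
  obtains c where "i * (w + iota c * i) + (w + iota c * i) * i = 0"
proof -
  obtain b where b: "i * w + w * i = iota b" using anticommutator i w by metis
  have "i * (w + iota (b/2) * i) + (w + iota (b/2) * i) * i
      = (i * w + w * i) + (iota (b/2) * (i * i) + iota (b/2) * (i * i))"
    using iota_left_commute[OF V_D[OF i(1)], of "b/2" i] by (simp add: algebra_simps)
  also have "\<dots> = iota b - (iota (b/2) + iota (b/2))" unfolding b i(2) by (simp add: D_e')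
  also have "\<dots> = 0" unfolding iota_add[symmetric] by simp
  finally show ?thesis using that by blast
qed

lemma scalar_iso_real:
  assumes "V = {0}" shows "scalar_iso (iota :: real \<Rightarrow> 'a)"
proof -
  have "d \<in> range iota" if dD: "d \<in> D" for d
  proof -
    obtain r v where "v \<in> V" "d = iota r + v" using D_cases_V[OF dD] .
    then show ?thesis using assms by auto
  qed
  then show ?thesis by (auto simp: scalar_iso_def iota_add iota_mult sconj_real_def)
qed

lemma scalar_iso_complex:
  assumes i: "i \<in> V" "i * i = - e" and gen: "\<And>v. v \<in> V \<Longrightarrow> \<exists>c. v = iota c * i"
  shows "scalar_iso (\<lambda>z. iota (Re z) + iota (Im z) * i)"
proof -
  have iD: "i \<in> D" "star i = - i" using i by (auto simp: V_def)
  have "d \<in> range (\<lambda>z. iota (Re z) + iota (Im z) * i)" if dD: "d \<in> D" for d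
  proof -
    obtain r v where v: "v \<in> V" "d = iota r + v" using D_cases_V[OF dD] .
    obtain c where "v = iota c * i" using gen v by blast
    then have "d = iota (Re (Complex r c)) + iota (Im (Complex r c)) * i" using v by simp
    then show ?thesis by blast
  qed
  then have surj: "range (\<lambda>z. iota (Re z) + iota (Im z) * i) = D" using iD by auto
  note comm = iota_left_commute[OF iD(1)] iota_commute[OF iD(1)]
  have mult: "(iota a + iota b * i) * (iota a' + iota b' * i) =
      iota (a * a' - b * b') + iota (a * b' + b * a') * i" for a b a' b'
    by (simp add: ring_distribs iota_add iota_diff iota_mult
        mult.assoc comm i(2) D_e')
  have add: "iota (a + a') + iota (b + b') * i = iota a + iota b * i + (iota a' + iota b' * i)" for a b a' b'
    by (simp add: iota_add distrib_right)
  have star: "star (iota a + iota b * i) = iota a + iota (- b) * i" for a b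
    using comm iD by (simp add: star_add star_mult iota_minus)
  show ?thesis unfolding scalar_iso_def
    by (intro conjI allI surj) (simp_all add: add mult star sconj_complex_def)
qed

lemma scalar_iso_quat:
  assumes i: "i \<in> V" "i * i = - e" and j: "j \<in> V" "j * j = - e" and ij: "i * j + j * i = 0"
  shows "scalar_iso (\<lambda>q. iota (qRe q) + iota (qI q) * i + iota (qJ q) * j + iota (qK q) * (i * j))"
proof -
  have iD: "i \<in> D" "star i = - i" and jD: "j \<in> D" "star j = - j" using i j by (auto simp: V_def)
  define k where "k = i * j"
  have ji: "j * i = - k" using minus_unique[OF ij] by (simp add: k_def)
  have ijk: "i * j = k" by (simp add: k_def)
  have kD: "k \<in> D" "star k = - k" using iD jD ji by (auto simp: k_def star_mult)
  have ik: "i * k = - j" using i(2) jD by (simp add: k_def mult.assoc[symmetric] D_e)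
  have kj: "k * j = - i" using j(2) iD by (simp add: k_def mult.assoc D_e')
  have ki: "k * i = j" using ik iD jD ji by (metis k_def ijk minus_minus mult.assoc mult_minus_right)
  have jk: "j * k = i" using ji kj by (metis ijk minus_minus mult.assoc mult_minus_left)
  have kk: "k * k = - e" using ki j(2) by (metis ijk mult.assoc)
  have kV: "k \<in> V" using kD by (simp add: V_def)
  have gen: "\<exists>a b c. v = iota a * i + iota b * j + iota c * k" if v: "v \<in> V" for v
  proof -
    obtain a where a: "i * (v + iota a * i) + (v + iota a * i) * i = 0" using orthogonalize_V[OF i v] .
    obtain b where b: "j * (v + iota b * j) + (v + iota b * j) * j = 0" using orthogonalize_V[OF j v] .
    obtain c where c: "k * (v + iota c * k) + (v + iota c * k) * k = 0" using orthogonalize_V[OF kV kk v] .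
    \<comment> \<open>With the components along \<open>i\<close>, \<open>j\<close> and
      \<open>k\<close> removed, \<open>w\<close> anticommutes with all three. Anticommuting with
      \<open>i\<close> and \<open>j\<close> it commutes with \<open>k = i * j\<close>, so
      \<open>k * w = 0\<close>.\<close>
    define w where "w = v + iota a * i + iota b * j + iota c * k"
    have wD: "w \<in> D" using V_D[OF v] iD jD kD by (simp add: w_def)
    note comm = iota_left_commute[OF iD(1)] iota_left_commute[OF jD(1)] iota_left_commute[OF kD(1)]
    note prods = ijk ji ik ki jk kj
    have wi: "w * i = - (i * w)"
    proof -
      have "i * w + w * i = i * (v + iota a * i) + (v + iota a * i) * i"
        unfolding w_def by (simp add: algebra_simps comm prods)
      then show ?thesis using a by (simp add: eq_neg_iff_add_eq_0 add.commute)
    qed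
    have wj: "w * j = - (j * w)"
    proof -
      have "j * w + w * j = j * (v + iota b * j) + (v + iota b * j) * j"
        unfolding w_def by (simp add: algebra_simps comm prods)
      then show ?thesis using b by (simp add: eq_neg_iff_add_eq_0 add.commute)
    qed
    have wk: "w * k = - (k * w)"
    proof -
      have "k * w + w * k = k * (v + iota c * k) + (v + iota c * k) * k"
        unfolding w_def by (simp add: algebra_simps comm prods)
      then show ?thesis using c by (simp add: eq_neg_iff_add_eq_0 add.commute)
    qed
    have "w * k = k * w"
    proof -
      have "w * k = (w * i) * j" by (simp add: k_def mult.assoc)
      also have "\<dots> = - (i * (w * j))" unfolding wi by (simp add: mult.assoc)
      also have "\<dots> = k * w" unfolding wj by (simp add: k_def mult.assoc)
      finally show ?thesis .
    qed
    then have "k * w + k * w = 0" using wk by (metis add.right_inverse)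
    then have "k * w = 0" by (rule two_nz[OF D_mult_H[OF kD(1) D_H[OF wD]]])
    moreover have "k \<noteq> 0" using kk by auto
    ultimately have "w = 0" using D_nz[OF kD(1) wD] by blast
    then have "v = - (iota a * i + iota b * j + iota c * k)"
      unfolding w_def by (simp only: eq_neg_iff_add_eq_0 add.assoc)
    then have "v = iota (- a) * i + iota (- b) * j + iota (- c) * k" by (simp add: iota_minus)
    then show ?thesis by blast
  qed
  have surj: "d \<in> range (\<lambda>q. iota (qRe q) + iota (qI q) * i + iota (qJ q) * j + iota (qK q) * k)"
    if dD: "d \<in> D" for d
  proof -
    obtain r v where v: "v \<in> V" "d = iota r + v" using D_cases_V[OF dD] .
    obtain a b c where abc: "v = iota a * i + iota b * j + iota c * k" using gen v by blast
    show ?thesis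
      by (rule range_eqI[of _ _ "Quat r a b c"]) (simp add: v abc add.assoc)
  qed
  note comm = iota_left_commute[OF iD(1)] iota_left_commute[OF jD(1)] iota_left_commute[OF kD(1)]
     iota_commute[OF iD(1)] iota_commute[OF jD(1)] iota_commute[OF kD(1)]
  have mult: "(iota a + iota b * i + iota c * j + iota d * k) * (iota a' + iota b' * i + iota c' * j + iota d' * k)
     = iota (a * a' - b * b' - c * c' - d * d') + iota (a * b' + b * a' + c * d' - d * c') * i
       + iota (a * c' - b * d' + c * a' + d * b') * j + iota (a * d' + b * c' - c * b' + d * a') * k"
    for a b c d a' b' c' d'
    by (simp add: ring_distribs iota_add iota_diff iota_mult
        mult.assoc comm ijk ji ik ki jk kj kk i(2) j(2) D_e' iD jD kD)
  have add: "iota (a + a') + iota (b + b') * i + iota (c + c') * j + iota (d + d') * k =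
      iota a + iota b * i + iota c * j + iota d * k + (iota a' + iota b' * i + iota c' * j + iota d' * k)"
    for a b c d a' b' c' d'
    by (simp add: iota_add distrib_right)
  have star: "star (iota a + iota b * i + iota c * j + iota d * k) =
      iota a + iota (- b) * i + iota (- c) * j + iota (- d) * k" for a b c d
    using comm iD jD kD by (simp add: star_add star_mult iota_minus)
  show ?thesis unfolding scalar_iso_def k_def[symmetric]
  proof (intro conjI allI)
    show "range (\<lambda>q. iota (qRe q) + iota (qI q) * i + iota (qJ q) * j + iota (qK q) * k) = D"
      using surj iD jD kD by auto
  qed (simp_all add: add mult star sconj_quat_def)
qed

text \<open>The three cases are that there is no imaginary unit, one up to real factors, or a second
  one, which can be made to anticommute with the first.\<close>

lemma scalar_iso_exists:
  "(\<exists>\<theta> :: real \<Rightarrow> 'a. scalar_iso \<theta>) \<or> (\<exists>\<theta> :: complex \<Rightarrow> 'a. scalar_iso \<theta>) \<or>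
   (\<exists>\<theta> :: quat \<Rightarrow> 'a. scalar_iso \<theta>)"
proof (cases "V = {0}")
  case True
  then show ?thesis using scalar_iso_real by blast
next
  case False
  moreover have "0 \<in> V" by (simp add: V_def)
  ultimately obtain v where "v \<in> V" "v \<noteq> 0" by blast
  then obtain i where i: "i \<in> V" "i * i = - e" using V_normalize by metis
  show ?thesis
  proof (cases "\<forall>v\<in>V. \<exists>c. v = iota c * i")
    case True
    then show ?thesis using scalar_iso_complex[OF i] by blast
  next
    case False
    then obtain w where w: "w \<in> V" "\<And>c. w \<noteq> iota c * i" by blast
    obtain c where c: "i * (w + iota c * i) + (w + iota c * i) * i = 0" using orthogonalize_V[OF i w(1)] .
    have "w + iota c * i \<noteq> 0" using w(2)[of "- c"] by (auto simp: iota_minus eq_neg_iff_add_eq_0)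
    moreover have "w + iota c * i \<in> V" using w i by simp
    ultimately obtain j r where j: "j \<in> V" "j * j = - e" "w + iota c * i = iota r * j"
      using V_normalize by metis
    have r0: "r \<noteq> 0" using j(3) \<open>w + iota c * i \<noteq> 0\<close> by auto
    have "iota r * (i * j + j * i) = 0"
      using c iota_left_commute[OF V_D[OF i(1)], of r j] unfolding j(3) by (simp add: distrib_left mult.assoc)
    moreover have "iota r \<noteq> 0" using r0 iota_eq_iff[of r 0] by simp
    moreover have "i * j + j * i \<in> D" using V_D i j by simp
    ultimately have "i * j + j * i = 0" using D_nz iota_D by blast
    then show ?thesis using scalar_iso_quat[OF i j(1,2)] by blast
  qed
qed

section \<open>Orthonormalization\<close>

text \<open>A vector \<open>b\<close> is avoided by pairing: some combination of
  \<open>h (2 * i)\<close> and \<open>h (2 * i + 1)\<close>, nonzero because one coefficient is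
  \<open>e\<close>, is orthogonal to \<open>b\<close>. The pairs are disjoint, so these combinations
  stay orthogonal.\<close>

lemma orthonormal_avoiding:
  assumes "finite G" "G \<subseteq> H"
  shows "\<exists>h :: nat \<Rightarrow> 'a. orthonormal h \<and> (\<forall>i. \<forall>x\<in>G. h i * star x = 0)"
  using assms
proof (induction G)
  case empty
  then show ?case using orthonormal_exists by blast
next
  case (insert b G)
  then obtain h :: "nat \<Rightarrow> 'a" where h: "orthonormal h" "\<And>i x. x \<in> G \<Longrightarrow> h i * star x = 0" by auto
  have bH: "b \<in> H" using insert by simp
  have "\<exists>c d. c \<in> D \<and> d \<in> D \<and> (c = e \<or> d = e) \<and> (c * h (2 * i) + d * h (2 * i + 1)) * star b = 0" for i
  proof -
    define \<beta> \<gamma> where "\<beta> = h (2 * i) * star b" and "\<gamma> = h (2 * i + 1) * star b"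
    have \<beta>\<gamma>: "\<beta> \<in> D" "\<gamma> \<in> D" using bH h by (auto simp: \<beta>_def \<gamma>_def)
    show ?thesis
    proof (cases "\<gamma> = 0")
      case True
      then show ?thesis
        by (intro exI[of _ 0] exI[of _ e]) (simp add: \<gamma>_def mult.assoc)
    next
      case False
      define d where "d = - (\<beta> * dinv \<gamma>)"
      have dD: "d \<in> D" using \<beta>\<gamma> dinv(1)[OF \<beta>\<gamma>(2) False] by (simp add: d_def)
      have "d * \<gamma> = - \<beta>" using dinv_cancel_right(2)[OF \<beta>\<gamma>(2) False \<beta>\<gamma>(1)] by (simp add: d_def)
      then have "(e * h (2 * i) + d * h (2 * i + 1)) * star b = 0"
        using h by (simp add: \<beta>_def \<gamma>_def distrib_right mult.assoc H_e)
      then show ?thesis using dD D_1 by blast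
    qed
  qed
  then obtain c d where cd: "\<And>i. c i \<in> D" "\<And>i. d i \<in> D" "\<And>i. c i = e \<or> d i = e"
      "\<And>i. (c i * h (2 * i) + d i * h (2 * i + 1)) * star b = 0"
    by metis
  define y where "y i = c i * h (2 * i) + d i * h (2 * i + 1)" for i
  have ne: "2 * i \<noteq> Suc (2 * j)" "Suc (2 * j) \<noteq> 2 * i" for i j :: nat by presburger+
  have yH: "y i \<in> H" for i using cd h by (simp add: y_def)
  have "y i * star (h (2 * i)) = c i" "y i * star (h (2 * i + 1)) = d i" for i
    using cd(1,2) h ne by (simp_all add: y_def distrib_right orthonormal_simps D_e')
  then have y0: "y i \<noteq> 0" for i using cd(3)[of i] by (metis e_nz mult_zero_left)
  have yy: "y i * star (y j) = 0" if "i \<noteq> j" for i j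
    using cd(1,2) h that ne unfolding y_def
    by (simp add: star_add star_mult ring_distribs mult.assoc[symmetric] orthonormal_simps)
  have "\<exists>u w. u \<in> H \<and> u * star u = e \<and> u = w * y i" for i using normalize[OF yH y0] by metis
  then obtain h' w where h': "\<And>i. h' i \<in> H" "\<And>i. h' i * star (h' i) = e" "\<And>i. h' i = w i * y i" by metis
  have "h' i * star (h' j) = w i * (y i * star (y j)) * star (w j)" for i j
    unfolding h'(3) by (simp add: star_mult mult.assoc)
  then have "orthonormal h'" using h'(1,2) yy by (intro orthonormalI) auto
  moreover have "h' i * star x = 0" if "x \<in> insert b G" for i x
    using that cd(4) h(2) by (auto simp: h'(3) y_def distrib_right mult.assoc)
  ultimately show ?case by blast
qed

lemma unit_avoiding:
  assumes "finite G" "G \<subseteq> H"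
  obtains u where "u \<in> H" "u * star u = e" "\<And>x. x \<in> G \<Longrightarrow> u * star x = 0"
  using orthonormal_avoiding[OF assms] orthonormal_norm orthonormal_H by metis

text \<open>General in \<open>B\<close> because it serves both the inner product and the form
  attached to a contraction. The \<open>x k\<close> may be dependent while \<open>g\<close> has to
  be an infinite sequence: when \<open>x k\<close> adds nothing new, a vector from
  \<open>unit_avoiding\<close> takes its place.\<close>

lemma gram_schmidt:
  fixes B :: "'a \<Rightarrow> 'a \<Rightarrow> 'a" and x :: "nat \<Rightarrow> 'a"
  assumes BD: "\<And>x y. x \<in> H \<Longrightarrow> y \<in> H \<Longrightarrow> B x y \<in> D"
    and B_add: "\<And>x y z. x \<in> H \<Longrightarrow> y \<in> H \<Longrightarrow> z \<in> H \<Longrightarrow> B (x + y) z = B x z + B y z"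
    and B_mult: "\<And>d x y. d \<in> D \<Longrightarrow> x \<in> H \<Longrightarrow> y \<in> H \<Longrightarrow> B (d * x) y = d * B x y"
    and B_star: "\<And>x y. x \<in> H \<Longrightarrow> y \<in> H \<Longrightarrow> star (B x y) = B y x"
    and B_pos: "\<And>x. x \<in> H \<Longrightarrow> B x x \<in> P" "\<And>x. x \<in> H \<Longrightarrow> x \<noteq> 0 \<Longrightarrow> B x x \<noteq> 0"
    and x: "\<And>k. x k \<in> H"
  obtains g where "\<And>k. g k \<in> H" "\<And>k j. B (g k) (g j) = (if k = j then e else 0)"
    "\<And>k. x k = (\<Sum>j\<le>k. B (x k) (g j) * g j)"
proof -
  have B_0: "B 0 y = 0" if "y \<in> H" for y using B_mult[of 0 0 y] that by simp
  have B_sum: "B (\<Sum>j\<in>A. c j * g j) y = (\<Sum>j\<in>A. c j * B (g j) y)"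
    if "finite A" "\<And>j. j \<in> A \<Longrightarrow> c j \<in> D" "\<And>j. j \<in> A \<Longrightarrow> g j \<in> H" "y \<in> H" for A c and g :: "nat \<Rightarrow> 'a" and y
    using that by (induction A) (simp_all add: B_0 B_add B_mult)
  define ON where "ON g k \<longleftrightarrow> (\<forall>i<k. g i \<in> H) \<and> (\<forall>i<k. \<forall>j<k. B (g i) (g j) = (if i = j then e else 0))"
    for g :: "nat \<Rightarrow> 'a" and k
  define good where "good g k r \<longleftrightarrow> r \<in> H \<and> B r r = e \<and> (\<forall>j<k. B r (g j) = 0) \<and>
      x k = (\<Sum>j<k. B (x k) (g j) * g j) + B (x k) r * r" for g :: "nat \<Rightarrow> 'a" and k r
  have step: "\<exists>r. good g k r" if ON: "ON g k" for g k
  proof -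
    have gH: "g i \<in> H" and gg: "B (g i) (g j) = (if i = j then e else 0)" if "i < k" "j < k" for i j
      using ON that by (auto simp: ON_def)
    define R where "R y = y - (\<Sum>j<k. B y (g j) * g j)" for y
    have RH: "R y \<in> H" if "y \<in> H" for y
      unfolding R_def using that gH BD by (intro H_diff H_sum D_mult_H) auto
    have y_R: "y = (\<Sum>j<k. B y (g j) * g j) + R y" for y by (simp add: R_def)
    have BR: "B (R y) (g i) = 0" if y: "y \<in> H" and i: "i < k" for y i
    proof -
      have sH: "(\<Sum>j<k. B y (g j) * g j) \<in> H" using gH BD y by (intro H_sum D_mult_H) auto
      have "B y (g i) = B (\<Sum>j<k. B y (g j) * g j) (g i) + B (R y) (g i)"
        using B_add[OF sH RH[OF y] gH[OF i i]] y_R[of y] by simp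
      also have "B (\<Sum>j<k. B y (g j) * g j) (g i) = (\<Sum>j<k. B y (g j) * B (g j) (g i))"
        using gH BD y i by (intro B_sum) auto
      also have "\<dots> = (\<Sum>j<k. if j = i then B y (g i) else 0)"
        using gg i D_e'[OF BD[OF y gH[OF i i]]] by (intro sum.cong) auto
      also have "\<dots> = B y (g i)" using i by simp
      finally show ?thesis by simp
    qed
    have norm: "\<exists>r z. z \<in> D \<and> r \<in> H \<and> B r r = e \<and> (\<forall>j<k. B r (g j) = 0) \<and> R y = z * r"
      if y: "y \<in> H" and nz: "R y \<noteq> 0" for y
    proof -
      obtain z w where zw: "z \<in> S" "w \<in> S" "z * w = e" "w * B (R y) (R y) * w = e"
        using P_root[OF B_pos(1)[OF RH[OF y]] B_pos(2)[OF RH[OF y] nz]] by metis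
      have zD: "z \<in> D" and wD: "w \<in> D" using zw S_D by blast+
      let ?r = "w * R y"
      have rH: "?r \<in> H" using wD RH[OF y] by simp
      have "B ?r ?r = w * star (w * B (R y) (R y))"
        using B_mult[OF wD RH[OF y] rH] B_mult[OF wD RH[OF y] RH[OF y]] B_star[OF rH RH[OF y]] by simp
      also have "\<dots> = e"
        using zw(4) S_star[OF zw(2)] B_star[OF RH[OF y] RH[OF y]] by (simp add: star_mult mult.assoc)
      finally have "B ?r ?r = e" .
      moreover have "B ?r (g j) = 0" if "j < k" for j
        using B_mult[OF wD RH[OF y] gH[OF that that]] BR[OF y that] by simp
      moreover have "R y = z * ?r" using zw(3) RH[OF y] by (simp add: mult.assoc[symmetric] H_e)
      ultimately show ?thesis using zD rH by blast
    qed
    show ?thesis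
    proof (cases "R (x k) = 0")
      case False
      then obtain r z where r: "z \<in> D" "r \<in> H" "B r r = e" "\<forall>j<k. B r (g j) = 0" "R (x k) = z * r"
        using norm[OF x] by metis
      have rg: "B (g j) r = 0" if "j < k" for j using B_star[of r "g j"] r gH[of j j] that by force
      have sH: "(\<Sum>j<k. B (x k) (g j) * g j) \<in> H" using gH BD x by (intro H_sum D_mult_H) auto
      have "B (x k) r = B (\<Sum>j<k. B (x k) (g j) * g j) r + B (R (x k)) r"
        using B_add[OF sH RH[OF x] r(2), of k] y_R[of "x k"] by simp
      also have "B (\<Sum>j<k. B (x k) (g j) * g j) r = (\<Sum>j<k. B (x k) (g j) * B (g j) r)"
        using gH BD x r by (intro B_sum) auto
      also have "\<dots> = 0" using rg by simp
      also have "B (R (x k)) r = z" using r B_mult[of z r r] by (simp add: D_e')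
      finally have "B (x k) r = z" by simp
      then have "good g k r" unfolding good_def using r y_R[of "x k"] by simp
      then show ?thesis by blast
    next
      case True
      \<comment> \<open>Being orthogonal to the \<open>g j\<close> in the original inner product,
        \<open>u\<close> is no combination of them, whatever \<open>B\<close> is.\<close>
      obtain u where u: "u \<in> H" "u * star u = e" "\<And>y. y \<in> g ` {..<k} \<Longrightarrow> u * star y = 0"
        using gH by (auto intro: unit_avoiding[of "g ` {..<k}"])
      have "R u \<noteq> 0"
      proof
        assume "R u = 0"
        then have "u * star u = (\<Sum>j<k. B u (g j) * g j) * star u" using y_R[of u] by simp
        also have "\<dots> = (\<Sum>j<k. B u (g j) * (g j * star u))" by (simp add: sum_distrib_right mult.assoc)
        also have "\<dots> = 0" using u(3) star_orth by (intro sum.neutral) auto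
        finally show False using u(2) by simp
      qed
      then obtain r z where r: "r \<in> H" "B r r = e" "\<forall>j<k. B r (g j) = 0"
        using norm[OF u(1)] by metis
      have rg: "B (g j) r = 0" if "j < k" for j using B_star[of r "g j"] r gH[of j j] that by force
      have xk: "x k = (\<Sum>j<k. B (x k) (g j) * g j)" using y_R[of "x k"] True by simp
      have "B (x k) r = B (\<Sum>j<k. B (x k) (g j) * g j) r" using xk by simp
      also have "\<dots> = (\<Sum>j<k. B (x k) (g j) * B (g j) r)"
        using gH BD x r by (intro B_sum) auto
      also have "\<dots> = 0" using rg by simp
      finally have "good g k r" unfolding good_def using r xk by simp
      then show ?thesis by blast
    qed
  qed
  have "\<exists>g. \<forall>k. ON g k \<longrightarrow> good g k (g k)"
  \<comment> \<open>Recursive choice: the conditions on stage \<open>k\<close> look only at the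
    earlier \<open>g j\<close>.\<close>
  proof (rule dependent_wf_choice[OF wf_less_than, of "\<lambda>g k r. ON g k \<longrightarrow> good g k r"])
    fix f g :: "nat \<Rightarrow> 'a" and k r
    assume eq: "\<And>z. (z, k) \<in> less_than \<Longrightarrow> f z = g z"
    have "ON f k = ON g k" unfolding ON_def using eq by simp
    moreover have "(\<Sum>j<k. B (x k) (f j) * f j) = (\<Sum>j<k. B (x k) (g j) * g j)"
      using eq by (intro sum.cong) auto
    then have "good f k r = good g k r"
      unfolding good_def using eq by simp
    ultimately show "(ON f k \<longrightarrow> good f k r) = (ON g k \<longrightarrow> good g k r)" by simp
  qed (use step in blast)
  then obtain g where g: "\<And>k. ON g k \<Longrightarrow> good g k (g k)" by blast
  have ON: "ON g k" for k
  proof (induction k)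
    case (Suc k)
    have gk: "g k \<in> H" "B (g k) (g k) = e" "\<And>j. j < k \<Longrightarrow> B (g k) (g j) = 0"
      using g[OF Suc] by (auto simp: good_def)
    moreover have "B (g j) (g k) = 0" if "j < k" for j
      using B_star[of "g k" "g j"] gk Suc that unfolding ON_def by force
    ultimately show ?case using Suc by (auto simp: ON_def less_Suc_eq)
  qed (simp add: ON_def)
  show ?thesis
  proof (rule that)
    show "g k \<in> H" for k using ON[of "Suc k"] by (simp add: ON_def)
    show "B (g k) (g j) = (if k = j then e else 0)" for k j
      using ON[of "Suc (max k j)"] by (simp add: ON_def)
    show "x k = (\<Sum>j\<le>k. B (x k) (g j) * g j)" for k
      using g[OF ON[of k]] by (simp add: good_def lessThan_Suc_atMost[symmetric])
  qed
qed

text \<open>A maximal orthonormal set from Zorn's lemma is infinite by \<open>unit_avoiding\<close>,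
  and countable because its vectors give orthogonal projections \<open>star x * x\<close>, of which
  the factor allows only countable families.\<close>

lemma basis_exists:
  obtains u :: "nat \<Rightarrow> 'a" where "orthonormal u" "\<And>x. x \<in> H \<Longrightarrow> (\<And>i. u i * star x = 0) \<Longrightarrow> x = 0"
proof -
  define \<A> where "\<A> = {M. M \<subseteq> H \<and> (\<forall>x\<in>M. x * star x = e) \<and> (\<forall>x\<in>M. \<forall>y\<in>M. x \<noteq> y \<longrightarrow> x * star y = 0)}"
  have "\<Union>C \<in> \<A>" if C: "subset.chain \<A> C" for C
  proof -
    have sub: "C \<subseteq> \<A>" and lin: "\<And>M N. M \<in> C \<Longrightarrow> N \<in> C \<Longrightarrow> M \<subseteq> N \<or> N \<subseteq> M"
      using C by (auto simp: subset.chain_def)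
    have "x * star y = 0" if xy: "M \<in> C" "N \<in> C" "x \<in> M" "y \<in> N" "x \<noteq> y" for x y M N
    proof -
      obtain L where "L \<in> C" "x \<in> L" "y \<in> L" using lin xy by blast
      then show ?thesis using sub xy(5) by (auto simp: \<A>_def)
    qed
    note 1 = this
    have 2: "M \<subseteq> H" "\<forall>x\<in>M. x * star x = e" if "M \<in> C" for M
      using sub that by (auto simp: \<A>_def)
    show ?thesis
      unfolding \<A>_def
    proof (intro CollectI conjI ballI impI)
      show "\<Union>C \<subseteq> H" using 2 by blast
      show "x * star x = e" if "x \<in> \<Union>C" for x using 2 that by blast
      show "x * star y = 0" if "x \<in> \<Union>C" "y \<in> \<Union>C" "x \<noteq> y" for x y
        using that by (elim UnionE) (rule 1)
    qed
  qed
  then obtain M where M: "M \<in> \<A>" and max: "\<And>N. N \<in> \<A> \<Longrightarrow> M \<subseteq> N \<Longrightarrow> N = M"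
    using subset_Zorn'[of \<A>] by metis
  have MH: "x \<in> H" "x * star x = e" if "x \<in> M" for x using M that by (auto simp: \<A>_def)
  have Mo: "x * star y = 0" if "x \<in> M" "y \<in> M" "x \<noteq> y" for x y using M that by (auto simp: \<A>_def)
  have no_unit: "\<exists>x\<in>M. x * star u \<noteq> 0" if u: "u \<in> H" "u * star u = e" for u
  proof (rule ccontr)
    assume "\<not> ?thesis"
    then have 0: "x * star u = 0" "u * star x = 0" if "x \<in> M" for x using that star_orth by blast+
    then have "insert u M \<in> \<A>" using M u by (auto simp: \<A>_def)
    then have "u \<in> M" using max by blast
    then show False using 0 u by fastforce
  qed
  have complete: "x = 0" if x: "x \<in> H" "\<And>y. y \<in> M \<Longrightarrow> y * star x = 0" for x
  proof (rule ccontr)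
    assume "x \<noteq> 0"
    then obtain w u where u: "u \<in> H" "u * star u = e" "u = w * x"
      using normalize[OF x(1)] by metis
    have "y * star u = 0" if "y \<in> M" for y
      using x(2)[OF that] by (simp add: u(3) star_mult mult.assoc[symmetric])
    then show False using no_unit u by blast
  qed
  have "infinite M"
  proof
    assume "finite M"
    then obtain u where u: "u \<in> H" "u * star u = e" "\<And>x. x \<in> M \<Longrightarrow> u * star x = 0"
      using unit_avoiding[of M] MH by blast
    then show False using no_unit[OF u(1,2)] star_orth by blast
  qed
  have absorb: "x * (star x * x) = x" if "x \<in> M" for x
    using MH[OF that] by (simp add: mult.assoc[symmetric] H_e)
  have kill: "x * (star y * y) = 0" if "x \<in> M" "y \<in> M" "x \<noteq> y" for x y
    using Mo[OF that] by (simp add: mult.assoc[symmetric])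
  have nz: "x \<noteq> 0" if "x \<in> M" for x using MH[OF that] by auto
  have "inj_on (\<lambda>x. star x * x) M"
  proof (rule inj_onI, rule ccontr)
    fix x y assume xy: "x \<in> M" "y \<in> M" "star x * x = star y * y" "x \<noteq> y"
    then have "x = 0" using absorb[of x] kill[of x y] by simp
    then show False using nz xy by blast
  qed
  moreover have "orthogonal_family star ((\<lambda>x. star x * x) ` M)"
    unfolding orthogonal_family_def
  proof (intro conjI ballI impI)
    fix p assume "p \<in> (\<lambda>x. star x * x) ` M"
    then obtain x where x: "x \<in> M" "p = star x * x" by blast
    show "projection star p" using absorb[OF x(1)] by (simp add: x(2) projection_def star_mult star_star mult.assoc)
    show "p \<noteq> 0" using absorb[OF x(1)] nz[OF x(1)] x(2) by auto
    fix q assume "q \<in> (\<lambda>x. star x * x) ` M" "p \<noteq> q"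
    then obtain y where "y \<in> M" "q = star y * y" "x \<noteq> y" using x by blast
    then show "p * q = 0" using kill[of x y] x by (simp add: mult.assoc)
  qed
  ultimately have "countable M"
    using infinite unfolding infinite_factor_def by (metis countable_image_inj_on)
  then have bij: "bij_betw (from_nat_into M) UNIV M" using \<open>infinite M\<close> by (rule bij_betw_from_nat_into)
  show ?thesis
  proof (rule that[of "from_nat_into M"])
    have inM: "from_nat_into M i \<in> M" for i using bij by (auto simp: bij_betw_def)
    show "orthonormal (from_nat_into M)"
    proof (rule orthonormalI)
      show "from_nat_into M i * star (from_nat_into M j) = 0" if "i \<noteq> j" for i j
        using Mo[OF inM inM] bij that by (auto simp: bij_betw_def inj_eq)
    qed (use MH inM in auto)
    show "x = 0" if x: "x \<in> H" "\<And>i. from_nat_into M i * star x = 0" for x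
    proof (rule complete[OF x(1)])
      fix y assume "y \<in> M"
      then obtain i where "y = from_nat_into M i" using bij by (auto simp: bij_betw_def)
      then show "y * star x = 0" using x(2) by simp
    qed
  qed
qed

end

section \<open>The Hilbert space\<close>

text \<open>Completeness and a countable dense set of scalars are assumptions here, so that one
  argument serves all three fields; each of them is checked at the end.\<close>

locale coordinatized = ep_factor star e
  for star :: "'a::ring_1 \<Rightarrow> 'a" and e +
  fixes \<theta> :: "'k::conj_scalar \<Rightarrow> 'a"
  assumes scalar_iso: "scalar_iso \<theta>"
    and scalar_complete: "\<And>f :: nat \<Rightarrow> 'k. Cauchy f \<Longrightarrow> convergent f"
    and scalar_dense: "\<exists>C :: 'k set. countable C \<and> (\<forall>x r. 0 < r \<longrightarrow> (\<exists>c\<in>C. norm (x - c) < r))"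
begin

lemma \<theta>_add: "\<theta> (x + y) = \<theta> x + \<theta> y" and \<theta>_mult: "\<theta> (x * y) = \<theta> x * \<theta> y"
  and \<theta>_1 [simp]: "\<theta> 1 = e" and \<theta>_star: "star (\<theta> x) = \<theta> (sconj x)"
  using scalar_iso by (simp_all add: scalar_iso_def)

lemma \<theta>_D [simp]: "\<theta> x \<in> D"
  using scalar_iso by (auto simp: scalar_iso_def)

lemma \<theta>_0 [simp]: "\<theta> 0 = 0"
  using \<theta>_add[of 0 0] by simp

lemma \<theta>_minus: "\<theta> (- x) = - \<theta> x"
  using \<theta>_add[of x "- x"] by (simp add: eq_neg_iff_add_eq_0 add.commute)

lemma \<theta>_diff: "\<theta> (x - y) = \<theta> x - \<theta> y"
  using \<theta>_add[of x "- y"] by (simp add: \<theta>_minus)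

lemma \<theta>_eq_0_iff [simp]: "\<theta> x = 0 \<longleftrightarrow> x = 0"
proof
  assume 0: "\<theta> x = 0"
  show "x = 0"
  proof (rule ccontr)
    assume "x \<noteq> 0"
    then have "\<theta> x * \<theta> (inverse x) = e" by (simp flip: \<theta>_mult)
    then show False using 0 by simp
  qed
qed simp

lemma \<theta>_inj: "\<theta> x = \<theta> y \<Longrightarrow> x = y"
  using \<theta>_eq_0_iff[of "x - y"] by (simp add: \<theta>_diff)

lemma \<theta>_cases: assumes "d \<in> D" obtains k where "d = \<theta> k"
proof -
  have "d \<in> range \<theta>" using assms scalar_iso by (simp add: scalar_iso_def)
  then show ?thesis using that by blast
qed

definition coef :: "'a \<Rightarrow> 'a \<Rightarrow> 'k" where
  "coef x y = (THE k. \<theta> k = x * star y)"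

lemma \<theta>_coef: assumes "x \<in> H" "y \<in> H" shows "\<theta> (coef x y) = x * star y"
proof -
  obtain k where k: "x * star y = \<theta> k" using \<theta>_cases[OF D_inner[OF assms]] .
  then have "coef x y = k" unfolding coef_def using \<theta>_inj by (intro the_equality) auto
  then show ?thesis using k by simp
qed

lemma coef_eq: "x \<in> H \<Longrightarrow> y \<in> H \<Longrightarrow> x * star y = \<theta> k \<Longrightarrow> coef x y = k"
  using \<theta>_coef \<theta>_inj by metis

lemma sconj_of_real [simp]: "sconj (of_real r :: 'k) = of_real r"
proof (cases "r = 0")
  case True
  have "sconj (0::'k) = 0" using sconj_add[of "0::'k" 0] by simp
  then show ?thesis using True by simp
next
  case False
  have "(of_real r :: 'k) * sconj (of_real r) = of_real r * of_real r"
    using mult_sconj[of "of_real r :: 'k"] by (simp add: power2_eq_square scaleR_conv_of_real)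
  then show ?thesis using False by simp
qed

lemma \<theta>_real_S [simp]: "\<theta> (of_real r) \<in> S"
  by (rule SI) (simp_all add: \<theta>_star)

lemma of_real_commute: "(of_real r :: 'k) * x = x * of_real r"
  by (metis mult_scaleR_left mult_scaleR_right mult_1 mult_1_right of_real_def)

lemma \<theta>_real_commute: assumes "d \<in> D" shows "\<theta> (of_real r) * d = d * \<theta> (of_real r)"
proof -
  obtain k where "d = \<theta> k" using \<theta>_cases[OF assms] .
  then show ?thesis by (simp flip: \<theta>_mult add: of_real_commute)
qed

lemma \<theta>_norm: "\<theta> k * star (\<theta> k) = \<theta> (of_real ((norm k)\<^sup>2))"
  using mult_sconj[of k] by (simp add: \<theta>_star scaleR_conv_of_real flip: \<theta>_mult)

lemma \<theta>_P_iff: "\<theta> (of_real r) \<in> P \<longleftrightarrow> 0 \<le> r"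
proof -
  have pos: "\<theta> (of_real r) \<in> P" if "0 \<le> r" for r
  proof -
    have "\<theta> (of_real r) = \<theta> (of_real (sqrt r)) * star (\<theta> (of_real (sqrt r)))"
      using that \<theta>_norm[of "of_real (sqrt r)"] by simp
    then show ?thesis using P_norm[OF D_H[OF \<theta>_D]] by metis
  qed
  have "0 \<le> r" if "\<theta> (of_real r) \<in> P"
  proof (rule ccontr)
    assume "\<not> 0 \<le> r"
    then have "- \<theta> (of_real r) \<in> P" using pos[of "- r"] by (simp add: \<theta>_minus)
    then have "\<theta> (of_real r) = 0" using P_antisym that by blast
    then show False using \<open>\<not> 0 \<le> r\<close> by simp
  qed
  then show ?thesis using pos by blast
qed

section \<open>The inner product space and its norm\<close>

definition hspace :: "('k, 'a) inner_space" where
  "hspace = \<lparr>carrier = H, monoid.mult = (\<lambda>x y. 0), one = 0, ring.zero = 0, add = (+),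
     module.smult = (\<lambda>k x. \<theta> k * x), ip = coef\<rparr>"

lemma hspace_simps [simp]: "carrier hspace = H" "ring.zero hspace = 0" "add hspace = (+)"
  "module.smult hspace = (\<lambda>k x. \<theta> k * x)" "ip hspace = coef"
  by (simp_all add: hspace_def)

text \<open>A symmetric square root \<open>\<theta> k\<close> of \<open>x * star x\<close> satisfies
  \<open>\<theta> k * star (\<theta> k) = x * star x\<close>, which \<open>mult_sconj\<close>
  evaluates to a nonnegative real number.\<close>

lemma norm_exists: assumes x: "x \<in> H" obtains r where "r \<ge> 0" "coef x x = of_real r" "x \<noteq> 0 \<Longrightarrow> r > 0"
proof -
  obtain z where z: "z \<in> S" "z * z = x * star x" using EP_sqrt[OF x] by metis
  obtain k where k: "z = \<theta> k" using \<theta>_cases[OF S_D[OF z(1)]] .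
  have "x * star x = \<theta> (of_real ((norm k)\<^sup>2))"
    using \<theta>_norm[of k] z S_star[OF z(1)] k by simp
  then have c: "coef x x = of_real ((norm k)\<^sup>2)" by (rule coef_eq[OF x x])
  have "k \<noteq> 0" if "x \<noteq> 0"
  proof
    assume "k = 0"
    then have "x * star x = 0" using z(2) k by (metis \<theta>_0 mult_zero_left)
    then show False using proper that by blast
  qed
  then show ?thesis using that[of "(norm k)\<^sup>2"] c by simp
qed

sublocale hs: left_inner_product_space hspace
proof -
  have ag: "abelian_group hspace"
  proof (rule abelian_groupI)
    show "\<exists>y\<in>carrier hspace. y \<oplus>\<^bsub>hspace\<^esub> x = \<zero>\<^bsub>hspace\<^esub>" if "x \<in> carrier hspace" for x
      using that by (intro bexI[of _ "- x"]) simp_all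
  qed (simp_all add: ac_simps)
  show "left_inner_product_space hspace"
  proof (intro left_inner_product_space.intro ag left_inner_product_space_axioms.intro)
    show "ip hspace (x \<oplus>\<^bsub>hspace\<^esub> y) z = ip hspace x z + ip hspace y z"
      if "x \<in> carrier hspace" "y \<in> carrier hspace" "z \<in> carrier hspace" for x y z
      using that by (simp, intro coef_eq) (simp_all add: \<theta>_add \<theta>_coef distrib_right)
    show "ip hspace (a \<odot>\<^bsub>hspace\<^esub> x) y = a * ip hspace x y"
      if "x \<in> carrier hspace" "y \<in> carrier hspace" for x y a
      using that by (simp, intro coef_eq) (simp_all add: \<theta>_mult \<theta>_coef mult.assoc)
    show "ip hspace y x = sconj (ip hspace x y)"
      if "x \<in> carrier hspace" "y \<in> carrier hspace" for x y
      using that by (simp, intro coef_eq) (simp_all add: \<theta>_star[symmetric] \<theta>_coef star_mult star_star)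
    show "\<exists>r>0. ip hspace x x = of_real r" if "x \<in> carrier hspace" "x \<noteq> \<zero>\<^bsub>hspace\<^esub>" for x
      using norm_exists[of x] that by simp metis
  qed (simp_all add: \<theta>_add \<theta>_mult ring_distribs mult.assoc H_e)
qed

abbreviation hn :: "'a \<Rightarrow> real" where "hn \<equiv> hnorm hspace"

lemma hn_sq: "x \<in> H \<Longrightarrow> x * star x = \<theta> (of_real ((hn x)\<^sup>2))"
  using hs.ip_self[of x] \<theta>_coef[of x x] by simp

lemma hn_eqI: assumes "x \<in> H" "r \<ge> 0" "x * star x = \<theta> (of_real (r\<^sup>2))" shows "hn x = r"
proof -
  have "(of_real ((hn x)\<^sup>2) :: 'k) = of_real (r\<^sup>2)"
    using hn_sq[OF assms(1)] assms(3) by (intro \<theta>_inj) simp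
  then have "(hn x)\<^sup>2 = r\<^sup>2" unfolding of_real_eq_iff .
  then show ?thesis using assms(2) hs.hnorm_nonneg by simp
qed

lemma hn_le_iff: assumes "x \<in> H" "y \<in> H" shows "hn x \<le> hn y \<longleftrightarrow> y * star y - x * star x \<in> P"
proof -
  have "y * star y - x * star x = \<theta> (of_real ((hn y)\<^sup>2 - (hn x)\<^sup>2))"
    using assms by (simp add: hn_sq \<theta>_diff del: of_real_power)
  then show ?thesis unfolding \<theta>_P_iff diff_ge_0_iff_ge
    using power_mono_iff[of "hn x" "hn y" 2] hs.hnorm_nonneg by (simp add: \<theta>_P_iff del: of_real_diff of_real_power)
qed

lemma hn_0 [simp]: "hn 0 = 0" and hn_eq_0_iff: "x \<in> H \<Longrightarrow> hn x = 0 \<longleftrightarrow> x = 0"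
  using hs.hnorm_eq_0_iff by simp_all

lemma hn_triangle: "x \<in> H \<Longrightarrow> y \<in> H \<Longrightarrow> hn (x + y) \<le> hn x + hn y"
  using hs.hnorm_triangle[of x y] by simp

lemma hn_mult: assumes "x \<in> H" shows "hn (\<theta> k * x) = norm k * hn x"
proof (rule hn_eqI)
  have "(\<theta> k * x) * star (\<theta> k * x) = \<theta> k * (x * star x) * star (\<theta> k)" by (simp add: star_mult mult.assoc)
  also have "\<dots> = \<theta> (of_real ((hn x)\<^sup>2)) * (\<theta> k * star (\<theta> k))"
    using \<theta>_real_commute[OF \<theta>_D, of "(hn x)\<^sup>2" k] by (simp add: hn_sq[OF assms] mult.assoc[symmetric])
  also have "\<dots> = \<theta> (of_real ((norm k * hn x)\<^sup>2))"
    unfolding \<theta>_norm \<theta>_mult[symmetric] of_real_mult[symmetric] by (simp add: power_mult_distrib mult.commute)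
  finally show "(\<theta> k * x) * star (\<theta> k * x) = \<theta> (of_real ((norm k * hn x)\<^sup>2))" .
qed (use assms hs.hnorm_nonneg in auto)

lemma hn_minus: "x \<in> H \<Longrightarrow> hn (- x) = hn x"
  using hn_mult[of x "-1"] by (simp add: \<theta>_minus H_e)

lemma hn_diff_commute: "x \<in> H \<Longrightarrow> y \<in> H \<Longrightarrow> hn (x - y) = hn (y - x)"
  using hn_minus[of "x - y"] by simp

lemma hn_diff_triangle: "x \<in> H \<Longrightarrow> y \<in> H \<Longrightarrow> z \<in> H \<Longrightarrow> hn (x - z) \<le> hn (x - y) + hn (y - z)"
  using hn_triangle[of "x - y" "y - z"] by simp

lemma Cauchy_Schwarz_coef: "x \<in> H \<Longrightarrow> y \<in> H \<Longrightarrow> norm (coef x y) \<le> hn x * hn y"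
  using hs.Cauchy_Schwarz[of x y] by simp

lemma coef_add: "x \<in> H \<Longrightarrow> y \<in> H \<Longrightarrow> z \<in> H \<Longrightarrow> coef (x + y) z = coef x z + coef y z"
  using hs.ip_add_left[of x y z] by simp

lemma coef_diff: "x \<in> H \<Longrightarrow> y \<in> H \<Longrightarrow> z \<in> H \<Longrightarrow> coef (x - y) z = coef x z - coef y z"
  using coef_add[of "x - y" y z] by simp

lemma coef_mult: "x \<in> H \<Longrightarrow> y \<in> H \<Longrightarrow> coef (\<theta> k * x) y = k * coef x y"
  using hs.ip_smult_left[of x y k] by simp

lemma coef_adjoint: "x \<in> H \<Longrightarrow> y \<in> H \<Longrightarrow> coef (x * a) y = coef x (y * star a)"
  by (rule coef_eq) (simp_all add: \<theta>_coef star_mult star_star mult.assoc)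

lemma hn_unit: "x \<in> H \<Longrightarrow> x * star x = e \<Longrightarrow> hn x = 1"
  by (rule hn_eqI) simp_all

lemma hn_sum: "(\<And>i. i \<in> A \<Longrightarrow> f i \<in> H) \<Longrightarrow> hn (sum f A) \<le> (\<Sum>i\<in>A. hn (f i))"
  by (induction A rule: infinite_finite_induct) (auto intro: order.trans[OF hn_triangle])

lemma minus_hspace [simp]: "x \<in> H \<Longrightarrow> y \<in> H \<Longrightarrow> x \<ominus>\<^bsub>hspace\<^esub> y = x - y"
  using hs.smult_minus_one[of y] by (simp add: a_minus_def \<theta>_minus H_e)

lemma hdist_eq: "x \<in> H \<Longrightarrow> y \<in> H \<Longrightarrow> hdist hspace x y = hn (x - y)"
  by (simp add: hdist_def)

section \<open>Vectors with dominated coordinates, and completeness\<close>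

lemma expands_scaled:
  "expands f c x \<Longrightarrow> d \<in> D \<Longrightarrow> expands f (\<lambda>i. d * c i) (d * x)"
  by (simp add: expands_def mult.assoc)

text \<open>The other two residue classes modulo 3 supply the auxiliary sequences of
  \<open>dominated_expands\<close>, so \<open>h\<close> may be a complete basis. The dominating
  vector is \<open>M\<close> times a geometric series with ratio \<open>1 / 2\<close>, whose norm
  \<open>sqrt (4 / 3)\<close> is rounded up to 2.\<close>

lemma dominated_vector_3:
  fixes h :: "nat \<Rightarrow> 'a" and c :: "nat \<Rightarrow> 'k"
  assumes h: "orthonormal h" and b: "b < 3" and M: "M > 0" and c: "\<And>i. norm (c i) \<le> M * (1 / 2) ^ i"
  obtains y where "expands (\<lambda>i. h (3 * i + b)) (\<lambda>i. \<theta> (c i)) y" "hn y \<le> 2 * M"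
proof -
  obtain b' b'' where b': "b' < 3" "b'' < 3" "b \<noteq> b'" "b \<noteq> b''" "b' \<noteq> b''"
  proof -
    consider "b = 0" | "b = 1" | "b = 2" using b by linarith
    then show ?thesis
    proof cases
      case 1 then show ?thesis using that[of 1 2] by simp
    next
      case 2 then show ?thesis using that[of 0 2] by simp
    next
      case 3 then show ?thesis using that[of 0 1] by simp
    qed
  qed
  let ?f = "\<lambda>b i. h (3 * i + b)"
  have ON: "orthonormal (?f b)" for b using three_orthonormal(1)[OF h] .
  have orth: "?f b i * star (?f b' j) = 0" "?f b i * star (?f b'' j) = 0" "?f b' i * star (?f b'' j) = 0" for i j
    using three_orthonormal(2)[OF h] b b' by blast+
  define a where "a = \<theta> (of_real (1 / 2))"
  have "a * a = \<theta> (of_real (1 / 2 * (1 / 2)))" by (simp only: a_def \<theta>_mult of_real_mult)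
  moreover have "1 / 2 * (1 / 2) = (1 / 4 :: real)" by simp
  ultimately have aa: "a * a = \<theta> (of_real (1 / 4))" by (simp only:)
  have "\<theta> (of_real 1) - \<theta> (of_real (1 / 4)) = \<theta> (of_real (1 - 1 / 4))"
    by (simp only: \<theta>_diff of_real_diff)
  then have eaa: "e - a * a = \<theta> (of_real (3 / 4))" by (simp only: aa of_real_1 \<theta>_1) simp
  have a: "a \<in> S" "a \<noteq> 0" "a * a \<noteq> e" "e - a * a \<in> P"
  proof -
    show "e - a * a \<in> P" unfolding eaa \<theta>_P_iff by simp
    show "a * a \<noteq> e" using eaa by auto
    show "a \<in> S" unfolding a_def by (rule \<theta>_real_S)
    show "a \<noteq> 0" unfolding a_def \<theta>_eq_0_iff by simp
  qed
  obtain x0 where x0: "expands (?f b) (\<lambda>i. a ^ i * e) x0"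
    using geometric_expands[OF ON[of b] ON[of b'] orth(1) a] by blast
  have x0H: "x0 \<in> H" using expandsD(3)[OF x0] .
  have apow: "a ^ i * e = \<theta> (of_real ((1 / 2) ^ i))" for i
  proof (induction i)
    case (Suc i)
    then show ?case by (simp only: power_Suc mult.assoc \<theta>_mult of_real_mult) (simp only: a_def)
  qed simp
  have "\<theta> (of_real ((hn x0)\<^sup>2 * (3 / 4))) = \<theta> 1"
    using geometric(1)[OF ON[of b] ON[of b'] orth(1) a(1,3) x0]
    unfolding eaa hn_sq[OF x0H] \<theta>_mult[symmetric] of_real_mult[symmetric] by simp
  then have "(of_real ((hn x0)\<^sup>2 * (3 / 4)) :: 'k) = of_real 1"
    unfolding of_real_1 by (rule \<theta>_inj)
  then have "(hn x0)\<^sup>2 * (3 / 4) = 1" unfolding of_real_eq_iff .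
  then have "(hn x0)\<^sup>2 \<le> 2\<^sup>2" by simp
  then have hn0: "hn x0 \<le> 2" by (rule power2_le_imp_le) simp
  define x where "x = \<theta> (of_real M) * x0"
  define \<alpha> where "\<alpha> i = \<theta> (of_real (M * (1 / 2) ^ i))" for i
  have x: "expands (?f b) \<alpha> x"
    using expands_scaled[OF x0 \<theta>_D, of "of_real M"] unfolding x_def apow \<alpha>_def
    by (simp flip: \<theta>_mult of_real_mult del: of_real_power)
  have "\<alpha> i * \<alpha> i - \<theta> (c i) * star (\<theta> (c i)) \<in> P" for i
  proof -
    have "\<alpha> i * \<alpha> i - \<theta> (c i) * star (\<theta> (c i)) = \<theta> (of_real ((M * (1 / 2) ^ i)\<^sup>2 - (norm (c i))\<^sup>2))"
      unfolding \<theta>_norm \<alpha>_def of_real_diff \<theta>_diff \<theta>_mult[symmetric] of_real_mult[symmetric] power2_eq_square ..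
    moreover have "(norm (c i))\<^sup>2 \<le> (M * (1 / 2) ^ i)\<^sup>2" using c by (intro power_mono) auto
    ultimately show ?thesis by (simp only: \<theta>_P_iff diff_ge_0_iff_ge)
  qed
  moreover have "\<alpha> i \<in> S" "\<alpha> i \<noteq> 0" "d \<in> D \<Longrightarrow> \<alpha> i * d = d * \<alpha> i" for i d
    using M \<theta>_real_commute unfolding \<alpha>_def \<theta>_eq_0_iff by (simp_all del: of_real_mult of_real_power)
  ultimately obtain y where y: "expands (?f b) (\<lambda>i. \<theta> (c i)) y" "x * star x - y * star y \<in> P"
    using dominated_expands[OF ON[of b] ON[of b'] ON[of b''] orth x, of "\<lambda>i. \<theta> (c i)"] \<theta>_D by metis
  have "hn y \<le> hn x" using hn_le_iff[of y x] y expandsD(3)[OF x] expandsD(3)[OF y(1)] by simp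
  also have "\<dots> \<le> 2 * M" using hn_mult[OF x0H, of "of_real M"] hn0 M by (simp add: x_def mult.commute)
  finally show ?thesis using that y(1) by blast
qed

text \<open>Thinning out the coordinates keeps their bound, so each residue class contributes a
  vector of norm at most \<open>2 * M\<close>.\<close>

lemma dominated_vector:
  fixes h :: "nat \<Rightarrow> 'a" and c :: "nat \<Rightarrow> 'k"
  assumes h: "orthonormal h" and M: "M > 0" and c: "\<And>i. norm (c i) \<le> M * (1 / 2) ^ i"
  obtains y where "expands h (\<lambda>i. \<theta> (c i)) y" "hn y \<le> 6 * M"
proof -
  have "norm (c (3 * i + b)) \<le> M * (1 / 2) ^ i" for i b
  proof -
    have "(1 / 2 :: real) ^ (3 * i + b) \<le> (1 / 2) ^ i" by (rule power_decreasing) auto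
    then show ?thesis using c[of "3 * i + b"] M by (meson mult_left_mono less_imp_le order.trans)
  qed
  then have "\<exists>y. expands (\<lambda>i. h (3 * i + b)) (\<lambda>i. \<theta> (c (3 * i + b))) y \<and> hn y \<le> 2 * M" if "b < 3" for b
    using dominated_vector_3[OF h that M, of "\<lambda>i. c (3 * i + b)"] by blast
  then obtain y where y: "\<And>b. b < 3 \<Longrightarrow> expands (\<lambda>i. h (3 * i + b)) (\<lambda>i. \<theta> (c (3 * i + b))) (y b)"
      "\<And>b. b < 3 \<Longrightarrow> hn (y b) \<le> 2 * M"
    by metis
  define z where "z = (\<Sum>b<3. y b)"
  have yH: "y b \<in> H" if "b < 3" for b using expandsD(3)[OF y(1)[OF that]] .
  have "y b \<in> cspan (range h)" if "b < 3" for b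
    by (rule cspan_mono[OF expandsD(1)[OF y(1)[OF that]]]) blast
  then have "z \<in> cspan (range h)" unfolding z_def by (intro cspan_sum) auto
  moreover have "z * star (h j) = \<theta> (c j)" for j
  proof -
    define a i where "a = j mod 3" and "i = j div 3"
    have j: "j = 3 * i + a" and a: "a < 3" by (simp_all add: a_def i_def)
    have "y b * star (h j) = (if b = a then \<theta> (c j) else 0)" if "b < 3" for b
    proof (cases "b = a")
      case True
      then show ?thesis using expandsD(2)[OF y(1)[OF a], of i] j by simp
    next
      case False
      have "y b * star (h j) = 0"
      proof (rule cspan_orth[OF expandsD(1)[OF y(1)[OF that]]])
        fix x assume "x \<in> range (\<lambda>i. h (3 * i + b))"
        then show "x * star (h j) = 0" using three_orthonormal(2)[OF h that a False] j by auto
      qed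
      then show ?thesis using False by simp
    qed
    then have "z * star (h j) = (\<Sum>b<3. if b = a then \<theta> (c j) else 0)"
      by (simp add: z_def sum_distrib_right)
    then show ?thesis using a by simp
  qed
  ultimately have "expands h (\<lambda>i. \<theta> (c i)) z" by (simp add: expands_def)
  moreover have "hn z \<le> (\<Sum>b<3. hn (y b))" unfolding z_def by (rule hn_sum) (use yH in auto)
  moreover have "(\<Sum>b<3. hn (y b)) \<le> (\<Sum>b<(3::nat). 2 * M)" using y(2) by (intro sum_mono) auto
  ultimately show ?thesis using that by simp
qed

text \<open>The rate \<open>4^-k\<close> leaves room for a factor \<open>2^-j\<close> in the
  coordinate \<open>j\<close>, as \<open>dominated_vector\<close> requires.\<close>

lemma geometric_subsequence:
  assumes cau: "hs.MCauchy \<sigma>"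
  obtains r :: "nat \<Rightarrow> nat" where "strict_mono r" "\<And>k m. k \<le> m \<Longrightarrow> hn (\<sigma> (r m) - \<sigma> (r k)) \<le> (1 / 4) ^ k"
proof -
  have \<sigma>H: "\<sigma> n \<in> H" for n using cau unfolding hs.MCauchy_def by auto
  have "\<exists>N. \<forall>n n'. N \<le> n \<longrightarrow> N \<le> n' \<longrightarrow> hn (\<sigma> n - \<sigma> n') < (1 / 4) ^ k" for k
  proof -
    have "(0::real) < (1 / 4) ^ k" by simp
    then show ?thesis using cau hdist_eq[OF \<sigma>H \<sigma>H] unfolding hs.MCauchy_def by metis
  qed
  then obtain N where N: "\<And>k n n'. N k \<le> n \<Longrightarrow> N k \<le> n' \<Longrightarrow> hn (\<sigma> n - \<sigma> n') < (1 / 4) ^ k" by metis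
  define r where "r k = (\<Sum>i\<le>k. Suc (N i))" for k
  have sm: "strict_mono r" by (simp add: strict_mono_Suc_iff r_def)
  have "N k \<le> r k" for k unfolding r_def by (cases k) (simp_all)
  then have "hn (\<sigma> (r m) - \<sigma> (r k)) \<le> (1 / 4) ^ k" if "k \<le> m" for k m
    using N[of k "r m" "r k"] strict_mono_less_eq[OF sm, of k m] that by (meson less_imp_le order.trans)
  then show ?thesis using that sm by blast
qed

text \<open>In the basis that orthonormalizes a fast subsequence, coordinates converge to some
  \<open>L j\<close>. \<open>dominated_vector\<close> realizes the errors \<open>L j - c k j\<close>
  as vectors \<open>w k\<close>, and \<open>w k + x k\<close> is the limit, the same for every
  \<open>k\<close>.\<close>

lemma hspace_complete: "hs.mcomplete"
  unfolding hs.mcomplete_def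
proof (intro allI impI)
  fix \<sigma> assume cau: "hs.MCauchy \<sigma>"
  have \<sigma>H: "\<sigma> n \<in> H" for n using cau unfolding hs.MCauchy_def by auto
  obtain r where r: "strict_mono r" "\<And>k m. k \<le> m \<Longrightarrow> hn (\<sigma> (r m) - \<sigma> (r k)) \<le> (1 / 4) ^ k"
    using geometric_subsequence[OF cau] by blast
  define x where "x k = \<sigma> (r k)" for k
  have xH: "x k \<in> H" for k using \<sigma>H by (simp add: x_def)
  have "\<exists>g. (\<forall>k. g k \<in> H) \<and> (\<forall>k j. g k * star (g j) = (if k = j then e else 0)) \<and>
      (\<forall>k. x k = (\<Sum>j\<le>k. x k * star (g j) * g j))" (is "\<exists>g. ?Q g")
  proof (rule gram_schmidt[of "\<lambda>x y. x * star y" x])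
    show "x * star x \<noteq> 0" if "x \<noteq> 0" for x using proper that by blast
    show "\<exists>g. ?Q g" if "\<And>k. g k \<in> H" "\<And>k j. g k * star (g j) = (if k = j then e else 0)"
      "\<And>k. x k = (\<Sum>j\<le>k. x k * star (g j) * g j)" for g using that by blast
  qed (simp_all add: distrib_right mult.assoc star_mult star_star xH)
  then obtain g where g: "\<And>k. g k \<in> H" "\<And>k j. g k * star (g j) = (if k = j then e else 0)"
      and xg: "\<And>k. x k = (\<Sum>j\<le>k. x k * star (g j) * g j)" by blast
  have gON: "orthonormal g" using g by (intro orthonormalI) auto
  define c where "c k j = coef (x k) (g j)" for k j
  have \<theta>c: "\<theta> (c k j) = x k * star (g j)" for k j using \<theta>_coef[OF xH g(1)] by (simp add: c_def)
  have xe: "expands g (\<lambda>j. if j \<in> {..k} then \<theta> (c k j) else 0) (x k)" for k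
    using expands_base_sum[OF gON, of "\<lambda>j. \<theta> (c k j)" "{..k}"] xg[of k] xH g(1) by (simp add: \<theta>c)
  have c0: "c k j = 0" if "k < j" for k j
    using expandsD(2)[OF xe, of k j] that \<theta>c[of k j] by simp
  have xe: "expands g (\<lambda>j. \<theta> (c k j)) (x k)" for k
    using expandsD(1)[OF xe] \<theta>c by (simp add: expands_def)
  have cd: "norm (c m j - c k j) \<le> (1 / 4) ^ k" if "k \<le> m" for k m j
  proof -
    have "c m j - c k j = coef (x m - x k) (g j)" using coef_diff[OF xH xH g(1)] by (simp add: c_def)
    then have "norm (c m j - c k j) \<le> hn (x m - x k) * hn (g j)"
      using Cauchy_Schwarz_coef[of "x m - x k" "g j"] xH g(1) by simp
    also have "hn (g j) = 1" using hn_unit[OF g(1)] g(2) by simp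
    finally show ?thesis using r(2)[OF that] by (simp add: x_def)
  qed
  have "convergent (\<lambda>m. c m j)" for j
  proof (rule scalar_complete, rule metric_CauchyI)
    fix \<epsilon> :: real assume "\<epsilon> > 0"
    then obtain k where k: "(1 / 4 :: real) ^ k < \<epsilon> / 2" using real_arch_pow_inv[of "\<epsilon> / 2" "1 / 4"] by auto
    have "dist (c m j) (c n j) < \<epsilon>" if "m \<ge> k" "n \<ge> k" for m n
    proof -
      have "dist (c m j) (c n j) \<le> dist (c m j) (c k j) + dist (c n j) (c k j)" by (rule dist_triangle2)
      then show ?thesis using cd[OF that(1), of j] cd[OF that(2), of j] k by (simp add: dist_norm)
    qed
    then show "\<exists>M. \<forall>m\<ge>M. \<forall>n\<ge>M. dist (c m j) (c n j) < \<epsilon>" by blast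
  qed
  then obtain L where L: "\<And>j. (\<lambda>m. c m j) \<longlonglongrightarrow> L j" unfolding convergent_def by metis
  have Lc: "norm (L j - c k j) \<le> (1 / 4) ^ k" for j k
  proof (rule tendsto_upperbound)
    show "(\<lambda>m. norm (c m j - c k j)) \<longlonglongrightarrow> norm (L j - c k j)" by (intro tendsto_intros L)
    show "\<forall>\<^sub>F m in sequentially. norm (c m j - c k j) \<le> (1 / 4) ^ k"
      using cd by (auto simp: eventually_sequentially)
  qed simp
  \<comment> \<open>For \<open>j \<le> k\<close>, \<open>4^-k\<close> is split into two factors
    \<open>2^-k\<close>. For \<open>j = Suc i\<close> beyond \<open>k\<close>, the coordinate
    \<open>j\<close> of both \<open>x k\<close> and \<open>x i\<close> is 0, so the smaller error of
    \<open>x i\<close> applies.\<close>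
  have bound: "norm (L j - c k j) \<le> (4 * (1 / 2) ^ k) * (1 / 2) ^ j" for j k
  proof (cases "j \<le> k")
    case True
    have "(1 / 4 :: real) ^ k = (1 / 2) ^ k * (1 / 2) ^ k" by (simp flip: power_mult_distrib)
    also have "\<dots> \<le> (1 / 2) ^ k * (1 / 2) ^ j" using True by (intro mult_left_mono power_decreasing) auto
    also have "\<dots> \<le> (4 * (1 / 2) ^ k) * (1 / 2) ^ j" by simp
    finally show ?thesis using Lc[of j k] by linarith
  next
    case False
    then obtain i where i: "j = Suc i" "k \<le> i" by (cases j) auto
    have "norm (L j - c k j) = norm (L j - c i j)" using c0 False i by simp
    also have "\<dots> \<le> (1 / 4) ^ i" by (rule Lc)
    also have "(1 / 4 :: real) ^ i = (1 / 2) ^ i * (1 / 2) ^ i" by (simp flip: power_mult_distrib)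
    also have "\<dots> \<le> (1 / 2) ^ k * (1 / 2) ^ i" using i by (intro mult_right_mono power_decreasing) auto
    also have "\<dots> \<le> (4 * (1 / 2) ^ k) * (1 / 2) ^ j" using i by simp
    finally show ?thesis .
  qed
  have "\<exists>w. expands g (\<lambda>j. \<theta> (L j - c k j)) w \<and> hn w \<le> 6 * (4 * (1 / 2) ^ k)" for k
    by (rule dominated_vector[OF gON _ bound[of _ k]]) auto
  then obtain w where w: "\<And>k. expands g (\<lambda>j. \<theta> (L j - c k j)) (w k)" "\<And>k. hn (w k) \<le> 6 * (4 * (1 / 2) ^ k)"
    by metis
  have wx: "expands g (\<lambda>j. \<theta> (L j)) (w k + x k)" for k
    using w(1)[of k] xe[of k] by (simp add: expands_def distrib_right \<theta>_diff)
  define y where "y = w 0 + x 0"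
  have yw: "y = w k + x k" for k unfolding y_def using expands_unique[OF wx wx] .
  have yH: "y \<in> H" using expandsD(3)[OF wx[of 0]] by (simp add: y_def)
  have "limitin hs.mtopology (\<sigma> \<circ> r) y sequentially"
    unfolding hs.limit_metric_sequentially
  proof (intro conjI allI impI)
    fix \<epsilon> :: real assume "\<epsilon> > 0"
    then obtain K where K: "(1 / 2 :: real) ^ K < \<epsilon> / 24" using real_arch_pow_inv[of "\<epsilon> / 24" "1 / 2"] by auto
    have "hdist hspace (x n) y < \<epsilon>" if "n \<ge> K" for n
    proof -
      have "hdist hspace (x n) y = hn (y - x n)"
        using hdist_eq[OF xH yH] hn_diff_commute[OF xH yH] by simp
      also have "\<dots> = hn (w n)" using yw[of n] by simp
      also have "\<dots> \<le> 24 * (1 / 2) ^ n" using w(2)[of n] by simp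
      also have "\<dots> \<le> 24 * (1 / 2) ^ K" using that by (intro mult_left_mono power_decreasing) auto
      finally show ?thesis using K by simp
    qed
    then show "\<exists>N. \<forall>n\<ge>N. (\<sigma> \<circ> r) n \<in> carrier hspace \<and> hdist hspace ((\<sigma> \<circ> r) n) y < \<epsilon>"
      using \<sigma>H by (auto simp: x_def)
  qed (use yH in simp)
  then show "\<exists>y. limitin hs.mtopology \<sigma> y sequentially"
    using hs.MCauchy_convergent_subsequence[OF cau r(1)] by blast
qed

sublocale hs: left_hilbert_space hspace
  by unfold_locales (rule hspace_complete)

section \<open>Boundedness of right multiplications\<close>

lemma hn_Cauchy_limit:
  fixes x :: "nat \<Rightarrow> 'a"
  assumes x: "\<And>n. x n \<in> H" and cau: "\<And>\<epsilon>. \<epsilon> > 0 \<Longrightarrow> \<exists>N. \<forall>m\<ge>N. \<forall>n\<ge>N. hn (x m - x n) < \<epsilon>"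
  obtains y where "y \<in> H" "\<And>\<epsilon>. \<epsilon> > 0 \<Longrightarrow> \<exists>N. \<forall>n\<ge>N. hn (x n - y) < \<epsilon>"
proof -
  have "hs.MCauchy x"
    unfolding hs.MCauchy_def
  proof (intro conjI allI impI)
    show "range x \<subseteq> carrier hspace" using x by auto
    fix \<epsilon> :: real assume "\<epsilon> > 0"
    then show "\<exists>N. \<forall>n n'. N \<le> n \<longrightarrow> N \<le> n' \<longrightarrow> hdist hspace (x n) (x n') < \<epsilon>"
      using cau[of \<epsilon>] hdist_eq[OF x x] by (metis (no_types))
  qed
  then obtain y where "limitin hs.mtopology x y sequentially"
    using hspace_complete unfolding hs.mcomplete_def by blast
  then have y: "y \<in> carrier hspace" "\<And>\<epsilon>. \<epsilon> > 0 \<Longrightarrow> \<exists>N. \<forall>n\<ge>N. x n \<in> carrier hspace \<and> hdist hspace (x n) y < \<epsilon>"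
    unfolding hs.limit_metric_sequentially by auto
  then have yH: "y \<in> H" by simp
  show ?thesis
  proof (rule that[OF yH])
    show "\<exists>N. \<forall>n\<ge>N. hn (x n - y) < \<epsilon>" if "\<epsilon> > 0" for \<epsilon>
      using y(2)[OF that] hdist_eq[OF x yH] by (metis (no_types))
  qed
qed

text \<open>
  The gliding hump of Sokal's proof of the uniform boundedness principle: if the vectors
  \<open>w n = z n * star a\<close> grow like \<open>4\<^sup>n\<close>, then \<open>x = \<Sum> \<plusminus> 3\<^sup>-\<^sup>n w n / \<parallel>w n\<parallel>\<close>, with signs chosen
  successively, has \<open>\<bar>\<langle>x a, z n\<rangle>\<bar> = \<bar>\<langle>x, w n\<rangle>\<bar> \<ge> (4/3)\<^sup>n / 2\<close> for all \<open>n\<close>.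
\<close>

lemma bounded_right_mult_star:
  obtains K where "\<And>y. y \<in> H \<Longrightarrow> hn (y * star a) \<le> K * hn y"
proof (rule ccontr)
  assume "\<not> thesis"
  then have "\<exists>y\<in>H. K * hn y < hn (y * star a)" for K
    using that[of K] by (meson not_le)
  then have "\<exists>y\<in>H. 4 ^ n * hn y < hn (y * star a)" for n :: nat by blast
  then obtain z where z: "\<And>n :: nat. z n \<in> H" "\<And>n. 4 ^ n * hn (z n) < hn (z n * star a)" by metis
  define w where "w n = z n * star a" for n
  have wH: "w n \<in> H" for n using z by (simp add: w_def)
  have zpos: "hn (z n) > 0" for n
  proof -
    have "z n \<noteq> 0" using z(2)[of n] by auto
    then show ?thesis using hn_eq_0_iff[OF z(1)] hs.hnorm_nonneg[of "z n"] by (simp add: less_le)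
  qed
  have wpos: "hn (w n) > 0" for n
    using z(2)[of n] zpos[of n] unfolding w_def by (smt (verit) zero_less_power mult_pos_pos)
  define v where "v n = \<theta> (of_real ((1 / 3) ^ n / hn (w n))) * w n" for n
  have vH: "v n \<in> H" for n using wH by (simp add: v_def)
  have hv: "hn (v n) = (1 / 3) ^ n" for n
    unfolding v_def hn_mult[OF wH] norm_of_real using wpos[of n] by simp
  have cv: "norm (coef (v n) (w n)) = (1 / 3) ^ n * hn (w n)" for n
  proof -
    have "coef (w n) (w n) = of_real ((hn (w n))\<^sup>2)" using hs.ip_self[of "w n"] wH by simp
    then have "norm (coef (w n) (w n)) = (hn (w n))\<^sup>2" by (simp del: of_real_power)
    then have "norm (coef (v n) (w n)) = \<bar>(1 / 3) ^ n / hn (w n)\<bar> * (hn (w n))\<^sup>2"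
      unfolding v_def coef_mult[OF wH wH] norm_mult norm_of_real by simp
    then show ?thesis using wpos[of n] by (simp add: power2_eq_square)
  qed
  define x where "x = rec_nat 0 (\<lambda>n x. if norm (coef (x + v n) (w n)) \<ge> (1 / 3) ^ n * hn (w n) then x + v n else x - v n)"
  have x0: "x 0 = 0" and xS: "x (Suc n) = (if norm (coef (x n + v n) (w n)) \<ge> (1 / 3) ^ n * hn (w n) then x n + v n else x n - v n)" for n
    by (simp_all add: x_def)
  have xH: "x n \<in> H" for n by (induction n) (simp_all add: x0 xS vH)
  have step: "hn (x (Suc n) - x n) = (1 / 3) ^ n" for n
    using hv[of n] hn_minus[OF vH, of n] by (simp add: xS)
  \<comment> \<open>The two candidates for \<open>x (Suc n)\<close> differ by
    \<open>2 * v n\<close>, so the inner product of one of them with \<open>w n\<close> is at least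
    as large as that of \<open>v n\<close>.\<close>
  have big: "norm (coef (x (Suc n)) (w n)) \<ge> (1 / 3) ^ n * hn (w n)" for n
  proof (cases "norm (coef (x n + v n) (w n)) \<ge> (1 / 3) ^ n * hn (w n)")
    case True
    then show ?thesis by (simp add: xS)
  next
    case False
    have "coef (x n + v n) (w n) - coef (x n - v n) (w n) = 2 * coef (v n) (w n)"
      using coef_add[OF xH vH wH, of n n n] coef_diff[OF xH vH wH, of n n n] by (simp add: mult_2)
    then have "2 * norm (coef (v n) (w n)) = norm (coef (x n + v n) (w n) - coef (x n - v n) (w n))"
      by (simp add: norm_mult)
    also have "\<dots> \<le> norm (coef (x n + v n) (w n)) + norm (coef (x n - v n) (w n))" by (rule norm_triangle_ineq4)
    finally show ?thesis using False cv[of n] by (simp add: xS)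
  qed
  have dist: "hn (x m - x n) \<le> 3 / 2 * (1 / 3) ^ n" if "n \<le> m" for m n
  proof -
    have "hn (x m - x n) \<le> 3 / 2 * ((1 / 3) ^ n - (1 / 3) ^ m)"
      using that
    proof (induction m rule: dec_induct)
      case (step m)
      have "hn (x (Suc m) - x n) \<le> hn (x (Suc m) - x m) + hn (x m - x n)"
        by (rule hn_diff_triangle) (simp_all add: xH)
      then show ?case using step \<open>\<And>n. hn (x (Suc n) - x n) = (1 / 3) ^ n\<close>[of m] by simp
    qed simp
    also have "\<dots> \<le> 3 / 2 * (1 / 3) ^ n" by simp
    finally show ?thesis .
  qed
  have "\<exists>N. \<forall>m\<ge>N. \<forall>n\<ge>N. hn (x m - x n) < \<epsilon>" if eps: "\<epsilon> > 0" for \<epsilon>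
  proof -
    obtain N where N: "(1 / 3 :: real) ^ N < \<epsilon> / 3" using real_arch_pow_inv[of "\<epsilon> / 3" "1 / 3"] eps by auto
    have "hn (x m - x n) < \<epsilon>" if "m \<ge> N" "n \<ge> N" for m n
    proof -
      have "hn (x m - x n) \<le> hn (x m - x N) + hn (x N - x n)" by (rule hn_diff_triangle) (simp_all add: xH)
      also have "hn (x N - x n) = hn (x n - x N)" by (rule hn_diff_commute) (simp_all add: xH)
      finally show ?thesis using dist[OF that(1)] dist[OF that(2)] N by linarith
    qed
    then show ?thesis by blast
  qed
  then obtain y where y: "y \<in> H" "\<And>\<epsilon>. \<epsilon> > 0 \<Longrightarrow> \<exists>N. \<forall>n\<ge>N. hn (x n - y) < \<epsilon>"
    using hn_Cauchy_limit[of x] xH by blast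
  \<comment> \<open>All steps after \<open>x (Suc n)\<close> add up to half of \<open>3^-n\<close>;
    hence half of the inner product secured by \<open>big\<close> survives in the limit.\<close>
  have lim: "hn (y - x (Suc n)) \<le> 1 / 2 * (1 / 3) ^ n" for n
  proof (rule field_le_epsilon)
    fix \<epsilon> :: real assume "\<epsilon> > 0"
    then obtain N where N: "\<And>m. m \<ge> N \<Longrightarrow> hn (x m - y) < \<epsilon>" using y(2) by blast
    define m where "m = max N (Suc n)"
    have "hn (y - x (Suc n)) \<le> hn (y - x m) + hn (x m - x (Suc n))"
      by (rule hn_diff_triangle) (simp_all add: xH y)
    also have "hn (y - x m) = hn (x m - y)" by (rule hn_diff_commute) (simp_all add: xH y)
    finally show "hn (y - x (Suc n)) \<le> 1 / 2 * (1 / 3) ^ n + \<epsilon>"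
      using N[of m] dist[of "Suc n" m] by (simp add: m_def)
  qed
  have grow: "1 / 2 * (4 / 3) ^ n \<le> hn (y * a)" for n
  proof -
    have "coef (x (Suc n)) (w n) = coef y (w n) - coef (y - x (Suc n)) (w n)"
      using coef_diff[OF y(1) xH wH, of "Suc n" n] by simp
    then have "norm (coef (x (Suc n)) (w n)) \<le> norm (coef y (w n)) + norm (coef (y - x (Suc n)) (w n))"
      by (simp add: norm_triangle_ineq4)
    moreover have "norm (coef (y - x (Suc n)) (w n)) \<le> hn (y - x (Suc n)) * hn (w n)"
      by (rule Cauchy_Schwarz_coef) (simp_all add: y xH wH)
    moreover have "\<dots> \<le> 1 / 2 * (1 / 3) ^ n * hn (w n)"
      using lim[of n] wpos[of n] by (intro mult_right_mono) auto
    ultimately have "1 / 2 * (1 / 3) ^ n * hn (w n) \<le> norm (coef y (w n))"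
      using big[of n] by linarith
    also have "coef y (w n) = coef (y * a) (z n)" using coef_adjoint[OF y(1) z(1), of a n] by (simp add: w_def)
    also have "norm (coef (y * a) (z n)) \<le> hn (y * a) * hn (z n)"
      by (rule Cauchy_Schwarz_coef) (simp_all add: y z)
    finally have 1: "1 / 2 * (1 / 3) ^ n * hn (w n) \<le> hn (y * a) * hn (z n)" .
    have "1 / 2 * (4 / 3) ^ n * hn (z n) = 1 / 2 * (1 / 3) ^ n * (4 ^ n * hn (z n))"
      by (simp add: power_divide)
    also have "\<dots> \<le> 1 / 2 * (1 / 3) ^ n * hn (w n)"
      using z(2)[of n] by (intro mult_left_mono) (auto simp: w_def)
    also note 1
    finally show ?thesis using zpos[of n] by simp
  qed
  obtain n where "2 * hn (y * a) < (4 / 3) ^ n" using real_arch_pow[of "4 / 3"] by auto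
  then show False using grow[of n] by simp
qed

lemma bounded_right_mult: obtains K where "\<And>y. y \<in> H \<Longrightarrow> hn (y * a) \<le> K * hn y"
  using bounded_right_mult_star[of "star a"] by (simp only: star_star) blast

section \<open>Basis expansions, separability and dimension\<close>

lemma Bessel_coef:
  assumes f: "orthonormal f" and y: "y \<in> H" and A: "finite A"
  shows "(\<Sum>i\<in>A. (norm (coef y (f i)))\<^sup>2) \<le> (hn y)\<^sup>2"
proof -
  have "(y * star (f i)) * star (y * star (f i)) = \<theta> (of_real ((norm (coef y (f i)))\<^sup>2))" for i
    using \<theta>_norm[of "coef y (f i)"] \<theta>_coef[OF y orthonormal_H[OF f], of i] by simp
  moreover have "(\<Sum>i\<in>A. \<theta> (of_real (r i))) = \<theta> (of_real (sum r A))" for r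
    using A by (induction A) (simp_all add: \<theta>_add)
  ultimately have "y * star y - (\<Sum>i\<in>A. (y * star (f i)) * star (y * star (f i))) =
      \<theta> (of_real ((hn y)\<^sup>2 - (\<Sum>i\<in>A. (norm (coef y (f i)))\<^sup>2)))"
    by (simp only: hn_sq[OF y] \<theta>_diff of_real_diff)
  then show ?thesis using Bessel[OF f y A] by (simp only: \<theta>_P_iff diff_ge_0_iff_ge)
qed

lemma hn_sum_orthonormal:
  assumes f: "orthonormal f" and A: "finite A"
  shows "(hn (\<Sum>i\<in>A. \<theta> (c i) * f i))\<^sup>2 = (\<Sum>i\<in>A. (norm (c i))\<^sup>2)"
proof -
  let ?x = "\<Sum>i\<in>A. \<theta> (c i) * f i"
  have xH: "?x \<in> H" using f by simp
  have xf: "?x * star (f i) = \<theta> (c i)" if "i \<in> A" for i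
    using expandsD(2)[OF expands_base_sum[OF f, of "\<lambda>i. \<theta> (c i)" A], of i] A that by simp
  have fx: "f i * star ?x = star (\<theta> (c i))" if "i \<in> A" for i
    using arg_cong[OF xf[OF that], of star] by (simp add: star_mult star_star)
  have "?x * star ?x = (\<Sum>i\<in>A. \<theta> (c i) * (f i * star ?x))"
    by (simp only: sum_distrib_right mult.assoc)
  also have "\<dots> = (\<Sum>i\<in>A. \<theta> (of_real ((norm (c i))\<^sup>2)))"
    by (intro sum.cong refl) (simp only: fx \<theta>_norm)
  also have "\<dots> = \<theta> (of_real (\<Sum>i\<in>A. (norm (c i))\<^sup>2))"
    using A by (induction A) (simp_all add: \<theta>_add)
  finally have "\<theta> (of_real ((hn ?x)\<^sup>2)) = \<theta> (of_real (\<Sum>i\<in>A. (norm (c i))\<^sup>2))" using hn_sq[OF xH] by simp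
  then have "(of_real ((hn ?x)\<^sup>2) :: 'k) = of_real (\<Sum>i\<in>A. (norm (c i))\<^sup>2)" by (rule \<theta>_inj)
  then show ?thesis unfolding of_real_eq_iff .
qed

text \<open>Bessel's inequality makes the partial sums a Cauchy sequence, and \<open>x\<close> minus
  their limit is orthogonal to the whole basis.\<close>

lemma basis_expansion:
  fixes u :: "nat \<Rightarrow> 'a"
  assumes u: "orthonormal u" and basis: "\<And>x. x \<in> H \<Longrightarrow> (\<And>i. u i * star x = 0) \<Longrightarrow> x = 0"
    and x: "x \<in> H" and "\<epsilon> > 0"
  obtains n where "hn (x - (\<Sum>i<n. \<theta> (coef x (u i)) * u i)) < \<epsilon>"
proof -
  define c where "c i = coef x (u i)" for i :: nat
  define s where "s n = (\<Sum>i<n. \<theta> (c i) * u i)" for n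
  have sH: "s n \<in> H" for n using u by (simp add: s_def)
  have "summable (\<lambda>i. (norm (c i))\<^sup>2)"
    using Bessel_coef[OF u x, of "{..<_}"] unfolding c_def
    by (intro summableI_nonneg_bounded[where x = "(hn x)\<^sup>2"]) auto
  note summ = this
  have ds: "(hn (s m - s n))\<^sup>2 = (\<Sum>i\<in>{n..<m}. (norm (c i))\<^sup>2)" if "n \<le> m" for m n
  proof -
    have "{n..<m} = {..<m} - {..<n}" by auto
    then have "s m - s n = (\<Sum>i\<in>{n..<m}. \<theta> (c i) * u i)"
      unfolding s_def using that by (simp only: sum_diff finite_lessThan lessThan_subset_iff)
    then show ?thesis using hn_sum_orthonormal[OF u, of "{n..<m}" c] by simp
  qed
  have "\<exists>N. \<forall>m\<ge>N. \<forall>n\<ge>N. hn (s m - s n) < \<epsilon>" if eps: "\<epsilon> > 0" for \<epsilon>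
  proof -
    obtain N where N: "\<And>n m. n \<ge> N \<Longrightarrow> norm (\<Sum>i\<in>{n..<m}. (norm (c i))\<^sup>2) < \<epsilon>\<^sup>2"
      using summ eps unfolding summable_Cauchy by (metis zero_less_power)
    have *: "hn (s m - s n) < \<epsilon>" if "n \<ge> N" "n \<le> m" for m n
    proof -
      have "(hn (s m - s n))\<^sup>2 < \<epsilon>\<^sup>2" using N[OF that(1), of m] ds[OF that(2)] by simp
      then show ?thesis by (rule power2_less_imp_less) (use eps in simp)
    qed
    have "hn (s m - s n) < \<epsilon>" if "m \<ge> N" "n \<ge> N" for m n
      using *[of n m] *[of m n] hn_diff_commute[OF sH sH, of m n] that by (metis nle_le)
    then show ?thesis by blast
  qed
  then obtain y where y: "y \<in> H" "\<And>\<epsilon>. \<epsilon> > 0 \<Longrightarrow> \<exists>N. \<forall>n\<ge>N. hn (s n - y) < \<epsilon>"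
    using hn_Cauchy_limit[of s] sH by blast
  have "coef (x - y) (u i) = 0" for i
  proof -
    have "norm (coef (x - y) (u i)) \<le> 0"
    proof (rule field_le_epsilon)
      fix \<epsilon> :: real assume "\<epsilon> > 0"
      then obtain N where N: "\<And>n. n \<ge> N \<Longrightarrow> hn (s n - y) < \<epsilon>" using y(2) by blast
      define n where "n = max N (Suc i)"
      have "s n * star (u i) = \<theta> (c i)"
        using expandsD(2)[OF expands_base_sum[OF u, of "\<lambda>i. \<theta> (c i)" "{..<n}"], of i]
        by (simp add: s_def n_def less_max_iff_disj)
      then have "coef (s n) (u i) = c i" using sH u by (intro coef_eq) auto
      then have "coef (x - y) (u i) = coef (s n - y) (u i)"
        using coef_diff[OF x y(1)] coef_diff[OF sH y(1)] u by (simp add: c_def)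
      then have "norm (coef (x - y) (u i)) \<le> hn (s n - y) * hn (u i)"
        using Cauchy_Schwarz_coef[of "s n - y" "u i"] sH y(1) u by simp
      also have "hn (u i) = 1" using hn_unit[OF orthonormal_H[OF u] orthonormal_norm[OF u]] .
      finally show "norm (coef (x - y) (u i)) \<le> 0 + \<epsilon>" using N[of n] by (simp add: n_def)
    qed
    then show ?thesis by simp
  qed
  then have "(x - y) * star (u i) = 0" for i
    using \<theta>_coef[of "x - y" "u i"] x y(1) u by simp
  then have "x - y = 0" using basis[of "x - y"] x y(1) star_orth by simp
  then obtain N where "\<forall>n\<ge>N. hn (s n - x) < \<epsilon>" using y(2)[OF \<open>\<epsilon> > 0\<close>] by auto
  then have "hn (x - s N) < \<epsilon>" using hn_diff_commute[OF sH x] by simp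
  then show ?thesis using that unfolding s_def c_def by blast
qed

lemma hspace_separable: "separable hspace"
proof -
  obtain u :: "nat \<Rightarrow> 'a" where u: "orthonormal u" "\<And>x. x \<in> H \<Longrightarrow> (\<And>i. u i * star x = 0) \<Longrightarrow> x = 0"
    using basis_exists by blast
  obtain C :: "'k set" where C: "countable C" "\<And>x r. 0 < r \<Longrightarrow> \<exists>c\<in>C. norm (x - c) < r"
    using scalar_dense by blast
  define s where "s l = (\<Sum>i<length l. \<theta> (l ! i) * u i)" for l :: "'k list"
  have sH: "s l \<in> H" for l using u by (simp add: s_def)
  have "\<exists>y\<in>s ` lists C. y \<in> hs.mball x r" if x: "x \<in> H" and r: "r > 0" for x r
  proof -
    define c where "c i = coef x (u i)" for i
    obtain n where n: "hn (x - (\<Sum>i<n. \<theta> (c i) * u i)) < r / 2"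
      using basis_expansion[OF u x, of "r / 2"] r unfolding c_def by auto
    \<comment> \<open>Half of \<open>r\<close> pays for truncating the expansion, the other half for
      approximating \<open>n\<close> coefficients; \<open>n + 1\<close> also covers
      \<open>n = 0\<close>.\<close>
    have "\<exists>d\<in>C. norm (c i - d) < r / (2 * (real n + 1))" for i using C(2) r by simp
    then obtain d where d: "\<And>i. d i \<in> C" "\<And>i. norm (c i - d i) < r / (2 * (real n + 1))" by metis
    define y where "y = s (map d [0..<n])"
    have y: "y = (\<Sum>i<n. \<theta> (d i) * u i)" by (simp add: y_def s_def)
    have "hn ((\<Sum>i<n. \<theta> (c i) * u i) - y) = hn (\<Sum>i<n. \<theta> (c i - d i) * u i)"
      by (simp add: y sum_subtractf \<theta>_diff left_diff_distrib)
    also have "\<dots> \<le> (\<Sum>i<n. hn (\<theta> (c i - d i) * u i))" using u by (intro hn_sum) simp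
    also have "\<dots> \<le> (\<Sum>i<n. r / (2 * (real n + 1)))"
      using d(2) u hn_unit orthonormal_norm[OF u(1)] by (intro sum_mono) (simp add: hn_mult less_imp_le)
    also have "\<dots> = real n * (r / (2 * (real n + 1)))" by simp
    also have "\<dots> < r / 2" using r by (simp add: field_simps)
    finally have "hn (x - y) < r"
      using n hn_diff_triangle[of x "\<Sum>i<n. \<theta> (c i) * u i" y] x u sH by (simp add: y_def)
    then have "y \<in> hs.mball x r"
      unfolding hs.in_mball using x sH hdist_eq[of x y] by (simp add: y_def)
    moreover have "map d [0..<n] \<in> lists C" using d(1) by (simp add: in_lists_conv_set)
    ultimately show ?thesis unfolding y_def by blast
  qed
  then have "hs.mtopology closure_of (s ` lists C) = topspace hs.mtopology"
    unfolding hs.metric_closure_of hs.topspace_mtopology by auto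
  moreover have "countable (s ` lists C)" using C(1) by (intro countable_image countable_lists)
  moreover have "s ` lists C \<subseteq> topspace hs.mtopology" unfolding hs.topspace_mtopology using sH by auto
  ultimately show ?thesis unfolding separable_def separable_space_def by blast
qed

lemma hspace_infinite_dimensional: "infinite_dimensional hspace"
  unfolding infinite_dimensional_def
proof
  assume "\<exists>G. finite G \<and> G \<subseteq> carrier hspace \<and> linear_subspace hspace hull G = carrier hspace"
  then obtain G where G: "finite G" "G \<subseteq> H" "linear_subspace hspace hull G = H" by auto
  obtain u where u: "u \<in> H" "u * star u = e" "\<And>x. x \<in> G \<Longrightarrow> u * star x = 0"
    using unit_avoiding[OF G(1,2)] by blast
  have "linear_subspace hspace {x \<in> H. x * star u = 0}"
    unfolding linear_subspace_def by (simp add: subset_iff distrib_right mult.assoc)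
  moreover have "G \<subseteq> {x \<in> H. x * star u = 0}" using G(2) u(3) star_orth by blast
  ultimately have "linear_subspace hspace hull G \<subseteq> {x \<in> H. x * star u = 0}" by (intro hull_minimal)
  then have "u * star u = 0" using G(3) u(1) by blast
  then show False using u(2) by simp
qed

section \<open>Bounded operators are right multiplications\<close>

text \<open>
  A strict contraction \<open>T\<close> between two blocks of a basis is a corner of a symmetry in the ring: the
  vectors \<open>T (x i) + s i\<close>, where \<open>s i\<close> lies in a third block and the \<open>s i\<close> have the Gram
  matrix of the positive definite form \<open>B x y = \<langle>x, y\<rangle> - \<langle>T x, T y\<rangle>\<close>, are orthonormal, and
  there is a symmetry exchanging them with the \<open>x i\<close>.
\<close>

lemma contraction_between_blocks:
  fixes u :: "nat \<Rightarrow> 'a"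
  assumes u: "orthonormal u" and abc: "a < 3" "b < 3" "c < 3" "a \<noteq> b" "a \<noteq> c" "b \<noteq> c"
    and T: "\<And>x. x \<in> H \<Longrightarrow> T x \<in> cspan (range (\<lambda>i. u (3 * i + b)))"
    and T_add: "\<And>x y. x \<in> H \<Longrightarrow> y \<in> H \<Longrightarrow> T (x + y) = T x + T y"
    and T_mult: "\<And>d x. d \<in> D \<Longrightarrow> x \<in> H \<Longrightarrow> T (d * x) = d * T x"
    and contr: "\<And>x. x \<in> H \<Longrightarrow> hn (T x) \<le> 1 / 2 * hn x"
  obtains t where "\<And>i. u (3 * i + a) * t = T (u (3 * i + a))"
    "\<And>i a'. a' < 3 \<Longrightarrow> a' \<noteq> a \<Longrightarrow> u (3 * i + a') * t = 0"
proof -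
  let ?u = "\<lambda>a i. u (3 * i + a)"
  have ON: "orthonormal (?u a)" for a using three_orthonormal(1)[OF u] .
  have orth: "?u a i * star (?u a' j) = 0" if "a < 3" "a' < 3" "a \<noteq> a'" for a a' i j
    using three_orthonormal(2)[OF u that] .
  have TH: "T x \<in> H" if "x \<in> H" for x using cspan_H[OF T[OF that]] .
  define B where "B x y = x * star y - T x * star (T y)" for x y
  have BD: "B x y \<in> D" if "x \<in> H" "y \<in> H" for x y using that TH by (simp add: B_def)
  have B_star: "star (B x y) = B y x" for x y by (simp add: B_def star_diff star_mult star_star)
  have B_real: "B x x = \<theta> (of_real ((hn x)\<^sup>2 - (hn (T x))\<^sup>2))" if "x \<in> H" for x
    by (simp only: B_def hn_sq[OF that] hn_sq[OF TH[OF that]] \<theta>_diff of_real_diff)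
  have sq: "(hn (T x))\<^sup>2 \<le> 1 / 4 * (hn x)\<^sup>2" if "x \<in> H" for x
    using power_mono[OF contr[OF that] hs.hnorm_nonneg, of 2] by (simp add: power_mult_distrib power2_eq_square)
  have B_add: "B (x + y) z = B x z + B y z" if "x \<in> H" "y \<in> H" for x y z
    using that by (simp add: B_def T_add distrib_right)
  have B_mult: "B (d * x) y = d * B x y" if "d \<in> D" "x \<in> H" for d x y
    using that by (simp add: B_def T_mult right_diff_distrib mult.assoc)
  define x where "x = ?u a"
  have xH: "x k \<in> H" for k using u by (simp add: x_def)
  have "\<exists>g. (\<forall>k. g k \<in> H) \<and> (\<forall>k j. B (g k) (g j) = (if k = j then e else 0)) \<and>
      (\<forall>k. x k = (\<Sum>j\<le>k. B (x k) (g j) * g j))" (is "\<exists>g. ?Q g")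
  proof (rule gram_schmidt[of B x])
    show "B y y \<in> P" if y: "y \<in> H" for y
      unfolding B_real[OF y] \<theta>_P_iff using sq[OF y] zero_le_power2[of "hn y"] by linarith
    show "B y y \<noteq> 0" if y: "y \<in> H" "y \<noteq> 0" for y
    proof -
      have "hn y > 0" using hn_eq_0_iff[OF y(1)] y(2) hs.hnorm_nonneg[of y] by (simp add: less_le)
      then have "(hn y)\<^sup>2 > 0" by simp
      then have "(hn y)\<^sup>2 - (hn (T y))\<^sup>2 > 0" using sq[OF y(1)] by linarith
      then have "(of_real ((hn y)\<^sup>2 - (hn (T y))\<^sup>2) :: 'k) \<noteq> 0" unfolding of_real_eq_0_iff by linarith
      then show ?thesis unfolding B_real[OF y(1)] \<theta>_eq_0_iff .
    qed
    show "\<exists>g. ?Q g" if "\<And>k. g k \<in> H" "\<And>k j. B (g k) (g j) = (if k = j then e else 0)"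
      "\<And>k. x k = (\<Sum>j\<le>k. B (x k) (g j) * g j)" for g using that by blast
  qed (simp_all add: BD B_star B_add B_mult xH)
  then obtain g where g: "\<And>k. g k \<in> H" "\<And>k j. B (g k) (g j) = (if k = j then e else 0)"
      and xg: "\<And>k. x k = (\<Sum>j\<le>k. B (x k) (g j) * g j)" by blast
  have B_sum: "B (\<Sum>j\<in>A. c j * g j) y = (\<Sum>j\<in>A. c j * B (g j) y)"
    if "finite A" "\<And>j. c j \<in> D" for A c y
    using that(1)
  proof induction
    case empty
    show ?case using B_mult[of 0 0 y] by simp
  next
    case (insert j A)
    have "(\<Sum>j\<in>A. c j * g j) \<in> H" using that(2) g by simp
    then show ?case using insert that(2) g by (simp add: B_add B_mult)
  qed
  have cD: "B (x k) (g j) \<in> D" for k j using BD xH g by simp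
  have c0: "B (x k) (g j) = 0" if "k < j" for k j
  proof -
    have "B (x k) (g j) = (\<Sum>l\<le>k. B (x k) (g l) * B (g l) (g j))"
      using B_sum[of "{..k}" "\<lambda>l. B (x k) (g l)" "g j"] xg[of k] cD by simp
    also have "\<dots> = 0" using that g(2) by (intro sum.neutral) auto
    finally show ?thesis .
  qed
  \<comment> \<open>Replacing the \<open>B\<close>-orthonormal \<open>g j\<close> by the orthonormal
    \<open>?u c j\<close> turns \<open>B\<close> into the inner product. The expansions of the
    \<open>x k\<close> are triangular, so the sums are finite.\<close>
  define s where "s k = (\<Sum>j\<le>k. B (x k) (g j) * ?u c j)" for k
  have sH: "s k \<in> H" for k unfolding s_def using cD u by (intro H_sum D_mult_H) auto
  have s_coef: "s k * star (?u c j) = B (x k) (g j)" for k j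
    using expandsD(2)[OF expands_base_sum[OF ON[of c], of "\<lambda>j. B (x k) (g j)" "{..k}"], of j] cD c0[of k j]
    by (auto simp: s_def not_le)
  have s_cspan: "s k \<in> cspan (range (?u c))" for k
    unfolding s_def using cD u by (intro cspan_sum cspan_mult cspan_base) auto
  have ss: "s i * star (s k) = B (x i) (x k)" for i k
  proof -
    have "s i * star (s k) = (\<Sum>j\<le>k. (s i * star (?u c j)) * star (B (x k) (g j)))"
      by (subst s_def[of k]) (simp add: star_sum star_mult sum_distrib_left mult.assoc)
    also have "\<dots> = (\<Sum>j\<le>k. B (x i) (g j) * B (g j) (x k))" by (simp only: s_coef B_star)
    also have "\<dots> = star (\<Sum>j\<le>k. B (x k) (g j) * B (g j) (x i))" by (simp add: star_sum star_mult B_star)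
    also have "(\<Sum>j\<le>k. B (x k) (g j) * B (g j) (x i)) = B (x k) (x i)"
      using B_sum[of "{..k}" "\<lambda>j. B (x k) (g j)" "x i"] xg[of k] cD by simp
    finally show ?thesis by (simp add: B_star)
  qed
  define v where "v k = T (x k) + s k" for k
  have vH: "v k \<in> H" for k using TH[OF xH] sH by (simp add: v_def)
  have s_b: "s k * star (?u b j) = 0" for k j
    by (rule cspan_orth[OF s_cspan]) (use orth[of c b] abc in auto)
  have s_T: "s k * star (T y) = 0" "T y * star (s k) = 0" if "y \<in> H" for k y
  proof -
    have "T y * star (s k) = 0"
      by (rule cspan_orth[OF T[OF that]]) (use star_orth[OF s_b] in auto)
    then show "s k * star (T y) = 0" "T y * star (s k) = 0" using star_orth by blast+
  qed
  have v: "orthonormal v"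
  proof -
    have vv: "v i * star (v k) = ?u a i * star (?u a k)" for i k
      using s_T[OF xH] ss[of i k] by (simp add: v_def x_def star_add ring_distribs B_def)
    show ?thesis
    proof (rule orthonormalI)
      show "v i * star (v i) = e" for i unfolding vv by (rule orthonormal_norm[OF ON])
      show "v i * star (v j) = 0" if "i \<noteq> j" for i j unfolding vv by (rule orthonormal_orth[OF ON that])
    qed (rule vH)
  qed
  have x: "orthonormal x" using ON by (simp add: x_def)
  have "x i * star (v k) = 0" for i k
  proof -
    have "T (x k) * star (x i) = 0"
      by (rule cspan_orth[OF T[OF xH]]) (use orth[of b a] abc in \<open>auto simp: x_def\<close>)
    moreover have "s k * star (x i) = 0"
      by (rule cspan_orth[OF s_cspan]) (use orth[of c a] abc in \<open>auto simp: x_def\<close>)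
    ultimately have "v k * star (x i) = 0" by (simp add: v_def distrib_right)
    then show ?thesis by (rule star_orth)
  qed
  then obtain w where w: "\<And>i. x i * w = v i" using swap[OF x v] by metis
  obtain p where p: "\<And>y. y \<in> cspan (range (?u a)) \<Longrightarrow> y * p = y"
      "\<And>y. (\<And>z. z \<in> range (?u a) \<Longrightarrow> z * star y = 0) \<Longrightarrow> y * p = 0"
    by (rule cspan_projection[of "range (?u a)"]) blast
  obtain q where q: "\<And>y. y \<in> cspan (range (?u b)) \<Longrightarrow> y * q = y"
      "\<And>y. (\<And>z. z \<in> range (?u b) \<Longrightarrow> z * star y = 0) \<Longrightarrow> y * q = 0"
    by (rule cspan_projection[of "range (?u b)"]) blast
  show ?thesis
  \<comment> \<open>\<open>p\<close> discards the other blocks, and \<open>q\<close> cuts the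
    component \<open>s i\<close> off \<open>v i\<close>.\<close>
  proof (rule that[of "p * w * q"])
    fix i
    have "?u a i * p = ?u a i" by (rule p(1)) (use u in \<open>auto intro: cspan_base\<close>)
    then have "?u a i * (p * w * q) = x i * w * q" by (simp add: x_def mult.assoc[symmetric])
    also have "\<dots> = T (x i) * q + s i * q" by (simp add: w v_def distrib_right)
    also have "T (x i) * q = T (x i)" by (rule q(1)[OF T[OF xH]])
    also have "s i * q = 0" by (rule q(2)) (use star_orth[OF s_b] in auto)
    finally show "?u a i * (p * w * q) = T (?u a i)" by (simp add: x_def)
    fix a' :: nat assume "a' < 3" "a' \<noteq> a"
    then have "?u a' i * p = 0" using orth[of a a'] abc by (intro p(2)) auto
    then show "?u a' i * (p * w * q) = 0" by (simp add: mult.assoc[symmetric])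
  qed
qed

text \<open>Scaled to a contraction, \<open>T\<close> is cut into nine corners between the three
  blocks of a basis. The sum \<open>r\<close> of ring elements for the corners agrees with the
  scaled operator on the basis, and everywhere since both are bounded.\<close>

lemma bounded_is_right_mult:
  assumes TH: "\<And>x. x \<in> H \<Longrightarrow> T x \<in> H"
    and T_add: "\<And>x y. x \<in> H \<Longrightarrow> y \<in> H \<Longrightarrow> T (x + y) = T x + T y"
    and T_mult: "\<And>d x. d \<in> D \<Longrightarrow> x \<in> H \<Longrightarrow> T (d * x) = d * T x"
    and bound: "\<And>x. x \<in> H \<Longrightarrow> hn (T x) \<le> K * hn x"
  obtains a where "\<And>x. x \<in> H \<Longrightarrow> T x = x * a"
proof -
  obtain u :: "nat \<Rightarrow> 'a" where u: "orthonormal u" and basis: "\<And>x. x \<in> H \<Longrightarrow> (\<And>i. u i * star x = 0) \<Longrightarrow> x = 0"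
    using basis_exists by blast
  let ?u = "\<lambda>a i. u (3 * i + a)"
  have ON: "orthonormal (?u a)" for a using three_orthonormal(1)[OF u] .
  have orth: "?u a i * star (?u a' j) = 0" if "a < 3" "a' < 3" "a \<noteq> a'" for a a' i j
    using three_orthonormal(2)[OF u that] .
  have "\<exists>p. projection star p \<and> (\<forall>y\<in>cspan (range (?u a)). y * p = y) \<and> (\<forall>y\<in>H. y * p \<in> cspan (range (?u a))) \<and>
      (\<forall>y. (\<forall>z\<in>range (?u a). z * star y = 0) \<longrightarrow> y * p = 0)" for a
    by (rule cspan_projection[of "range (?u a)"]) blast
  then obtain q where q: "\<And>a. projection star (q a)" "\<And>a y. y \<in> cspan (range (?u a)) \<Longrightarrow> y * q a = y"
      "\<And>a y. y \<in> H \<Longrightarrow> y * q a \<in> cspan (range (?u a))"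
      "\<And>a y. (\<And>z. z \<in> range (?u a) \<Longrightarrow> z * star y = 0) \<Longrightarrow> y * q a = 0"
    by metis
  have hq: "hn (y * q a) \<le> hn y" if "y \<in> H" for y a
    using hn_le_iff[of "y * q a" y] P_projection[OF q(1) that] that by simp
  have q_sum: "(\<Sum>a<3. y * q a) = y" if y: "y \<in> H" for y
  proof -
    have uq: "?u a i * q b = (if a = b then ?u a i else 0)" if "a < 3" "b < 3" for a b i
    proof (cases "a = b")
      case True
      have "?u a i * q a = ?u a i" by (rule q(2)) (use u in \<open>auto intro: cspan_base\<close>)
      then show ?thesis using True by simp
    next
      case False
      have "?u a i * q b = 0" by (rule q(4)) (use orth[of b a] that False in auto)
      then show ?thesis using False by simp
    qed
    have "u j * star (y - (\<Sum>b<3. y * q b)) = 0" for j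
    proof -
      have j: "u j = ?u (j mod 3) (j div 3)" by simp
      have "u j * star (\<Sum>b<3. y * q b) = (\<Sum>b<3. u j * q b) * star y"
        using q(1) by (simp add: star_sum star_mult projection_def sum_distrib_left sum_distrib_right mult.assoc)
      also have "(\<Sum>b<3. u j * q b) = (\<Sum>b<3. if b = j mod 3 then u j else 0)"
        using uq[of "j mod 3" _ "j div 3"] by (intro sum.cong) auto
      also have "\<dots> = u j" by simp
      finally show ?thesis by (simp add: star_diff right_diff_distrib)
    qed
    then have "y - (\<Sum>b<3. y * q b) = 0"
      by (rule basis[rotated]) (use y in \<open>intro H_diff H_sum H_mult_right\<close>)
    then show ?thesis by simp
  qed
  \<comment> \<open>The scaling factor is the inverse of a natural number, so that multiplying by a
    ring element can undo it.\<close>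
  obtain n :: nat where n: "2 * \<bar>K\<bar> < real n" using reals_Archimedean2 by blast
  have n0: "n > 0" using n by (cases n) auto
  define R where "R x = \<theta> (of_real (1 / real n)) * T x" for x
  have RH: "R x \<in> H" if "x \<in> H" for x using TH[OF that] by (simp add: R_def)
  have R_add: "R (x + y) = R x + R y" if "x \<in> H" "y \<in> H" for x y
    using that by (simp add: R_def T_add distrib_left)
  have R_mult: "R (d * x) = d * R x" if "d \<in> D" "x \<in> H" for d x
    using that \<theta>_real_commute[OF that(1), of "1 / real n"] by (simp only: R_def T_mult mult.assoc[symmetric])
  have R_bound: "hn (R x) \<le> 1 / 2 * hn x" if "x \<in> H" for x
  proof -
    have "hn (R x) = 1 / real n * hn (T x)"
      unfolding R_def hn_mult[OF TH[OF that]] norm_of_real by simp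
    also have "\<dots> \<le> 1 / real n * (K * hn x)" using bound[OF that] by (intro mult_left_mono) auto
    also have "\<dots> = (K / real n) * hn x" by simp
    also have "\<dots> \<le> 1 / 2 * hn x"
      using n n0 hs.hnorm_nonneg[of x] by (intro mult_right_mono) (auto simp: field_simps)
    finally show ?thesis .
  qed
  have corner: "\<exists>t. (\<forall>i. ?u a i * t = R (?u a i) * q b) \<and> (\<forall>i a'. a' < 3 \<longrightarrow> a' \<noteq> a \<longrightarrow> ?u a' i * t = 0)"
    if a: "a < 3" and b: "b < 3" for a b
  proof (cases "a = b")
    case False
    obtain c where c: "c < 3" "a \<noteq> c" "b \<noteq> c"
    proof -
      have "\<exists>c<3. a \<noteq> c \<and> b \<noteq> c" using a b by presburger
      then show ?thesis using that by blast
    qed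
    show ?thesis
    proof (rule contraction_between_blocks[OF u a b c(1) False c(2,3), of "\<lambda>x. R x * q b"])
      show "hn (R x * q b) \<le> 1 / 2 * hn x" if "x \<in> H" for x
        using order.trans[OF hq[OF RH[OF that]] R_bound[OF that]] .
    qed (use RH q(3) in \<open>auto simp: R_add R_mult distrib_right mult.assoc\<close>)
  next
    case True
    \<comment> \<open>A diagonal corner is diverted by the symmetry \<open>w\<close> into another
      block \<open>c\<close>, with \<open>c'\<close> as the auxiliary third block, and the result is
      brought back by \<open>w\<close>.\<close>
    obtain c c' where c: "c < 3" "c' < 3" "a \<noteq> c" "a \<noteq> c'" "c \<noteq> c'"
    proof -
      have "\<exists>c<3. \<exists>c'<3. a \<noteq> c \<and> a \<noteq> c' \<and> c \<noteq> c'" using a by presburger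
      then show ?thesis using that by blast
    qed
    obtain w where w: "star w = w" "w * w = 1" "\<And>i. ?u a i * w = ?u c i" "\<And>i. ?u c i * w = ?u a i"
      using swap[OF ON[of a] ON[of c] orth[OF a c(1,3)]] by metis
    have qw: "y * q a * w \<in> cspan (range (?u c))" if y: "y \<in> H" for y
    proof -
      have "expands (?u a) (\<lambda>i. y * q a * star (?u a i)) (y * q a)" using q(3)[OF y] by (simp add: expands_def)
      then have "expands (?u c) (\<lambda>i. y * q a * star (?u a i)) (y * q a * w)"
        by (rule transport_expands(1)[rotated 2]) (use w in auto)
      then show ?thesis by (rule expandsD(1))
    qed
    have hw: "hn (y * w) = hn y" if "y \<in> H" for y
    proof (rule hn_eqI)
      have "(y * w) * star (y * w) = y * (w * w) * star y" by (simp add: star_mult w(1) mult.assoc)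
      then show "(y * w) * star (y * w) = \<theta> (of_real ((hn y)\<^sup>2))" using w(2) hn_sq[OF that] by simp
    qed (use that hs.hnorm_nonneg in auto)
    obtain t where t: "\<And>i. ?u a i * t = R (?u a i) * q a * w" "\<And>i a'. a' < 3 \<Longrightarrow> a' \<noteq> a \<Longrightarrow> ?u a' i * t = 0"
    proof (rule contraction_between_blocks[OF u a c(1,2,3,4,5), of "\<lambda>x. R x * q a * w"])
      show "hn (R x * q a * w) \<le> 1 / 2 * hn x" if x: "x \<in> H" for x
        using order.trans[OF hq[OF RH[OF x], of a] R_bound[OF x]] hw[of "R x * q a"] RH[OF x] by simp
      show "R x * q a * w \<in> cspan (range (?u c))" if "x \<in> H" for x using qw RH that by blast
    qed (auto simp: R_add R_mult distrib_right mult.assoc)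
    have "?u a i * (t * w) = R (?u a i) * q b" for i
    proof -
      have "?u a i * (t * w) = R (?u a i) * q a * (w * w)" by (simp only: mult.assoc[symmetric] t(1))
      then show ?thesis using w(2) True by simp
    qed
    moreover have "?u a' i * (t * w) = 0" if "a' < 3" "a' \<noteq> a" for a' i
      using t(2)[OF that] by (simp add: mult.assoc[symmetric])
    ultimately show ?thesis by blast
  qed
  then obtain t where t: "\<And>a b i. a < 3 \<Longrightarrow> b < 3 \<Longrightarrow> ?u a i * t a b = R (?u a i) * q b"
      "\<And>a b i a'. a < 3 \<Longrightarrow> b < 3 \<Longrightarrow> a' < 3 \<Longrightarrow> a' \<noteq> a \<Longrightarrow> ?u a' i * t a b = 0"
    by metis
  define r where "r = (\<Sum>a<3. \<Sum>b<3. t a b)"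
  have ur: "u j * r = R (u j)" for j
  proof -
    define a i where "a = j mod 3" and "i = j div 3"
    have j: "u j = ?u a i" and a: "a < 3" by (simp_all add: a_def i_def)
    have "u j * r = (\<Sum>a'<3. \<Sum>b<3. u j * t a' b)" by (simp add: r_def sum_distrib_left)
    also have "\<dots> = (\<Sum>a'<3. if a' = a then (\<Sum>b<3. R (u j) * q b) else 0)"
      unfolding j using t a by (intro sum.cong refl) (auto intro!: sum.neutral sum.cong)
    also have "\<dots> = (\<Sum>b<3. R (u j) * q b)" using a by simp
    also have "\<dots> = R (u j)" using u by (intro q_sum RH) simp
    finally show ?thesis .
  qed
  obtain K' where K': "\<And>y. y \<in> H \<Longrightarrow> hn (y * r) \<le> K' * hn y" using bounded_right_mult by blast
  have xr: "x * r = R x" if x: "x \<in> H" for x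
  proof -
    \<comment> \<open>The sum of bounds for right multiplication by \<open>r\<close> and for
      \<open>R\<close>.\<close>
    define M where "M = \<bar>K'\<bar> + 1"
    have M: "M > 0" by (simp add: M_def)
    have "hn (x * r - R x) \<le> 0"
    proof (rule field_le_epsilon)
      fix \<epsilon> :: real assume "\<epsilon> > 0"
      then have "\<epsilon> / M > 0" using M by simp
      then obtain m where m: "hn (x - (\<Sum>i<m. \<theta> (coef x (u i)) * u i)) < \<epsilon> / M"
        using basis_expansion[OF u basis x] by blast
      define y where "y = (\<Sum>i<m. \<theta> (coef x (u i)) * u i)"
      have yH: "y \<in> H" using u by (simp add: y_def)
      have R0: "R 0 = 0" using R_mult[of 0 0] by simp
      have "R (\<Sum>i<m. \<theta> (coef x (u i)) * u i) = (\<Sum>i<m. \<theta> (coef x (u i)) * R (u i))"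
        using u by (induction m) (simp_all add: R0 R_add R_mult)
      then have yr: "y * r = R y" by (simp add: y_def sum_distrib_right mult.assoc ur)
      have "R x = R (x - y) + R y" using R_add[of "x - y" y] x yH by simp
      then have "x * r - R x = (x - y) * r - R (x - y)" using yr by (simp add: algebra_simps)
      also have "hn \<dots> \<le> hn ((x - y) * r) + hn (R (x - y))"
        using hn_triangle[of "(x - y) * r" "- R (x - y)"] hn_minus[of "R (x - y)"] RH[of "x - y"] x yH by simp
      also have "hn ((x - y) * r) \<le> \<bar>K'\<bar> * hn (x - y)"
        using K'[of "x - y"] x yH hs.hnorm_nonneg[of "x - y"] by (meson H_diff abs_ge_self mult_right_mono order.trans)
      also have "hn (R (x - y)) \<le> hn (x - y)"
        using R_bound[of "x - y"] x yH hs.hnorm_nonneg[of "x - y"] by simp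
      also have "\<bar>K'\<bar> * hn (x - y) + hn (x - y) = M * hn (x - y)" by (simp add: M_def algebra_simps)
      also have "\<dots> \<le> \<epsilon>" using m M by (simp add: y_def field_simps)
      finally show "hn (x * r - R x) \<le> 0 + \<epsilon>" by simp
    qed
    moreover have "x * r - R x \<in> H" using x RH by simp
    ultimately have "x * r - R x = 0" using hn_eq_0_iff hs.hnorm_nonneg[of "x * r - R x"] by (metis antisym)
    then show ?thesis by simp
  qed
  have nr: "\<theta> (of_nat m) = of_nat m * e" for m
    by (induction m) (simp_all add: \<theta>_add distrib_right add.commute)
  show ?thesis
  proof (rule that[of "of_nat n * r"])
    fix x assume x: "x \<in> H"
    have "x * (of_nat n * r) = of_nat n * (x * r)" by (metis mult.assoc mult_of_nat_commute)
    also have "\<dots> = \<theta> (of_nat n) * R x"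
      using RH[OF x] by (simp add: xr[OF x] nr mult.assoc H_e)
    also have "\<dots> = \<theta> (of_nat n * of_real (1 / real n)) * T x" by (simp only: R_def \<theta>_mult mult.assoc)
    also have "of_nat n * of_real (1 / real n) = (1 :: 'k)" using n0 by simp
    finally show "T x = x * (of_nat n * r)" using TH[OF x] by (simp add: H_e)
  qed
qed

section \<open>The isomorphism onto the bounded operators\<close>

text \<open>The ring acts from the right, so multiplication by \<open>a\<close> itself would reverse
  products; the star restores their order.\<close>

definition \<phi> :: "'a \<Rightarrow> 'a \<Rightarrow> 'a" where
  "\<phi> a = (\<lambda>x\<in>H. x * star a)"

lemma \<phi>_bounded: "\<phi> a \<in> bounded_operators hspace"
proof -
  obtain K where "\<And>y. y \<in> H \<Longrightarrow> hn (y * star a) \<le> K * hn y" using bounded_right_mult_star by blast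
  then show ?thesis
    by (auto simp: bounded_operators_def \<phi>_def distrib_right mult.assoc)
qed

text \<open>In a factor, only 0 kills all of \<open>e A\<close>.\<close>

lemma \<phi>_inj: "inj \<phi>"
proof (rule injI)
  fix a b assume eq: "\<phi> a = \<phi> b"
  have "e * c * (star a - star b) = 0" for c
    using fun_cong[OF eq, of "e * c"] by (simp add: \<phi>_def right_diff_distrib)
  then have "star a - star b = 0" using factor_annihilator e_nz by blast
  then have "star (star a) = star (star b)" by simp
  then show "a = b" by (simp add: star_star)
qed

lemma \<phi>_surj: assumes T: "T \<in> bounded_operators hspace" obtains a where "T = \<phi> a"
proof -
  have TE: "T \<in> H \<rightarrow>\<^sub>E H" and add: "\<And>x y. x \<in> H \<Longrightarrow> y \<in> H \<Longrightarrow> T (x + y) = T x + T y"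
    and mult: "\<And>k x. x \<in> H \<Longrightarrow> T (\<theta> k * x) = \<theta> k * T x"
    and "\<exists>K. \<forall>x\<in>H. hn (T x) \<le> K * hn x"
    using T by (simp_all add: bounded_operators_def)
  then obtain K where K: "\<And>x. x \<in> H \<Longrightarrow> hn (T x) \<le> K * hn x" by blast
  obtain a where a: "\<And>x. x \<in> H \<Longrightarrow> T x = x * a"
  proof (rule bounded_is_right_mult[of T K])
    show "T (d * x) = d * T x" if "d \<in> D" "x \<in> H" for d x
      using that mult[OF that(2)] by (metis \<theta>_cases)
  qed (use TE add K in auto)
  have "T = \<phi> (star a)"
  proof
    fix x show "T x = \<phi> (star a) x"
      using a TE by (cases "x \<in> H") (auto simp: \<phi>_def star_star)
  qed
  then show ?thesis using that by blast
qed

text \<open>The description needs uniqueness: by \<open>\<phi>_surj\<close> another adjoint is some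
  \<open>\<phi> b\<close>, and each difference of values is orthogonal to itself.\<close>

lemma \<phi>_hadjoint: "\<phi> (star a) = hadjoint hspace (\<phi> a)"
  unfolding hadjoint_def
proof (rule the_equality[symmetric])
  show "\<phi> (star a) \<in> bounded_operators hspace \<and>
      (\<forall>x\<in>carrier hspace. \<forall>y\<in>carrier hspace. ip hspace (\<phi> a x) y = ip hspace x (\<phi> (star a) y))"
    using \<phi>_bounded[of "star a"] coef_adjoint[of _ _ "star a"] by (simp add: \<phi>_def)
  fix T assume T: "T \<in> bounded_operators hspace \<and>
      (\<forall>x\<in>carrier hspace. \<forall>y\<in>carrier hspace. ip hspace (\<phi> a x) y = ip hspace x (T y))"
  then obtain b where b: "T = \<phi> b" using \<phi>_surj by blast
  have "y * star (star a) = y * star b" if y: "y \<in> H" for y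
  proof -
    let ?z = "y * star (star a) - y * star b"
    have z: "?z \<in> H" using y by simp
    have "coef ?z (y * star (star a)) = coef ?z (y * star b)"
      using T y z coef_adjoint[OF z y, of "star a"] by (auto simp: b \<phi>_def)
    then have "?z * star (y * star (star a)) = ?z * star (y * star b)"
      using \<theta>_coef[OF z] y by (metis H_mult_right)
    then have "?z * star ?z = 0" by (simp only: star_diff right_diff_distrib diff_self)
    then have "?z = 0" by (rule proper)
    then show ?thesis by simp
  qed
  then show "T = \<phi> (star a)" by (auto simp: b \<phi>_def)
qed

lemma hspace_isomorphic: "star_isomorphic_operators star hspace"
  unfolding star_isomorphic_operators_def
proof (intro bexI[of _ \<phi>] allI)
  show "\<phi> (star a) = hadjoint hspace (\<phi> a)" for a by (rule \<phi>_hadjoint)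
  have "\<phi> \<in> ring_hom ring_of_type_algebra (operator_ring hspace)"
  proof (rule ring_hom_memI)
    fix a b :: 'a
    show "\<phi> a \<in> carrier (operator_ring hspace)" using \<phi>_bounded by (simp add: operator_ring_def)
    show "\<phi> (a \<otimes>\<^bsub>ring_of_type_algebra\<^esub> b) = \<phi> a \<otimes>\<^bsub>operator_ring hspace\<^esub> \<phi> b"
      by (auto simp: operator_ring_def ring_of_type_algebra_def \<phi>_def compose_def star_mult mult.assoc)
    show "\<phi> (a \<oplus>\<^bsub>ring_of_type_algebra\<^esub> b) = \<phi> a \<oplus>\<^bsub>operator_ring hspace\<^esub> \<phi> b"
      by (auto simp: operator_ring_def ring_of_type_algebra_def \<phi>_def star_add distrib_left)
    show "\<phi> \<one>\<^bsub>ring_of_type_algebra\<^esub> = \<one>\<^bsub>operator_ring hspace\<^esub>"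
      by (auto simp: operator_ring_def ring_of_type_algebra_def \<phi>_def)
  qed
  moreover have "bij_betw \<phi> UNIV (bounded_operators hspace)"
    unfolding bij_betw_def using \<phi>_inj \<phi>_bounded \<phi>_surj by blast
  ultimately show "\<phi> \<in> ring_iso ring_of_type_algebra (operator_ring hspace)"
    by (simp add: ring_iso_def operator_ring_def ring_of_type_algebra_def)
qed

lemma hilbert_space_exists:
  "\<exists>V :: ('k, 'a) inner_space. left_hilbert_space V \<and> infinite_dimensional V \<and> separable V \<and>
    star_isomorphic_operators star V"
  using hs.left_hilbert_space_axioms hspace_infinite_dimensional hspace_separable hspace_isomorphic
  by blast

end

section \<open>Completeness and countable dense sets for the three scalar fields\<close>

lemma second_countable_dense:
  "\<exists>C :: 'k::{real_normed_vector, second_countable_topology} set.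
    countable C \<and> (\<forall>x r. 0 < r \<longrightarrow> (\<exists>c\<in>C. norm (x - c) < r))"
proof -
  obtain C :: "'k set" where C: "countable C" "\<And>U. open U \<Longrightarrow> U \<noteq> {} \<Longrightarrow> \<exists>c\<in>C. c \<in> U"
    using countable_dense_setE by blast
  have "\<exists>c\<in>C. norm (x - c) < r" if "0 < r" for x r
    using C(2)[of "ball x r"] that by (auto simp: dist_norm)
  then show ?thesis using C(1) by blast
qed

lemma quat_component_le: "\<bar>qRe x\<bar> \<le> norm x" "\<bar>qI x\<bar> \<le> norm x" "\<bar>qJ x\<bar> \<le> norm x" "\<bar>qK x\<bar> \<le> norm x"
  unfolding norm_quat_def by (rule real_le_rsqrt; simp)+

lemma quat_norm_le: "norm x \<le> \<bar>qRe x\<bar> + \<bar>qI x\<bar> + \<bar>qJ x\<bar> + \<bar>qK x\<bar>"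
proof -
  have "x = Quat (qRe x) 0 0 0 + Quat 0 (qI x) 0 0 + Quat 0 0 (qJ x) 0 + Quat 0 0 0 (qK x)"
    by (simp add: quat_eq_iff)
  then have "norm x \<le> norm (Quat (qRe x) 0 0 0) + norm (Quat 0 (qI x) 0 0) + norm (Quat 0 0 (qJ x) 0) + norm (Quat 0 0 0 (qK x))"
    by (metis norm_triangle_mono norm_triangle_ineq order_refl)
  then show ?thesis by (simp add: norm_quat_def)
qed

text \<open>The four coordinates are bounded by the norm and their absolute values sum to a bound of
  it, so convergence may be tested on coordinates.\<close>

lemma quat_complete: fixes f :: "nat \<Rightarrow> quat" assumes "Cauchy f" shows "convergent f"
proof -
  have comp: "convergent (\<lambda>n. g (f n))"
    if "\<And>x. \<bar>g x\<bar> \<le> norm x" "\<And>x y. g (x - y) = g x - g y" for g :: "quat \<Rightarrow> real"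
  proof (intro Cauchy_convergent CauchyI)
    fix r :: real assume "0 < r"
    then obtain N where "\<And>m n. m \<ge> N \<Longrightarrow> n \<ge> N \<Longrightarrow> norm (f m - f n) < r" using CauchyD[OF assms] by blast
    then show "\<exists>N. \<forall>m\<ge>N. \<forall>n\<ge>N. norm (g (f m) - g (f n)) < r"
      using that by (metis order_le_less_trans real_norm_def)
  qed
  obtain a b c d where lim: "(\<lambda>n. qRe (f n)) \<longlonglongrightarrow> a" "(\<lambda>n. qI (f n)) \<longlonglongrightarrow> b" "(\<lambda>n. qJ (f n)) \<longlonglongrightarrow> c" "(\<lambda>n. qK (f n)) \<longlonglongrightarrow> d"
    using comp[of qRe] comp[of qI] comp[of qJ] comp[of qK] quat_component_le
    unfolding convergent_def by auto
  have "(\<lambda>n. norm (f n - Quat a b c d)) \<longlonglongrightarrow> 0"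
  proof (rule tendsto_sandwich[OF _ _ tendsto_const])
    show "(\<lambda>n. \<bar>qRe (f n) - a\<bar> + \<bar>qI (f n) - b\<bar> + \<bar>qJ (f n) - c\<bar> + \<bar>qK (f n) - d\<bar>) \<longlonglongrightarrow> 0"
      using tendsto_add[OF tendsto_add[OF tendsto_add[OF
          tendsto_rabs_zero[OF LIM_zero[OF lim(1)]] tendsto_rabs_zero[OF LIM_zero[OF lim(2)]]]
          tendsto_rabs_zero[OF LIM_zero[OF lim(3)]]] tendsto_rabs_zero[OF LIM_zero[OF lim(4)]]] by simp
    show "\<forall>\<^sub>F n in sequentially. norm (f n - Quat a b c d)
        \<le> \<bar>qRe (f n) - a\<bar> + \<bar>qI (f n) - b\<bar> + \<bar>qJ (f n) - c\<bar> + \<bar>qK (f n) - d\<bar>"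
      using quat_norm_le[of "f _ - Quat a b c d"] by simp
  qed simp
  then have "f \<longlonglongrightarrow> Quat a b c d" by (rule LIM_zero_cancel[OF tendsto_norm_zero_cancel])
  then show ?thesis by (auto simp: convergent_def)
qed

lemma quat_dense: "\<exists>C :: quat set. countable C \<and> (\<forall>x r. 0 < r \<longrightarrow> (\<exists>c\<in>C. norm (x - c) < r))"
proof -
  let ?C = "(\<lambda>(a, b, c, d). Quat a b c d) ` (\<rat> \<times> \<rat> \<times> \<rat> \<times> \<rat>)"
  have "\<exists>c\<in>?C. norm (x - c) < r" if r: "0 < r" for x :: quat and r
  proof -
    have near: "\<exists>q\<in>\<rat>. \<bar>t - q\<bar> < r / 4" for t :: real
    proof -
      obtain q where "q \<in> \<rat>" "t - r / 4 < q" "q < t + r / 4"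
        using Rats_dense_in_real[of "t - r / 4" "t + r / 4"] r by auto
      moreover from this have "\<bar>t - q\<bar> < r / 4" by linarith
      ultimately show ?thesis by blast
    qed
    obtain a b c d where abcd: "a \<in> \<rat>" "b \<in> \<rat>" "c \<in> \<rat>" "d \<in> \<rat>"
      "\<bar>qRe x - a\<bar> < r / 4" "\<bar>qI x - b\<bar> < r / 4" "\<bar>qJ x - c\<bar> < r / 4" "\<bar>qK x - d\<bar> < r / 4"
      using near[of "qRe x"] near[of "qI x"] near[of "qJ x"] near[of "qK x"] by blast
    have "norm (x - Quat a b c d) < r" using quat_norm_le[of "x - Quat a b c d"] abcd by simp
    then show ?thesis using abcd by force
  qed
  moreover have "countable ?C" by (intro countable_image countable_SIGMA countable_rat)
  ultimately show ?thesis by blast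
qed

theorem theorem2p1:
  fixes star :: "'a::ring_1 \<Rightarrow> 'a"
  assumes "baer_star_factor star"
    and "infinite_factor star"
    and "type_I star"
    and "EP_axiom star"
  shows
    "(\<exists>H :: (real, 'a) inner_space.
        left_hilbert_space H \<and> infinite_dimensional H \<and> separable H \<and>
        star_isomorphic_operators star H) \<or>
     (\<exists>H :: (complex, 'a) inner_space.
        left_hilbert_space H \<and> infinite_dimensional H \<and> separable H \<and>
        star_isomorphic_operators star H) \<or>
     (\<exists>H :: (quat, 'a) inner_space.
        left_hilbert_space H \<and> infinite_dimensional H \<and> separable H \<and>
        star_isomorphic_operators star H)"
proof -
  obtain e where "minimal_projection star e" using assms(3) by (auto simp: type_I_def)
  then have ep: "ep_factor star e"
    using assms by (intro ep_factor.intro ep_factor_axioms.intro)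
  interpret ep_factor star e by (rule ep)
  from scalar_iso_exists show ?thesis
  proof (elim disjE exE)
    fix \<theta> :: "real \<Rightarrow> 'a" assume "scalar_iso \<theta>"
    then interpret coordinatized star e \<theta>
      by unfold_locales (rule Cauchy_convergent second_countable_dense | assumption)+
    show ?thesis using hilbert_space_exists by blast
  next
    fix \<theta> :: "complex \<Rightarrow> 'a" assume "scalar_iso \<theta>"
    then interpret coordinatized star e \<theta>
      by unfold_locales (rule Cauchy_convergent second_countable_dense | assumption)+
    show ?thesis using hilbert_space_exists by blast
  next
    fix \<theta> :: "quat \<Rightarrow> 'a" assume "scalar_iso \<theta>"
    then interpret coordinatized star e \<theta>
      by unfold_locales (rule quat_complete quat_dense | assumption)+
    show ?thesis using hilbert_space_exists by blast
  qed
qed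

end
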